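(* Let $\alpha>1$ be a constant, let $(M^{m},g)$ be a compact Riemannian manifold of dimension $m>2$, let $(N^{n},h)$ be a Riemannian manifold, and let $\psi:(M,g)\to(N,h)$ be a non-degenerate smooth map. Then $\psi:(M,g)\to(N,h)$ is $\alpha$-harmonic if and only if $\psi:(M,\bar g)\to(N,h)$ is harmonic, where $\bar g$ is the metric conformally related to $g$ defined by $$\bar g=\left\{(2\alpha)^{\frac{2}{m-2}}\,(1+|d\psi|^{2})^{\frac{2\alpha-2}{m-2}}\right\}g,$$ with $|d\psi|$ the Hilbert–Schmidt norm of $d\psi$ with respect to $g$ and $h$.
   Context: For a smooth map $\psi:(M,g)\to(N,h)$ between Riemannian manifolds, $\nabla$ denotes the connection on the pullback bundle $\psi^{-1}TN$ induced from the Levi-Civita connection of $N$ (so $\nabla_Y V=\nabla^N_{d\psi(Y)}V$). The tension field of $\psi$ is $\tau(\psi)=\mathrm{Tr}_g\nabla d\psi\in\Gamma(\psi^{-1}TN)$, and $\psi$ is harmonic if $\tau(\psi)=0$. For a constant $\alpha>1$, the $\alpha$-energy functional is $E_\alpha(\psi)=\int_M(1+|d\psi|^2)^\alpha\,dV_g$; $\psi$ is $\alpha$-harmonic if it is a critical point of $E_\alpha$ (with respect to smooth variations of $\psi$). The corresponding Euler–Lagrange equation is $\tau_\alpha(\psi)=0$, where $\tau_\alpha(\psi)=2\alpha(1+|d\psi|^2)^{\alpha-1}\tau(\psi)+d\psi\big(\mathrm{grad}(2\alpha(1+|d\psi|^2)^{\alpha-1})\big)$. The map $\psi$ is called non-degenerate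 if its differential has trivial kernel at each point, i.e. $\ker d\psi_p=\{0\}$ for all $p\in M$. *)

theory Defs
  imports "HOL-Analysis.Analysis"
begin

section \<open>Smooth maps between open subsets of Euclidean spaces\<close>

primrec C_k_on :: "nat \<Rightarrow> 'a::euclidean_space set \<Rightarrow> ('a \<Rightarrow> 'b::euclidean_space) \<Rightarrow> bool" where
  "C_k_on 0 S f \<longleftrightarrow> continuous_on S f"
| "C_k_on (Suc k) S f \<longleftrightarrow>
     (\<forall>x\<in>S. f differentiable (at x)) \<and> (\<forall>v. C_k_on k S (\<lambda>x. frechet_derivative f (at x) v))"

text \<open>Only meaningful for open \<open>S\<close>; all uses below are of this kind.\<close>

definition smooth_on :: "'a::euclidean_space set \<Rightarrow> ('a \<Rightarrow> 'b::euclidean_space) \<Rightarrow> bool" where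
  "smooth_on S f \<longleftrightarrow> (\<forall>k. C_k_on k S f)"

definition pd :: "'m::finite \<Rightarrow> (real^'m \<Rightarrow> 'b::euclidean_space) \<Rightarrow> real^'m \<Rightarrow> 'b" where
  "pd i f x = frechet_derivative f (at x) (axis i 1)"


section \<open>Manifolds and tangent vectors\<close>

text \<open>A chart is a pair of its domain and its coordinate map. The dimension of a manifold is
  the cardinality of the index type of its model space. The atlas need not be maximal.\<close>

type_synonym ('a, 'm) chart = "'a set \<times> ('a \<Rightarrow> (real, 'm) vec)"

record ('a, 'm) manifold =
  topo :: "'a topology"
  atlas :: "('a, 'm) chart set"

definition chart_inv :: "('a, 'm::finite) chart \<Rightarrow> real^'m \<Rightarrow> 'a" where
  "chart_inv c = inv_into (fst c) (snd c)"

definition chart_image :: "('a, 'm::finite) chart \<Rightarrow> (real^'m) set" where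
  "chart_image c = snd c ` fst c"

definition local_rep ::
    "('a, 'm::finite) chart \<Rightarrow> ('b, 'n::finite) chart \<Rightarrow> ('a \<Rightarrow> 'b) \<Rightarrow> real^'m \<Rightarrow> real^'n" where
  "local_rep c d f = (\<lambda>x. snd d (f (chart_inv c x)))"

definition smooth_manifold :: "('a, 'm::finite) manifold \<Rightarrow> bool" where
  "smooth_manifold M \<longleftrightarrow>
     Hausdorff_space (topo M) \<and> second_countable (topo M) \<and>
     topspace (topo M) = (\<Union>c\<in>atlas M. fst c) \<and>
     (\<forall>c\<in>atlas M. openin (topo M) (fst c) \<and> open (chart_image c) \<and>
        homeomorphic_map (subtopology (topo M) (fst c)) (top_of_set (chart_image c)) (snd c)) \<and>
     (\<forall>c\<in>atlas M. \<forall>c'\<in>atlas M. smooth_on (snd c ` (fst c \<inter> fst c')) (local_rep c c' id))"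

definition charts_at :: "('a, 'm::finite) manifold \<Rightarrow> 'a \<Rightarrow> ('a, 'm) chart set" where
  "charts_at M p = {c \<in> atlas M. p \<in> fst c}"

definition smooth_map ::
    "('a, 'm::finite) manifold \<Rightarrow> ('b, 'n::finite) manifold \<Rightarrow> ('a \<Rightarrow> 'b) \<Rightarrow> bool" where
  "smooth_map M N f \<longleftrightarrow>
     continuous_map (topo M) (topo N) f \<and>
     (\<forall>c\<in>atlas M. \<forall>d\<in>atlas N.
        smooth_on (snd c ` {p \<in> fst c. f p \<in> fst d}) (local_rep c d f))"

text \<open>A tangent vector at \<open>p\<close> assigns to each chart around \<open>p\<close> the components of the vector in
  that chart, subject to the contravariant transformation law. Vector space operations are
  pointwise; the value at a chart not containing \<open>p\<close> is fixed to \<open>0\<close>, so that the zero vector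
  is \<open>\<lambda>_. 0\<close>.\<close>

type_synonym ('a, 'm) tangent_vec = "('a, 'm) chart \<Rightarrow> (real, 'm) vec"

definition tangent_space :: "('a, 'm::finite) manifold \<Rightarrow> 'a \<Rightarrow> ('a, 'm) tangent_vec set" where
  "tangent_space M p = {v.
     (\<forall>c\<in>charts_at M p. \<forall>c'\<in>charts_at M p.
        v c' = frechet_derivative (local_rep c c' id) (at (snd c p)) (v c)) \<and>
     (\<forall>c. c \<notin> charts_at M p \<longrightarrow> v c = 0)}"

text \<open>The coordinate vector field \<open>\<partial>\<^sub>i\<close> of the chart \<open>c\<close> at \<open>p\<close>.\<close>

definition coord_vec ::
    "('a, 'm::finite) manifold \<Rightarrow> ('a, 'm) chart \<Rightarrow> 'a \<Rightarrow> 'm \<Rightarrow> ('a, 'm) tangent_vec" where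
  "coord_vec M c p i = (\<lambda>c'. if c' \<in> charts_at M p
     then frechet_derivative (local_rep c c' id) (at (snd c p)) (axis i 1) else 0)"

text \<open>By the chain rule and the transformation law, the differential does not depend on the
  chart chosen at \<open>p\<close>.\<close>

definition differential ::
    "('a, 'm::finite) manifold \<Rightarrow> ('b, 'n::finite) manifold \<Rightarrow> ('a \<Rightarrow> 'b) \<Rightarrow> 'a
      \<Rightarrow> ('a, 'm) tangent_vec \<Rightarrow> ('b, 'n) tangent_vec" where
  "differential M N f p v = (let c = (SOME c. c \<in> charts_at M p) in
     (\<lambda>d. if d \<in> charts_at N (f p)
        then frechet_derivative (local_rep c d f) (at (snd c p)) (v c) else 0))"

definition nondegenerate ::
    "('a, 'm::finite) manifold \<Rightarrow> ('b, 'n::finite) manifold \<Rightarrow> ('a \<Rightarrow> 'b) \<Rightarrow> bool" where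
  "nondegenerate M N f \<longleftrightarrow>
     (\<forall>p\<in>topspace (topo M).
        {v \<in> tangent_space M p. differential M N f p v = (\<lambda>_. 0)} = {\<lambda>_. 0})"


section \<open>Riemannian metrics\<close>

type_synonym ('a, 'm) metric = "'a \<Rightarrow> ('a, 'm) tangent_vec \<Rightarrow> ('a, 'm) tangent_vec \<Rightarrow> real"

text \<open>The matrix \<open>(g\<^sub>i\<^sub>j)\<close> in the chart \<open>c\<close>, as a function of the coordinates.\<close>

definition metric_matrix ::
    "('a, 'm::finite) manifold \<Rightarrow> ('a, 'm) metric \<Rightarrow> ('a, 'm) chart \<Rightarrow> real^'m \<Rightarrow> real^'m^'m" where
  "metric_matrix M g c x = (let p = chart_inv c x in
     (\<chi> i j. g p (coord_vec M c p i) (coord_vec M c p j)))"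

definition riemannian_metric :: "('a, 'm::finite) manifold \<Rightarrow> ('a, 'm) metric \<Rightarrow> bool" where
  "riemannian_metric M g \<longleftrightarrow>
     (\<forall>p\<in>topspace (topo M).
        (\<forall>u\<in>tangent_space M p. \<forall>v\<in>tangent_space M p. g p u v = g p v u) \<and>
        (\<forall>u\<in>tangent_space M p. \<forall>v\<in>tangent_space M p. \<forall>w\<in>tangent_space M p. \<forall>r.
           g p (\<lambda>c. r *\<^sub>R u c + v c) w = r * g p u w + g p v w) \<and>
        (\<forall>u\<in>tangent_space M p. u \<noteq> (\<lambda>_. 0) \<longrightarrow> g p u u > 0)) \<and>
     (\<forall>c\<in>atlas M. smooth_on (chart_image c) (metric_matrix M g c))"

definition riemannian_manifold :: "('a, 'm::finite) manifold \<Rightarrow> ('a, 'm) metric \<Rightarrow> bool" where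
  "riemannian_manifold M g \<longleftrightarrow> smooth_manifold M \<and> riemannian_metric M g"

text \<open>The Riemannian measure: the Borel measure given by \<open>sqrt (det g\<^sub>i\<^sub>j) dx\<close> in every chart.
  On a Riemannian manifold such a measure exists and, by second countability, is unique.\<close>

definition is_riemannian_measure ::
    "('a, 'm::finite) manifold \<Rightarrow> ('a, 'm) metric \<Rightarrow> 'a measure \<Rightarrow> bool" where
  "is_riemannian_measure M g \<mu> \<longleftrightarrow>
     space \<mu> = topspace (topo M) \<and>
     sets \<mu> = sigma_sets (topspace (topo M)) {U. openin (topo M) U} \<and>
     (\<forall>c\<in>atlas M. \<forall>A\<in>sets \<mu>. A \<subseteq> fst c \<longrightarrow>
        emeasure \<mu> A =
          (\<integral>\<^sup>+x\<in>snd c ` A. ennreal (sqrt (det (metric_matrix M g c x))) \<partial>lborel))"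

definition riemannian_measure ::
    "('a, 'm::finite) manifold \<Rightarrow> ('a, 'm) metric \<Rightarrow> 'a measure" where
  "riemannian_measure M g = (SOME \<mu>. is_riemannian_measure M g \<mu>)"

text \<open>Indexed by \<open>'m\<close>, hence a basis of the \<open>CARD('m)\<close>-dimensional tangent space.\<close>

definition orthonormal_basis ::
    "('a, 'm::finite) manifold \<Rightarrow> ('a, 'm) metric \<Rightarrow> 'a \<Rightarrow> ('m \<Rightarrow> ('a, 'm) tangent_vec) \<Rightarrow> bool" where
  "orthonormal_basis M g p e \<longleftrightarrow>
     (\<forall>i. e i \<in> tangent_space M p) \<and> (\<forall>i j. g p (e i) (e j) = (if i = j then 1 else 0))"

text \<open>The Hilbert--Schmidt norm of the differential at \<open>p\<close>; it does not depend on the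
  orthonormal basis.\<close>

definition hs_norm ::
    "('a, 'm::finite) manifold \<Rightarrow> ('a, 'm) metric \<Rightarrow> ('b, 'n::finite) manifold \<Rightarrow> ('b, 'n) metric
      \<Rightarrow> ('a \<Rightarrow> 'b) \<Rightarrow> 'a \<Rightarrow> real" where
  "hs_norm M g N h f p = (let e = (SOME e. orthonormal_basis M g p e) in
     sqrt (\<Sum>i\<in>UNIV. h (f p) (differential M N f p (e i)) (differential M N f p (e i))))"


section \<open>Harmonic maps\<close>

text \<open>The Christoffel symbol \<open>\<Gamma>\<^sup>k\<^sub>i\<^sub>j\<close> of the Levi-Civita connection in the chart \<open>c\<close>.\<close>

definition christoffel ::
    "('a, 'm::finite) manifold \<Rightarrow> ('a, 'm) metric \<Rightarrow> ('a, 'm) chart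
      \<Rightarrow> real^'m \<Rightarrow> 'm \<Rightarrow> 'm \<Rightarrow> 'm \<Rightarrow> real" where
  "christoffel M g c x k i j = (let G = metric_matrix M g c in
     (\<Sum>l\<in>UNIV. matrix_inv (G x) $ k $ l *
        (pd i G x $ j $ l + pd j G x $ i $ l - pd l G x $ i $ j)) / 2)"

text \<open>Components of \<open>\<nabla>\<^bsub>\<partial>\<^sub>i\<^esub> V\<close> for a section \<open>V\<close> of the pullback of the tangent bundle of \<open>N\<close>
  along \<open>f\<close>, where \<open>V\<close> is given by its components with respect to the frame of \<open>d\<close> as a function
  of the coordinates of \<open>c\<close>.\<close>

definition pullback_conn ::
    "('b, 'n::finite) manifold \<Rightarrow> ('b, 'n) metric \<Rightarrow> ('a, 'm::finite) chart \<Rightarrow> ('b, 'n) chart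
      \<Rightarrow> ('a \<Rightarrow> 'b) \<Rightarrow> 'm \<Rightarrow> (real^'m \<Rightarrow> real^'n) \<Rightarrow> real^'m \<Rightarrow> real^'n" where
  "pullback_conn N h c d f i V x = (let F = local_rep c d f in
     pd i V x +
     (\<chi> a. \<Sum>b\<in>UNIV. \<Sum>b'\<in>UNIV. christoffel N h d (F x) a b b' * pd i F x $ b * V x $ b'))"

text \<open>Components of \<open>(\<nabla>df)(\<partial>\<^sub>i, \<partial>\<^sub>j) = \<nabla>\<^bsub>\<partial>\<^sub>i\<^esub> (df \<partial>\<^sub>j) - df (\<nabla>\<^bsub>\<partial>\<^sub>i\<^esub> \<partial>\<^sub>j)\<close>.\<close>

definition second_fundamental_form ::
    "('a, 'm::finite) manifold \<Rightarrow> ('a, 'm) metric \<Rightarrow> ('b, 'n::finite) manifold \<Rightarrow> ('b, 'n) metric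
      \<Rightarrow> ('a, 'm) chart \<Rightarrow> ('b, 'n) chart \<Rightarrow> ('a \<Rightarrow> 'b) \<Rightarrow> 'm \<Rightarrow> 'm \<Rightarrow> real^'m \<Rightarrow> real^'n" where
  "second_fundamental_form M g N h c d f i j x = (let F = local_rep c d f in
     pullback_conn N h c d f i (pd j F) x
       - (\<Sum>k\<in>UNIV. christoffel M g c x k i j *\<^sub>R pd k F x))"

text \<open>Components of \<open>Tr\<^sub>g \<nabla>df\<close> in the frame of \<open>d\<close>. The components in different charts
  represent the same tangent vector of \<open>N\<close>, so their vanishing at a point does not depend on
  the charts.\<close>

definition tension_field ::
    "('a, 'm::finite) manifold \<Rightarrow> ('a, 'm) metric \<Rightarrow> ('b, 'n::finite) manifold \<Rightarrow> ('b, 'n) metric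
      \<Rightarrow> ('a, 'm) chart \<Rightarrow> ('b, 'n) chart \<Rightarrow> ('a \<Rightarrow> 'b) \<Rightarrow> real^'m \<Rightarrow> real^'n" where
  "tension_field M g N h c d f x =
     (\<Sum>i\<in>UNIV. \<Sum>j\<in>UNIV. matrix_inv (metric_matrix M g c x) $ i $ j *\<^sub>R
        second_fundamental_form M g N h c d f i j x)"

definition harmonic ::
    "('a, 'm::finite) manifold \<Rightarrow> ('a, 'm) metric \<Rightarrow> ('b, 'n::finite) manifold \<Rightarrow> ('b, 'n) metric
      \<Rightarrow> ('a \<Rightarrow> 'b) \<Rightarrow> bool" where
  "harmonic M g N h f \<longleftrightarrow>
     (\<forall>p\<in>topspace (topo M). \<forall>c\<in>charts_at M p. \<forall>d\<in>charts_at N (f p).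
        tension_field M g N h c d f (snd c p) = 0)"


section \<open>\<open>\<alpha>\<close>-harmonic maps\<close>

definition alpha_energy ::
    "real \<Rightarrow> ('a, 'm::finite) manifold \<Rightarrow> ('a, 'm) metric
      \<Rightarrow> ('b, 'n::finite) manifold \<Rightarrow> ('b, 'n) metric \<Rightarrow> ('a \<Rightarrow> 'b) \<Rightarrow> real" where
  "alpha_energy \<alpha> M g N h f =
     (\<integral>p. (1 + (hs_norm M g N h f p)\<^sup>2) powr \<alpha> \<partial>riemannian_measure M g)"

text \<open>\<open>F\<close> restricts to a smooth map from the product manifold \<open>(-\<epsilon>, \<epsilon>) \<times> M\<close> to \<open>N\<close> with
  \<open>F 0 = f\<close> on \<open>M\<close>.\<close>

definition smooth_variation ::
    "('a, 'm::finite) manifold \<Rightarrow> ('b, 'n::finite) manifold \<Rightarrow> ('a \<Rightarrow> 'b) \<Rightarrow> real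
      \<Rightarrow> (real \<Rightarrow> 'a \<Rightarrow> 'b) \<Rightarrow> bool" where
  "smooth_variation M N f \<epsilon> F \<longleftrightarrow>
     continuous_map (prod_topology (top_of_set {-\<epsilon><..<\<epsilon>}) (topo M)) (topo N) (\<lambda>(t, p). F t p) \<and>
     (\<forall>c\<in>atlas M. \<forall>d\<in>atlas N.
        smooth_on {(t, x). t \<in> {-\<epsilon><..<\<epsilon>} \<and> x \<in> chart_image c \<and> F t (chart_inv c x) \<in> fst d}
          (\<lambda>(t, x). local_rep c d (F t) x)) \<and>
     (\<forall>p\<in>topspace (topo M). F 0 p = f p)"

text \<open>Critical points of the \<open>\<alpha>\<close>-energy. Variations are not required to have compact support;
  the notion is intended for compact \<open>M\<close>.\<close>

definition alpha_harmonic ::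
    "real \<Rightarrow> ('a, 'm::finite) manifold \<Rightarrow> ('a, 'm) metric
      \<Rightarrow> ('b, 'n::finite) manifold \<Rightarrow> ('b, 'n) metric \<Rightarrow> ('a \<Rightarrow> 'b) \<Rightarrow> bool" where
  "alpha_harmonic \<alpha> M g N h f \<longleftrightarrow>
     (\<forall>\<epsilon>>0. \<forall>F. smooth_variation M N f \<epsilon> F \<longrightarrow>
        ((\<lambda>t. alpha_energy \<alpha> M g N h (F t)) has_real_derivative 0) (at 0))"

end

theory Submission
  imports Defs
begin

text \<open>In coordinates, the first variation of the \<open>\<alpha>\<close>-energy in the direction \<open>V\<close> is minus the integral
  of \<open>V\<^sup>a T\<^sub>a\<close>, where \<open>T\<^sub>a = \<partial>\<^sub>k (w \<surd>g g\<^sup>k\<^sup>l h\<^sub>a\<^sub>b \<partial>\<^sub>l\<psi>\<^sup>b) - (w / 2) \<surd>g g\<^sup>k\<^sup>l (\<partial>\<^sub>a h\<^sub>b\<^sub>c) \<partial>\<^sub>k\<psi>\<^sup>b \<partial>\<^sub>l\<psi>\<^sup>c\<close> and the weight is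
  \<open>w = 2\<alpha>(1 + |d\<psi>|\<^sup>2)\<^bsup>\<alpha>-1\<^esup>\<close>. Under a conformal change by \<open>\<lambda>\<close> the matrix \<open>\<surd>g g\<^sup>k\<^sup>l\<close> is multiplied by
  \<open>\<lambda>\<^bsup>(m-2)/2\<^esup>\<close>, and for the conformal factor of the theorem this is exactly \<open>w\<close>. So \<open>T\<^sub>a\<close> is the
  Euler--Lagrange expression of the ordinary energy for the new metric, that is, its volume density times
  the tension field with lowered index, and no conformal transformation law of Christoffel symbols is
  needed. If \<open>T\<close> vanishes, an arbitrary variation is decomposed by a partition of unity into variations
  supported in charts, for which the divergence term integrates to zero; if \<open>T\<close> does not vanish at a
  point, a bump function supported near that point yields a variation with nonzero derivative.\<close>

section \<open>Calculus of smooth maps\<close>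

text \<open>Three features of the definitions shape the proof. The Riemannian measure and the
  orthonormal basis behind the Hilbert-Schmidt norm are chosen by \<open>SOME\<close>, so a measure
  has to be constructed, and both notions need expressions in charts, before the energy can be
  computed at all. Next, \<open>alpha_harmonic\<close> asks for the derivative of the energy along
  every variation; differentiating under the integral requires a bound on the time derivative of the
  integrand that is uniform over M for small times, and compactness supplies it. Finally, N has no
  linear structure, so a variation cannot be multiplied by a cutoff function; its time parameter is
  multiplied pointwise instead, which has the same effect on the variation field at time 0. The
  exponent (m - 2)/2 of the overview is m/2 from the square root of the determinant minus 1 from the
  inverse matrix, and solving for the conformal factor divides by m - 2.\<close>

named_theorems smooth_intros

section \<open>Functions of class C^k\<close>

lemma has_derivative_cong_open:
  assumes "open S" "x \<in> S" "\<And>y. y \<in> S \<Longrightarrow> f y = g y"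
  shows "(f has_derivative f') (at x) \<longleftrightarrow> (g has_derivative f') (at x)"
  using assms has_derivative_transform_within_open[of f f' x UNIV S g]
    has_derivative_transform_within_open[of g f' x UNIV S f] by auto

lemma frechet_derivative_cong_open:
  assumes "open S" "x \<in> S" "\<And>y. y \<in> S \<Longrightarrow> f y = g y"
  shows "frechet_derivative f (at x) = frechet_derivative g (at x)"
  unfolding frechet_derivative_def using has_derivative_cong_open[OF assms] by simp

lemma frechet_derivative_eqI: "(f has_derivative f') (at x) \<Longrightarrow> frechet_derivative f (at x) = f'"
  using frechet_derivative_at by metis

lemma pd_cong_open:
  assumes "open S" "x \<in> S" "\<And>y. y \<in> S \<Longrightarrow> f y = g y"
  shows "pd i f x = pd i g x"
  unfolding pd_def using frechet_derivative_cong_open[OF assms] by simp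

lemma pd_eqI: "(f has_derivative f') (at x) \<Longrightarrow> pd i f x = f' (axis i 1)"
  unfolding pd_def by (simp add: frechet_derivative_eqI)

lemma C_k_on_cong:
  assumes "open S" "\<And>x. x \<in> S \<Longrightarrow> f x = g x"
  shows "C_k_on k S f \<longleftrightarrow> C_k_on k S g"
  using assms(2)
proof (induction k arbitrary: f g)
  case 0
  then show ?case by (simp cong: continuous_on_cong)
next
  case (Suc k)
  have "\<And>x. x \<in> S \<Longrightarrow> f differentiable (at x) \<longleftrightarrow> g differentiable (at x)"
    unfolding differentiable_def using has_derivative_cong_open[OF assms(1), of _ f g] Suc.prems by simp
  moreover have "\<And>v. C_k_on k S (\<lambda>x. frechet_derivative f (at x) v)
      \<longleftrightarrow> C_k_on k S (\<lambda>x. frechet_derivative g (at x) v)"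
    using frechet_derivative_cong_open[OF assms(1), of _ f g] Suc.prems by (intro Suc.IH) simp
  ultimately show ?case by auto
qed

lemma C_k_on_subset: "C_k_on k S f \<Longrightarrow> T \<subseteq> S \<Longrightarrow> C_k_on k T f"
  by (induction k arbitrary: f) (auto intro: continuous_on_subset)

text \<open>Derivatives in \<open>C_k_on\<close> are taken at \<open>x\<close> in the full space, so
  every clause of the definition depends only on \<open>f\<close> near \<open>x\<close>.\<close>

lemma C_k_on_locally:
  assumes "\<And>x. x \<in> S \<Longrightarrow> \<exists>U. open U \<and> x \<in> U \<and> C_k_on k U f"
  shows "C_k_on k S f"
  using assms
proof (induction k arbitrary: f)
  case 0
  have "isCont f x" if "x \<in> S" for x
    using 0[OF that] by (auto simp: continuous_on_eq_continuous_at)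
  then show ?case by (simp add: continuous_at_imp_continuous_on)
next
  case (Suc k)
  have "f differentiable (at x)" if "x \<in> S" for x
    using Suc.prems[OF that] by auto
  moreover have "C_k_on k S (\<lambda>x. frechet_derivative f (at x) v)" for v
  proof (rule Suc.IH)
    fix x assume "x \<in> S"
    then obtain U where "open U" "x \<in> U" "C_k_on (Suc k) U f" using Suc.prems[of x] by auto
    then show "\<exists>U. open U \<and> x \<in> U \<and> C_k_on k U (\<lambda>x. frechet_derivative f (at x) v)"
      by (intro exI[of _ U]) simp
  qed
  ultimately show ?case by simp
qed

lemma C_k_on_SucD: "C_k_on (Suc k) S f \<Longrightarrow> C_k_on k S f"
proof (induction k arbitrary: f)
  case 0
  then show ?case
    by (simp add: continuous_at_imp_continuous_on differentiable_imp_continuous_within)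
next
  case (Suc k)
  have "C_k_on k S (\<lambda>x. frechet_derivative f (at x) v)" for v
    by (rule Suc.IH[OF C_k_on.simps(2)[THEN iffD1, OF Suc.prems, THEN conjunct2, THEN spec]])
  with C_k_on.simps(2)[THEN iffD1, OF Suc.prems, THEN conjunct1]
  show ?case unfolding C_k_on.simps(2)[of k] by blast
qed

lemma C_k_on_SucI:
  assumes "open S" "\<And>x. x \<in> S \<Longrightarrow> (f has_derivative f' x) (at x)"
    "\<And>v. C_k_on k S (\<lambda>x. f' x v)"
  shows "C_k_on (Suc k) S f"
proof -
  have "C_k_on k S (\<lambda>x. frechet_derivative f (at x) v)" for v
    using assms(3)[of v] C_k_on_cong[OF assms(1), of "\<lambda>x. frechet_derivative f (at x) v" "\<lambda>x. f' x v"]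
      frechet_derivative_eqI[OF assms(2)] by simp
  then show ?thesis using assms(2) by (auto simp: differentiable_def)
qed

lemma C_k_on_has_derivative:
  "C_k_on (Suc k) S f \<Longrightarrow> x \<in> S \<Longrightarrow> (f has_derivative frechet_derivative f (at x)) (at x)"
  by (simp add: frechet_derivative_works)

lemma C_k_on_const: "open S \<Longrightarrow> C_k_on k S (\<lambda>x. c)"
proof (induction k arbitrary: c)
  case (Suc k)
  show ?case by (rule C_k_on_SucI[where f' = "\<lambda>x v. 0"]) (use Suc in auto)
qed simp

lemma C_k_on_linear:
  assumes "bounded_linear L" "open S" "C_k_on k S f"
  shows "C_k_on k S (\<lambda>x. L (f x))"
  using assms(3)
proof (induction k arbitrary: f)
  case 0
  then show ?case using assms by (simp add: bounded_linear.continuous_on)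
next
  case (Suc k)
  show ?case
    by (rule C_k_on_SucI[where f' = "\<lambda>x v. L (frechet_derivative f (at x) v)"])
       (use Suc assms C_k_on_has_derivative[OF Suc.prems] in
         \<open>auto intro: bounded_linear.has_derivative\<close>)
qed

lemma C_k_on_add:
  assumes "open S" "C_k_on k S f" "C_k_on k S g"
  shows "C_k_on k S (\<lambda>x. f x + g x)"
  using assms(2,3)
proof (induction k arbitrary: f g)
  case 0
  then show ?case by (simp add: continuous_on_add)
next
  case (Suc k)
  show ?case
    by (rule C_k_on_SucI[where f' = "\<lambda>x v. frechet_derivative f (at x) v + frechet_derivative g (at x) v"])
       (use Suc assms C_k_on_has_derivative[OF Suc.prems(1)] C_k_on_has_derivative[OF Suc.prems(2)] in
         \<open>auto intro: has_derivative_add\<close>)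
qed

lemma C_k_on_sum:
  assumes "open S" "\<And>i. i \<in> I \<Longrightarrow> C_k_on k S (f i)"
  shows "C_k_on k S (\<lambda>x. \<Sum>i\<in>I. f i x)"
  using assms(2)
  by (induction I rule: infinite_finite_induct) (simp_all add: C_k_on_const C_k_on_add assms(1))

lemma C_k_on_bilinear:
  assumes "bounded_bilinear B" "open S" "C_k_on k S f" "C_k_on k S g"
  shows "C_k_on k S (\<lambda>x. B (f x) (g x))"
  using assms(3,4)
proof (induction k arbitrary: f g)
  case 0
  then show ?case using assms by (simp add: bounded_bilinear.continuous_on)
next
  case (Suc k)
  show ?case
  proof (rule C_k_on_SucI[OF assms(2)])
    fix x assume "x \<in> S"
    then show "((\<lambda>x. B (f x) (g x)) has_derivative
      (\<lambda>v. B (f x) (frechet_derivative g (at x) v) + B (frechet_derivative f (at x) v) (g x))) (at x)"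
      by (intro bounded_bilinear.FDERIV[OF assms(1)] C_k_on_has_derivative[OF Suc.prems(1)]
          C_k_on_has_derivative[OF Suc.prems(2)])
  next
    fix v
    show "C_k_on k S (\<lambda>x. B (f x) (frechet_derivative g (at x) v) + B (frechet_derivative f (at x) v) (g x))"
      using Suc.prems by (intro C_k_on_add assms Suc.IH C_k_on_SucD[OF Suc.prems(1)]
          C_k_on_SucD[OF Suc.prems(2)]) auto
  qed
qed

lemma C_k_on_compose:
  assumes "open S" "open T" "C_k_on k T g" "C_k_on k S f" "f ` S \<subseteq> T"
  shows "C_k_on k S (\<lambda>x. g (f x))"
  using assms(3,4,5)
proof (induction k arbitrary: f g)
  case 0
  then show ?case by (auto intro: continuous_on_compose2)
next
  case (Suc k)
  show ?case
  proof (rule C_k_on_SucI[OF assms(1)])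
    fix x assume x: "x \<in> S"
    have A: "((\<lambda>x. g (f x)) has_derivative
        (\<lambda>v. frechet_derivative g (at (f x)) (frechet_derivative f (at x) v))) (at x)"
      using has_derivative_compose[OF C_k_on_has_derivative[OF Suc.prems(2) x]]
        C_k_on_has_derivative[OF Suc.prems(1), of "f x"] x Suc.prems(3) by auto
    \<comment> \<open>\<open>C_k_on\<close> controls derivatives in fixed directions, but here the
      direction, the derivative of \<open>f\<close> applied to \<open>v\<close>, moves with
      \<open>x\<close>. Expanding it in the basis leaves fixed directions \<open>b\<close> with
      scalar coefficients, so the induction hypothesis applies to each summand.\<close>
    have rep: "frechet_derivative g (at (f x)) w = (\<Sum>b\<in>Basis. (w \<bullet> b) *\<^sub>R frechet_derivative g (at (f x)) b)" for w
    proof -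
      have "linear (frechet_derivative g (at (f x)))"
        using C_k_on_has_derivative[OF Suc.prems(1), of "f x"] x Suc.prems(3) has_derivative_linear by blast
      then have "frechet_derivative g (at (f x)) (\<Sum>b\<in>Basis. (w \<bullet> b) *\<^sub>R b)
          = (\<Sum>b\<in>Basis. (w \<bullet> b) *\<^sub>R frechet_derivative g (at (f x)) b)"
        by (simp add: linear_sum linear_cmul)
      then show ?thesis by (simp add: euclidean_representation)
    qed
    have B: "(\<lambda>v. frechet_derivative g (at (f x)) (frechet_derivative f (at x) v)) =
        (\<lambda>v. \<Sum>b\<in>Basis. (frechet_derivative f (at x) v \<bullet> b) *\<^sub>R frechet_derivative g (at (f x)) b)"
      by (rule ext) (rule rep)
    show "((\<lambda>x. g (f x)) has_derivative
        (\<lambda>v. \<Sum>b\<in>Basis. (frechet_derivative f (at x) v \<bullet> b) *\<^sub>R frechet_derivative g (at (f x)) b)) (at x)"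
      by (rule has_derivative_eq_rhs[OF A B])
  next
    fix v
    have "C_k_on k S (\<lambda>x. frechet_derivative g (at (f x)) b)" for b
      by (rule Suc.IH[of "\<lambda>y. frechet_derivative g (at y) b"])
         (use Suc.prems C_k_on_SucD[OF Suc.prems(2)] in auto)
    then show "C_k_on k S (\<lambda>x. \<Sum>b\<in>Basis. (frechet_derivative f (at x) v \<bullet> b) *\<^sub>R frechet_derivative g (at (f x)) b)"
      using Suc.prems
      by (intro C_k_on_sum C_k_on_bilinear[OF bounded_bilinear_scaleR] assms(1)
          C_k_on_linear[OF bounded_linear_inner_left]) auto
  qed
qed

section \<open>Smooth functions and their closure properties\<close>

lemma smooth_on_cong:
  "open S \<Longrightarrow> (\<And>x. x \<in> S \<Longrightarrow> f x = g x) \<Longrightarrow> smooth_on S f \<longleftrightarrow> smooth_on S g"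
  unfolding smooth_on_def using C_k_on_cong[of S f g] by simp

lemma smooth_on_subset: "smooth_on S f \<Longrightarrow> T \<subseteq> S \<Longrightarrow> smooth_on T f"
  unfolding smooth_on_def using C_k_on_subset by blast

lemma smooth_on_locally:
  "(\<And>x. x \<in> S \<Longrightarrow> \<exists>U. open U \<and> x \<in> U \<and> smooth_on U f) \<Longrightarrow> smooth_on S f"
  unfolding smooth_on_def by (intro allI C_k_on_locally) blast

lemma smooth_on_imp_continuous_on: "smooth_on S f \<Longrightarrow> continuous_on S f"
  unfolding smooth_on_def by (metis C_k_on.simps(1))

lemma smooth_on_has_derivative:
  "smooth_on S f \<Longrightarrow> x \<in> S \<Longrightarrow> (f has_derivative frechet_derivative f (at x)) (at x)"
  unfolding smooth_on_def by (metis C_k_on_has_derivative)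

lemma smooth_on_imp_differentiable: "smooth_on S f \<Longrightarrow> x \<in> S \<Longrightarrow> f differentiable (at x)"
  using smooth_on_has_derivative differentiable_def by blast

lemma smooth_on_frechet_derivative:
  "smooth_on S f \<Longrightarrow> smooth_on S (\<lambda>x. frechet_derivative f (at x) v)"
  unfolding smooth_on_def by (metis C_k_on.simps(2))

lemma smooth_on_pd [smooth_intros]: "smooth_on S f \<Longrightarrow> smooth_on S (pd i f)"
  unfolding pd_def[abs_def] by (rule smooth_on_frechet_derivative)

lemma smooth_on_const [smooth_intros]: "open S \<Longrightarrow> smooth_on S (\<lambda>x. c)"
  unfolding smooth_on_def by (simp add: C_k_on_const)

lemma smooth_on_linear: "bounded_linear L \<Longrightarrow> open S \<Longrightarrow> smooth_on S f \<Longrightarrow> smooth_on S (\<lambda>x. L (f x))"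
  unfolding smooth_on_def by (simp add: C_k_on_linear)

lemma smooth_on_ident [smooth_intros]:
  assumes "open S" shows "smooth_on S (\<lambda>x. x)"
  unfolding smooth_on_def
proof
  fix k show "C_k_on k S (\<lambda>x. x)"
  proof (cases k)
    case (Suc k)
    show ?thesis unfolding Suc
      by (rule C_k_on_SucI[where f' = "\<lambda>x v. v"]) (auto simp: assms C_k_on_const)
  qed simp
qed

lemma smooth_on_bounded_linear: "bounded_linear L \<Longrightarrow> open S \<Longrightarrow> smooth_on S L"
  by (rule smooth_on_linear[OF _ _ smooth_on_ident])

lemma smooth_on_add [smooth_intros]:
  "open S \<Longrightarrow> smooth_on S f \<Longrightarrow> smooth_on S g \<Longrightarrow> smooth_on S (\<lambda>x. f x + g x)"
  unfolding smooth_on_def by (simp add: C_k_on_add)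

lemma smooth_on_minus [smooth_intros]: "open S \<Longrightarrow> smooth_on S f \<Longrightarrow> smooth_on S (\<lambda>x. - f x)"
  by (rule smooth_on_linear[OF bounded_linear_minus[OF bounded_linear_ident]])

lemma smooth_on_diff [smooth_intros]:
  "open S \<Longrightarrow> smooth_on S f \<Longrightarrow> smooth_on S g \<Longrightarrow> smooth_on S (\<lambda>x. f x - g x)"
  using smooth_on_add[OF _ _ smooth_on_minus, of S f g] by simp

lemma smooth_on_sum [smooth_intros]:
  "open S \<Longrightarrow> (\<And>i. i \<in> I \<Longrightarrow> smooth_on S (f i)) \<Longrightarrow> smooth_on S (\<lambda>x. \<Sum>i\<in>I. f i x)"
  unfolding smooth_on_def by (simp add: C_k_on_sum)

lemma smooth_on_bilinear:
  "bounded_bilinear B \<Longrightarrow> open S \<Longrightarrow> smooth_on S f \<Longrightarrow> smooth_on S g \<Longrightarrow> smooth_on S (\<lambda>x. B (f x) (g x))"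
  unfolding smooth_on_def by (simp add: C_k_on_bilinear)

lemmas smooth_on_mult [smooth_intros] =
  smooth_on_bilinear[OF bounded_bilinear_mult[where 'a = real]]
lemmas smooth_on_scaleR [smooth_intros] = smooth_on_bilinear[OF bounded_bilinear_scaleR]
lemmas smooth_on_inner [smooth_intros] = smooth_on_bilinear[OF bounded_bilinear_inner]
lemmas smooth_on_vec_nth [smooth_intros] = smooth_on_linear[OF bounded_linear_vec_nth]

lemma smooth_on_prod [smooth_intros]:
  fixes f :: "'i \<Rightarrow> 'a::euclidean_space \<Rightarrow> real"
  assumes "open S" "\<And>i. i \<in> I \<Longrightarrow> smooth_on S (f i)"
  shows "smooth_on S (\<lambda>x. \<Prod>i\<in>I. f i x)"
  using assms(2)
  by (induction I rule: infinite_finite_induct) (simp_all add: smooth_on_const smooth_on_mult assms(1))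

lemma smooth_on_compose:
  "open S \<Longrightarrow> open T \<Longrightarrow> smooth_on T g \<Longrightarrow> smooth_on S f \<Longrightarrow> f ` S \<subseteq> T \<Longrightarrow> smooth_on S (\<lambda>x. g (f x))"
  unfolding smooth_on_def by (simp add: C_k_on_compose[of S T])

lemma smooth_on_vec_lambda [smooth_intros]:
  fixes f :: "'i::finite \<Rightarrow> 'a::euclidean_space \<Rightarrow> 'b::euclidean_space"
  assumes "open S" "\<And>i. smooth_on S (f i)"
  shows "smooth_on S (\<lambda>x. \<chi> i. f i x)"
proof -
  have "(\<lambda>x. \<chi> i. f i x) = (\<lambda>x. \<Sum>i\<in>UNIV. axis i (f i x))"
    by (auto simp: vec_eq_iff axis_def sum.delta if_distrib cong: if_cong)
  moreover have "bounded_linear (axis i :: 'b \<Rightarrow> 'b^'i)" for i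
    unfolding linear_conv_bounded_linear[symmetric]
    by (rule linearI) (auto simp: axis_def vec_eq_iff)
  ultimately show ?thesis
    by (simp add: smooth_on_sum smooth_on_linear assms)
qed

lemma smooth_on_Pair [smooth_intros]:
  fixes f :: "'a::euclidean_space \<Rightarrow> 'b::euclidean_space" and g :: "'a \<Rightarrow> 'c::euclidean_space"
  assumes "open S" "smooth_on S f" "smooth_on S g"
  shows "smooth_on S (\<lambda>x. (f x, g x))"
proof -
  have "smooth_on S (\<lambda>x. (f x, 0::'c) + (0::'b, g x))"
    by (intro smooth_on_add smooth_on_linear[OF _ assms(1,2)] smooth_on_linear[OF _ assms(1,3)] assms(1)
        bounded_linear_Pair bounded_linear_ident bounded_linear_zero)
  then show ?thesis by simp
qed

lemmas smooth_on_fst [smooth_intros] = smooth_on_linear[OF bounded_linear_fst]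
lemmas smooth_on_snd [smooth_intros] = smooth_on_linear[OF bounded_linear_snd]

text \<open>The induction needs all exponents at once, since differentiating lowers the exponent by
  one.\<close>

lemma smooth_on_powr_const: "smooth_on {0<..} (\<lambda>t::real. t powr a)"
  unfolding smooth_on_def
proof
  fix k show "C_k_on k {0<..} (\<lambda>t::real. t powr a)"
  proof (induction k arbitrary: a)
    case (Suc k)
    show ?case
    proof (rule C_k_on_SucI)
      fix t :: real assume "t \<in> {0<..}"
      then have "((\<lambda>t. t powr a) has_real_derivative a * t powr (a - 1)) (at t)"
        by (auto intro!: derivative_eq_intros)
      then show "((\<lambda>t. t powr a) has_derivative (\<lambda>v. (v * a) * t powr (a - 1))) (at t)"
        unfolding has_field_derivative_def by (rule has_derivative_eq_rhs) auto
    next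
      fix v
      show "C_k_on k {0<..} (\<lambda>t. (v * a) * t powr (a - 1))"
        by (rule C_k_on_linear[OF bounded_linear_mult_right _ Suc]) auto
    qed auto
  qed (auto intro!: continuous_intros)
qed

lemma smooth_on_powr [smooth_intros]:
  fixes f :: "'a::euclidean_space \<Rightarrow> real"
  assumes "open S" "smooth_on S f" "\<And>x. x \<in> S \<Longrightarrow> f x > 0"
  shows "smooth_on S (\<lambda>x. f x powr a)"
  by (rule smooth_on_compose[OF assms(1) _ smooth_on_powr_const assms(2)]) (use assms(3) in auto)

lemma smooth_on_sqrt [smooth_intros]:
  fixes f :: "'a::euclidean_space \<Rightarrow> real"
  assumes "open S" "smooth_on S f" "\<And>x. x \<in> S \<Longrightarrow> f x > 0"
  shows "smooth_on S (\<lambda>x. sqrt (f x))"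
  using smooth_on_powr[OF assms, of "1/2"]
    smooth_on_cong[OF assms(1), of "\<lambda>x. f x powr (1/2)" "\<lambda>x. sqrt (f x)"] assms(3)
  by (simp add: powr_half_sqrt less_imp_le)

lemma smooth_on_inverse_real: "smooth_on (- {0}) (inverse :: real \<Rightarrow> real)"
  unfolding smooth_on_def
proof
  fix k show "C_k_on k (- {0}) (inverse :: real \<Rightarrow> real)"
  proof (induction k)
    case 0
    show ?case by (auto intro!: continuous_intros)
  next
    case (Suc k)
    have o: "open (- {0::real})" by auto
    show ?case
    proof (rule C_k_on_SucI[OF o])
      fix t :: real assume "t \<in> - {0}"
      then show "(inverse has_derivative (\<lambda>v. - v * (inverse t * inverse t))) (at t)"
        using has_derivative_inverse'[of t UNIV] by (simp add: mult.assoc mult.left_commute)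
    next
      fix v :: real
      show "C_k_on k (- {0}) (\<lambda>t. - v * (inverse t * inverse t))"
        by (intro C_k_on_linear[OF bounded_linear_mult_right o]
            C_k_on_bilinear[OF bounded_bilinear_mult o] Suc)
    qed
  qed
qed

lemma smooth_on_divide [smooth_intros]:
  fixes f g :: "'a::euclidean_space \<Rightarrow> real"
  assumes "open S" "smooth_on S f" "smooth_on S g" "\<And>x. x \<in> S \<Longrightarrow> g x \<noteq> 0"
  shows "smooth_on S (\<lambda>x. f x / g x)"
  unfolding divide_inverse
  by (intro smooth_on_mult assms smooth_on_compose[OF assms(1) _ smooth_on_inverse_real assms(3)])
     (use assms(4) in auto)

lemma smooth_on_det [smooth_intros]:
  fixes A :: "'a::euclidean_space \<Rightarrow> real^'n^'n"
  assumes "open S" "smooth_on S A"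
  shows "smooth_on S (\<lambda>x. det (A x))"
  unfolding det_def by (intro smooth_intros assms)

text \<open>Column \<open>l\<close> of the inverse solves a linear system with right side
  \<open>axis l 1\<close>, so Cramer's rule applies. Each entry becomes a quotient of determinants,
  which is how smoothness of the inverse is obtained.\<close>

lemma matrix_inv_cramer:
  fixes A :: "real^'n^'n"
  assumes "det A \<noteq> 0"
  shows "matrix_inv A $ k $ l = det (\<chi> i j. if j = k then (if i = l then 1 else 0) else A $ i $ j) / det A"
proof -
  have "invertible A" using assms invertible_det_nz by blast
  then have "A ** matrix_inv A = mat 1"
    unfolding invertible_def matrix_inv_def by (metis (mono_tags, lifting) someI_ex)
  then have "A *v (matrix_inv A *v axis l 1) = axis l 1"
    by (simp add: matrix_vector_mul_assoc)
  then have "matrix_inv A *v axis l 1 = (\<chi> k. det (\<chi> i j. if j = k then axis l 1 $ i else A $ i $ j) / det A)"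
    using cramer[OF assms] by blast
  then have "(matrix_inv A *v axis l 1) $ k = det (\<chi> i j. if j = k then axis l 1 $ i else A $ i $ j) / det A"
    by simp
  moreover have "(matrix_inv A *v axis l 1) $ k = matrix_inv A $ k $ l"
    by (simp add: matrix_vector_mult_basis column_def)
  moreover have "(\<chi> i j. if j = k then axis l 1 $ i else A $ i $ j)
      = (\<chi> i j. if j = k then (if i = l then 1 else 0) else A $ i $ j)"
    by (simp add: axis_def vec_eq_iff)
  ultimately show ?thesis by simp
qed

lemma smooth_on_matrix_inv_nth [smooth_intros]:
  fixes A :: "'a::euclidean_space \<Rightarrow> real^'n^'n"
  assumes "open S" "smooth_on S A" "\<And>x. x \<in> S \<Longrightarrow> det (A x) \<noteq> 0"
  shows "smooth_on S (\<lambda>x. matrix_inv (A x) $ k $ l)"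
proof -
  have "smooth_on S (\<lambda>x. det (\<chi> i j. if j = k then (if i = l then 1 else 0) else A x $ i $ j) / det (A x))"
  proof (intro smooth_intros assms)
    fix i j show "smooth_on S (\<lambda>x. if j = k then (if i = l then 1 else 0) else A x $ i $ j)"
      by (cases "j = k") (auto intro!: smooth_intros assms)
  qed (use assms in auto)
  then show ?thesis
    using smooth_on_cong[OF assms(1)] matrix_inv_cramer[OF assms(3)] by (metis (no_types, lifting))
qed

lemma smooth_on_matrix_inv [smooth_intros]:
  fixes A :: "'a::euclidean_space \<Rightarrow> real^'n^'n"
  assumes "open S" "smooth_on S A" "\<And>x. x \<in> S \<Longrightarrow> det (A x) \<noteq> 0"
  shows "smooth_on S (\<lambda>x. matrix_inv (A x))"
proof -
  have "smooth_on S (\<lambda>x. \<chi> k l. matrix_inv (A x) $ k $ l)"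
    by (intro smooth_intros assms)
  then show ?thesis by simp
qed

subsection \<open>Symmetry of second derivatives\<close>

text \<open>The mean value theorem is applied in direction \<open>u\<close> to the increment in
  direction \<open>v\<close>, then in direction \<open>v\<close> to the resulting derivative. The
  second difference is symmetric in \<open>u\<close> and \<open>v\<close>, so doing this in both
  orders makes the two mixed derivatives comparable.\<close>

lemma second_difference_mean_value:
  fixes f :: "'a::euclidean_space \<Rightarrow> real"
  assumes "convex U" "open U" "\<And>x. x \<in> U \<Longrightarrow> f differentiable (at x)"
    "\<And>x. x \<in> U \<Longrightarrow> (\<lambda>y. frechet_derivative f (at y) u) differentiable (at x)"
    and s: "s > 0" and U: "\<And>a b. 0 \<le> a \<Longrightarrow> a \<le> s \<Longrightarrow> 0 \<le> b \<Longrightarrow> b \<le> s \<Longrightarrow> x + a *\<^sub>R u + b *\<^sub>R v \<in> U"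
  shows "\<exists>a b. 0 < a \<and> a < s \<and> 0 < b \<and> b < s \<and>
    f (x + s *\<^sub>R u + s *\<^sub>R v) - f (x + s *\<^sub>R u) - f (x + s *\<^sub>R v) + f x =
      s\<^sup>2 * frechet_derivative (\<lambda>y. frechet_derivative f (at y) u) (at (x + a *\<^sub>R u + b *\<^sub>R v)) v"
proof -
  let ?D = "\<lambda>y. frechet_derivative f (at y) u"
  have d1: "((\<lambda>a. f (x + a *\<^sub>R u + w)) has_real_derivative ?D (x + a *\<^sub>R u + w)) (at a)"
    if "x + a *\<^sub>R u + w \<in> U" for a w
  proof -
    let ?f' = "frechet_derivative f (at (x + a *\<^sub>R u + w))"
    have f': "(f has_derivative ?f') (at (x + a *\<^sub>R u + w))"
      using assms(3)[OF that] frechet_derivative_works by blast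
    have "((\<lambda>a. f (x + a *\<^sub>R u + w)) has_derivative (\<lambda>h. ?f' (h *\<^sub>R u))) (at a)"
      by (rule has_derivative_compose[where f = "\<lambda>a. x + a *\<^sub>R u + w", OF _ f']) (auto intro!: derivative_eq_intros)
    then show ?thesis unfolding has_field_derivative_def
      by (rule has_derivative_eq_rhs)
        (simp add: linear_cmul[OF has_derivative_linear[OF f']] fun_eq_iff)
  qed
  have d2: "((\<lambda>b. ?D (w + b *\<^sub>R v)) has_real_derivative frechet_derivative ?D (at (w + b *\<^sub>R v)) v) (at b)"
    if "w + b *\<^sub>R v \<in> U" for b w
  proof -
    let ?f' = "frechet_derivative ?D (at (w + b *\<^sub>R v))"
    have f': "(?D has_derivative ?f') (at (w + b *\<^sub>R v))"
      using assms(4)[OF that] frechet_derivative_works by blast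
    have "((\<lambda>b. ?D (w + b *\<^sub>R v)) has_derivative (\<lambda>h. ?f' (h *\<^sub>R v))) (at b)"
      by (rule has_derivative_compose[where f = "\<lambda>b. w + b *\<^sub>R v", OF _ f']) (auto intro!: derivative_eq_intros)
    then show ?thesis unfolding has_field_derivative_def
      by (rule has_derivative_eq_rhs)
        (simp add: linear_cmul[OF has_derivative_linear[OF f']] fun_eq_iff)
  qed
  let ?g = "\<lambda>a. f (x + a *\<^sub>R u + s *\<^sub>R v) - f (x + a *\<^sub>R u + 0)"
  have "(?g has_real_derivative ?D (x + a *\<^sub>R u + s *\<^sub>R v) - ?D (x + a *\<^sub>R u + 0)) (at a)"
    if "0 \<le> a" "a \<le> s" for a
    by (rule DERIV_diff; rule d1) (use that s U[of a s] U[of a 0] in auto)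
  then obtain a where a: "0 < a" "a < s"
    "?g s - ?g 0 = s * (?D (x + a *\<^sub>R u + s *\<^sub>R v) - ?D (x + a *\<^sub>R u + 0))"
    using MVT2[OF s, of ?g "\<lambda>a. ?D (x + a *\<^sub>R u + s *\<^sub>R v) - ?D (x + a *\<^sub>R u + 0)"] by auto
  have "((\<lambda>b. ?D (x + a *\<^sub>R u + b *\<^sub>R v)) has_real_derivative
      frechet_derivative ?D (at (x + a *\<^sub>R u + b *\<^sub>R v)) v) (at b)"
    if "0 \<le> b" "b \<le> s" for b
    by (rule d2) (use that a U[of a b] in auto)
  then obtain b where b: "0 < b" "b < s"
    "?D (x + a *\<^sub>R u + s *\<^sub>R v) - ?D (x + a *\<^sub>R u + 0 *\<^sub>R v)
      = s * frechet_derivative ?D (at (x + a *\<^sub>R u + b *\<^sub>R v)) v"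
    using MVT2[OF s, of "\<lambda>b. ?D (x + a *\<^sub>R u + b *\<^sub>R v)"
        "\<lambda>b. frechet_derivative ?D (at (x + a *\<^sub>R u + b *\<^sub>R v)) v"] by auto
  show ?thesis
    by (intro exI[of _ a] exI[of _ b])
       (use a b in \<open>simp add: power2_eq_square\<close>)
qed

text \<open>Arbitrarily close to \<open>x\<close> there are points \<open>y\<close> and
  \<open>z\<close> at which the two mixed derivatives take a common value, because both represent
  the same second difference. Continuity of the mixed derivatives at \<open>x\<close> then forces
  equality there.\<close>

lemma frechet_derivative_commute_real:
  fixes f :: "'a::euclidean_space \<Rightarrow> real"
  assumes "open S" "smooth_on S f" "x \<in> S"
  shows "frechet_derivative (\<lambda>y. frechet_derivative f (at y) u) (at x) v
       = frechet_derivative (\<lambda>y. frechet_derivative f (at y) v) (at x) u"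
proof -
  let ?D = "\<lambda>u v y. frechet_derivative (\<lambda>y. frechet_derivative f (at y) u) (at y) v"
  obtain r where r: "r > 0" "ball x r \<subseteq> S" using assms open_contains_ball by metis
  have sm: "smooth_on (ball x r) f" using assms(2) r(2) by (rule smooth_on_subset)
  have cont: "isCont (?D u v) x" for u v
    using smooth_on_imp_continuous_on[OF smooth_on_frechet_derivative[OF
          smooth_on_frechet_derivative[OF sm]], of u v] r(1)
    by (simp add: continuous_on_eq_continuous_at)
  have ex: "\<exists>y z. dist y x < e \<and> dist z x < e \<and> ?D u v y = ?D v u z" if "e > 0" for e
  proof -
    \<comment> \<open>The side \<open>s\<close> keeps the whole parallelogram within
      \<open>min e r\<close> of \<open>x\<close>; the summand 1 keeps the denominator positive when
      \<open>u\<close> and \<open>v\<close> vanish.\<close>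
    define s where "s = min e r / (2 * (norm u + norm v + 1))"
    have n: "norm u + norm v + 1 > 0" by (smt (verit) norm_ge_zero)
    have s: "s > 0" unfolding s_def using r that n by simp
    have near: "dist (x + a *\<^sub>R u + b *\<^sub>R v) x < min e r" if "0 \<le> a" "a \<le> s" "0 \<le> b" "b \<le> s" for a b
    proof -
      have "dist (x + a *\<^sub>R u + b *\<^sub>R v) x \<le> a * norm u + b * norm v"
        using norm_triangle_ineq[of "a *\<^sub>R u" "b *\<^sub>R v"] that by (simp add: dist_norm)
      also have "\<dots> \<le> s * norm u + s * norm v"
        using that by (intro add_mono mult_right_mono) auto
      also have "\<dots> < s * (2 * (norm u + norm v + 1))"
        using s mult_nonneg_nonneg[of s "norm u"] mult_nonneg_nonneg[of s "norm v"]
        by (simp add: algebra_simps add_nonneg_pos)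
      also have "\<dots> = min e r" unfolding s_def using n by simp
      finally show ?thesis .
    qed
    have mv: "\<exists>a b. 0 < a \<and> a < s \<and> 0 < b \<and> b < s \<and>
        f (x + s *\<^sub>R u + s *\<^sub>R v) - f (x + s *\<^sub>R u) - f (x + s *\<^sub>R v) + f x =
          s\<^sup>2 * ?D u v (x + a *\<^sub>R u + b *\<^sub>R v)"
      if "\<And>a b. 0 \<le> a \<Longrightarrow> a \<le> s \<Longrightarrow> 0 \<le> b \<Longrightarrow> b \<le> s \<Longrightarrow> dist (x + a *\<^sub>R u + b *\<^sub>R v) x < min e r" for u v
    proof (rule second_difference_mean_value[where U = "ball x r"])
      show "x + a *\<^sub>R u + b *\<^sub>R v \<in> ball x r" if "0 \<le> a" "a \<le> s" "0 \<le> b" "b \<le> s" for a b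
        using \<open>\<And>a b. 0 \<le> a \<Longrightarrow> a \<le> s \<Longrightarrow> 0 \<le> b \<Longrightarrow> b \<le> s \<Longrightarrow> dist (x + a *\<^sub>R u + b *\<^sub>R v) x < min e r\<close>[OF that]
        by (simp add: dist_commute)
    qed (use s sm smooth_on_imp_differentiable[OF sm]
          smooth_on_imp_differentiable[OF smooth_on_frechet_derivative[OF sm]] in auto)
    obtain a b where ab: "0 < a" "a < s" "0 < b" "b < s"
        "f (x + s *\<^sub>R u + s *\<^sub>R v) - f (x + s *\<^sub>R u) - f (x + s *\<^sub>R v) + f x =
          s\<^sup>2 * ?D u v (x + a *\<^sub>R u + b *\<^sub>R v)"
      using mv[OF near] by auto
    have near': "dist (x + a *\<^sub>R v + b *\<^sub>R u) x < min e r" if "0 \<le> a" "a \<le> s" "0 \<le> b" "b \<le> s" for a b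
      using near[of b a] that by (simp add: algebra_simps)
    obtain a' b' where ab': "0 < a'" "a' < s" "0 < b'" "b' < s"
        "f (x + s *\<^sub>R v + s *\<^sub>R u) - f (x + s *\<^sub>R v) - f (x + s *\<^sub>R u) + f x =
          s\<^sup>2 * ?D v u (x + a' *\<^sub>R v + b' *\<^sub>R u)"
      using mv[OF near'] by auto
    have "s\<^sup>2 * ?D u v (x + a *\<^sub>R u + b *\<^sub>R v) = s\<^sup>2 * ?D v u (x + a' *\<^sub>R v + b' *\<^sub>R u)"
      unfolding ab(5)[symmetric] ab'(5)[symmetric] by (simp add: algebra_simps)
    then have "?D u v (x + a *\<^sub>R u + b *\<^sub>R v) = ?D v u (x + a' *\<^sub>R v + b' *\<^sub>R u)"
      using s by simp
    then show ?thesis using near[of a b] near'[of a' b'] ab ab' by force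
  qed
  show ?thesis
  proof (rule ccontr)
    assume ne: "?D u v x \<noteq> ?D v u x"
    \<comment> \<open>Half of the gap: one common value cannot lie strictly within this distance of
      both numbers.\<close>
    define d where "d = \<bar>?D u v x - ?D v u x\<bar> / 2"
    have d: "d > 0" using ne by (simp add: d_def)
    obtain e1 where e1: "e1 > 0" "\<And>y. dist y x < e1 \<Longrightarrow> dist (?D u v y) (?D u v x) < d"
      using cont[of u v] d unfolding continuous_at_eps_delta by blast
    obtain e2 where e2: "e2 > 0" "\<And>y. dist y x < e2 \<Longrightarrow> dist (?D v u y) (?D v u x) < d"
      using cont[of v u] d unfolding continuous_at_eps_delta by blast
    obtain y z where yz: "dist y x < min e1 e2" "dist z x < min e1 e2" "?D u v y = ?D v u z"
      using ex[of "min e1 e2"] e1(1) e2(1) by auto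
    have "dist (?D u v y) (?D u v x) < d" "dist (?D u v y) (?D v u x) < d"
      using e1(2)[of y] e2(2)[of z] yz by auto
    then have "dist (?D u v x) (?D v u x) < \<bar>?D u v x - ?D v u x\<bar>"
      unfolding d_def by (rule dist_triangle_half_r)
    then show False by (simp add: dist_real_def)
  qed
qed

lemma frechet_derivative_inner:
  fixes f :: "'a::euclidean_space \<Rightarrow> 'b::euclidean_space"
  assumes "f differentiable (at x)"
  shows "frechet_derivative (\<lambda>y. f y \<bullet> b) (at x) v = frechet_derivative f (at x) v \<bullet> b"
proof -
  have "((\<lambda>y. f y \<bullet> b) has_derivative (\<lambda>v. frechet_derivative f (at x) v \<bullet> b)) (at x)"
    by (intro has_derivative_inner_left) (use assms frechet_derivative_works in blast)
  then show ?thesis by (simp add: frechet_derivative_eqI)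
qed

lemma frechet_derivative_commute:
  fixes f :: "'a::euclidean_space \<Rightarrow> 'b::euclidean_space"
  assumes "open S" "smooth_on S f" "x \<in> S"
  shows "frechet_derivative (\<lambda>y. frechet_derivative f (at y) u) (at x) v
       = frechet_derivative (\<lambda>y. frechet_derivative f (at y) v) (at x) u"
proof (rule euclidean_eqI)
  fix b :: 'b
  have *: "frechet_derivative (\<lambda>y. frechet_derivative f (at y) u) (at x) v \<bullet> b
      = frechet_derivative (\<lambda>y. frechet_derivative (\<lambda>z. f z \<bullet> b) (at y) u) (at x) v" for u v
  proof -
    have "frechet_derivative (\<lambda>y. frechet_derivative (\<lambda>z. f z \<bullet> b) (at y) u) (at x)
        = frechet_derivative (\<lambda>y. frechet_derivative f (at y) u \<bullet> b) (at x)"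
      by (rule frechet_derivative_cong_open[OF assms(1,3)])
         (simp add: frechet_derivative_inner smooth_on_imp_differentiable[OF assms(2)])
    then show ?thesis
      by (simp add: frechet_derivative_inner smooth_on_imp_differentiable[OF
            smooth_on_frechet_derivative[OF assms(2)] assms(3)])
  qed
  have "smooth_on S (\<lambda>z. f z \<bullet> b)"
    by (intro smooth_intros assms)
  then show "frechet_derivative (\<lambda>y. frechet_derivative f (at y) u) (at x) v \<bullet> b
       = frechet_derivative (\<lambda>y. frechet_derivative f (at y) v) (at x) u \<bullet> b"
    unfolding * by (rule frechet_derivative_commute_real[OF assms(1) _ assms(3)])
qed

subsection \<open>Bump functions\<close>

definition exp_bump :: "real \<Rightarrow> real" where
  "exp_bump s = (if s > 0 then exp (- inverse s) else 0)"

text \<open>The case \<open>n = 0\<close> is \<open>exp_bump\<close>. The whole family is closed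
  under differentiation up to linear combinations, which lets smoothness go through by induction on
  the order.\<close>

definition exp_bump_poly :: "nat \<Rightarrow> real \<Rightarrow> real" where
  "exp_bump_poly n s = (if s > 0 then inverse s ^ n * exp (- inverse s) else 0)"

lemma exp_bump_poly_tendsto_0: "(exp_bump_poly n \<longlongrightarrow> 0) (at 0)"
proof -
  have "((\<lambda>y::real. y ^ n / exp y) \<longlongrightarrow> 0) at_top"
    by (rule tendsto_power_div_exp_0)
  then have "((\<lambda>s::real. inverse s ^ n / exp (inverse s)) \<longlongrightarrow> 0) (at_right 0)"
    using filterlim_inverse_at_top_right by (rule filterlim_compose)
  then have "(exp_bump_poly n \<longlongrightarrow> 0) (at_right 0)"
    by (rule Lim_transform_eventually)
       (auto simp: eventually_at_filter exp_bump_poly_def exp_minus divide_inverse)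
  moreover have "(exp_bump_poly n \<longlongrightarrow> 0) (at_left 0)"
    by (rule Lim_transform_eventually[OF tendsto_const])
       (auto simp: eventually_at_filter exp_bump_poly_def)
  ultimately show ?thesis by (simp add: filterlim_split_at)
qed

lemma exp_bump_poly_deriv:
  "(exp_bump_poly n has_real_derivative (exp_bump_poly (n + 2) s - real n * exp_bump_poly (n + 1) s)) (at s)"
proof -
  consider "s > 0" | "s < 0" | "s = 0" by linarith
  then show ?thesis
  proof cases
    case 1
    have "((\<lambda>s. inverse s ^ n * exp (- inverse s)) has_real_derivative
        (exp_bump_poly (n + 2) s - real n * exp_bump_poly (n + 1) s)) (at s)"
      using 1 by (auto intro!: derivative_eq_intros simp: exp_bump_poly_def)
         (cases n; simp add: field_simps power2_eq_square)
    then show ?thesis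
      by (rule has_field_derivative_transform_within_open[where S = "{0<..}"])
         (use 1 in \<open>auto simp: exp_bump_poly_def\<close>)
  next
    case 2
    have "((\<lambda>s. 0) has_real_derivative (exp_bump_poly (n + 2) s - real n * exp_bump_poly (n + 1) s)) (at s)"
      using 2 by (simp add: exp_bump_poly_def)
    then show ?thesis
      by (rule has_field_derivative_transform_within_open[where S = "{..<0}"])
         (use 2 in \<open>auto simp: exp_bump_poly_def\<close>)
  next
    case 3
    \<comment> \<open>At 0 the difference quotient of level \<open>n\<close> is level
      \<open>n + 1\<close> of the same family, and every level tends to 0 there.\<close>
    have "((\<lambda>h. exp_bump_poly n (0 + h) / h) \<longlongrightarrow> 0) (at 0)"
    proof (rule Lim_transform_eventually[OF exp_bump_poly_tendsto_0[of "Suc n"]])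
      show "\<forall>\<^sub>F h in at 0. exp_bump_poly (Suc n) h = exp_bump_poly n (0 + h) / h"
        by (auto simp: eventually_at_filter exp_bump_poly_def field_simps)
    qed
    then show ?thesis unfolding 3
      by (simp add: has_field_derivative_iff exp_bump_poly_def)
  qed
qed

lemma smooth_on_exp_bump: "smooth_on UNIV exp_bump"
proof -
  have "C_k_on k UNIV (exp_bump_poly n)" for k n
  proof (induction k arbitrary: n)
    case 0
    show ?case
      using exp_bump_poly_deriv DERIV_isCont continuous_at_imp_continuous_on by (metis C_k_on.simps(1))
  next
    case (Suc k)
    show ?case
    proof (rule C_k_on_SucI)
      fix s show "(exp_bump_poly n has_derivative
          (\<lambda>v. v * exp_bump_poly (n + 2) s + (- v * real n) * exp_bump_poly (n + 1) s)) (at s)"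
        using exp_bump_poly_deriv[of n s] unfolding has_field_derivative_def
        by (rule has_derivative_eq_rhs) (auto simp: algebra_simps)
    next
      fix v
      show "C_k_on k UNIV (\<lambda>s. v * exp_bump_poly (n + 2) s + (- v * real n) * exp_bump_poly (n + 1) s)"
        by (intro C_k_on_add C_k_on_linear[OF bounded_linear_mult_right] Suc) auto
    qed auto
  qed
  from this[of _ 0] show ?thesis
    by (simp add: smooth_on_def exp_bump_def[abs_def] exp_bump_poly_def[abs_def] cong: if_cong)
qed

text \<open>The squared distance is used because the norm itself is not smooth at the
  centre.\<close>

definition ball_bump :: "'a::euclidean_space \<Rightarrow> real \<Rightarrow> 'a \<Rightarrow> real" where
  "ball_bump a r x = exp_bump (r\<^sup>2 - (x - a) \<bullet> (x - a))"

lemma smooth_on_ball_bump: "smooth_on UNIV (ball_bump a r)"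
  unfolding ball_bump_def[abs_def]
  by (rule smooth_on_compose[OF _ _ smooth_on_exp_bump]) (auto intro!: smooth_intros)

lemma ball_bump_pos_iff:
  assumes "r > 0" shows "ball_bump a r x > 0 \<longleftrightarrow> x \<in> ball a r"
proof -
  have "r\<^sup>2 - (x - a) \<bullet> (x - a) > 0 \<longleftrightarrow> norm (x - a) < r"
    using power_mono_iff[of r "norm (x - a)" 2] assms by (simp add: dot_square_norm linorder_not_le[symmetric])
  then show ?thesis
    by (auto simp: ball_bump_def exp_bump_def dist_norm norm_minus_commute)
qed

lemma ball_bump_nonneg: "ball_bump a r x \<ge> 0"
  by (simp add: ball_bump_def exp_bump_def)

lemma ball_bump_eq_0: "r > 0 \<Longrightarrow> x \<notin> ball a r \<Longrightarrow> ball_bump a r x = 0"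
  using ball_bump_pos_iff[of r a x] ball_bump_nonneg[of a r x] by linarith

section \<open>Positive definite matrices\<close>

definition spd :: "real^'n^'n \<Rightarrow> bool" where
  "spd A \<longleftrightarrow> (\<forall>i j. A $ i $ j = A $ j $ i) \<and> (\<forall>v. v \<noteq> 0 \<longrightarrow> v \<bullet> (A *v v) > 0)"

lemma matrix_inv_unique:
  fixes A :: "real^'n^'n"
  assumes "A ** B = mat 1"
  shows "matrix_inv A = B"
proof -
  have "B ** A = mat 1" using assms matrix_left_right_inverse by blast
  with assms have "\<exists>C. A ** C = mat 1 \<and> C ** A = mat 1" by blast
  then have "matrix_inv A ** A = mat 1"
    unfolding matrix_inv_def by (metis (mono_tags, lifting) someI_ex)
  then have "matrix_inv A ** (A ** B) = B" by (simp add: matrix_mul_assoc)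
  then show ?thesis by (simp add: assms)
qed

lemma matrix_inv_mult:
  fixes A :: "real^'n^'n"
  assumes "det A \<noteq> 0"
  shows "A ** matrix_inv A = mat 1" "matrix_inv A ** A = mat 1"
proof -
  obtain B where "A ** B = mat 1" using assms invertible_det_nz invertible_def by metis
  then show "A ** matrix_inv A = mat 1" by (simp add: matrix_inv_unique)
  then show "matrix_inv A ** A = mat 1" using matrix_left_right_inverse by blast
qed

lemma matrix_inv_scaleR:
  fixes A :: "real^'n^'n"
  assumes "det A \<noteq> 0" "c \<noteq> 0"
  shows "matrix_inv (c *\<^sub>R A) = (1 / c) *\<^sub>R matrix_inv A"
proof (rule matrix_inv_unique)
  have "(c *\<^sub>R A) ** ((1 / c) *\<^sub>R matrix_inv A) = A ** matrix_inv A"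
    using assms(2)
    by (simp add: vec_eq_iff matrix_matrix_mult_def)
  then show "(c *\<^sub>R A) ** ((1 / c) *\<^sub>R matrix_inv A) = mat 1"
    using matrix_inv_mult[OF assms(1)] by simp
qed

lemma matrix_inv_sym:
  fixes A :: "real^'n^'n"
  assumes "det A \<noteq> 0" "\<And>i j. A $ i $ j = A $ j $ i"
  shows "matrix_inv A $ i $ j = matrix_inv A $ j $ i"
proof -
  have A: "transpose A = A" using assms(2) by (simp add: transpose_def vec_eq_iff)
  have "transpose (matrix_inv A ** A) = mat 1"
    using matrix_inv_mult[OF assms(1)] by (simp add: transpose_mat)
  then have "A ** transpose (matrix_inv A) = mat 1"
    by (simp add: matrix_transpose_mul A)
  then have "matrix_inv A = transpose (matrix_inv A)" by (rule matrix_inv_unique)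
  then have "matrix_inv A $ i $ j = transpose (matrix_inv A) $ i $ j" by simp
  then show ?thesis by (simp add: transpose_def)
qed

lemma matrix_inv_mult_nth:
  fixes A :: "real^'n^'n"
  assumes "det A \<noteq> 0"
  shows "(\<Sum>k\<in>UNIV. A $ i $ k * matrix_inv A $ k $ j) = (if i = j then 1 else 0)"
    "(\<Sum>k\<in>UNIV. matrix_inv A $ i $ k * A $ k $ j) = (if i = j then 1 else 0)"
  using matrix_inv_mult[OF assms] by (simp_all add: matrix_matrix_mult_def vec_eq_iff mat_def)

text \<open>Gram-Schmidt in maximal form: sets orthonormal for the form \<open>B\<close> are
  independent, hence of bounded size, so a largest one exists. Were its span proper, the normalized
  remainder of an outside vector after projection would enlarge it.\<close>

lemma spd_orthonormal_exists:
  fixes A :: "real^'n^'n"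
  assumes "spd A"
  shows "\<exists>e :: 'n \<Rightarrow> real^'n. \<forall>i j. e i \<bullet> (A *v e j) = (if i = j then 1 else 0)"
proof -
  define B where "B u v = u \<bullet> (A *v v)" for u v
  have B_add: "B u (v + w) = B u v + B u w" "B (v + w) u = B v u + B w u" for u v w
    by (simp_all add: B_def matrix_vector_right_distrib inner_add_left inner_add_right)
  have B_scale: "B u (r *\<^sub>R v) = r * B u v" "B (r *\<^sub>R u) v = r * B u v" for u v r
    by (simp_all add: B_def matrix_vector_mult_scaleR)
  have B_sum: "B u (\<Sum>x\<in>S. f x) = (\<Sum>x\<in>S. B u (f x))" for u S and f :: "real^'n \<Rightarrow> real^'n"
    by (induction S rule: infinite_finite_induct) (auto simp: B_add, auto simp: B_def)
  have B_sym: "B u v = B v u" for u v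
  proof -
    have "transpose A = A" using assms by (simp add: spd_def transpose_def vec_eq_iff)
    then show ?thesis
      unfolding B_def using dot_lmul_matrix[of u A v] transpose_matrix_vector[of A u]
      by (simp add: inner_commute)
  qed
  have B_pos: "v \<noteq> 0 \<Longrightarrow> B v v > 0" for v using assms by (simp add: spd_def B_def)
  define P where "P S \<longleftrightarrow> finite S \<and> (\<forall>u\<in>S. \<forall>v\<in>S. B u v = (if u = v then 1 else 0))" for S
  have coeff: "B u (\<Sum>v\<in>S. c v *\<^sub>R v) = c u" if "P S" "u \<in> S" for S u c
  proof -
    have "B u (\<Sum>v\<in>S. c v *\<^sub>R v) = (\<Sum>v\<in>S. if u = v then c v else 0)"
      unfolding B_sum B_scale using that by (intro sum.cong) (auto simp: P_def)
    also have "\<dots> = c u" using that by (simp add: P_def)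
    finally show ?thesis .
  qed
  have indep: "independent S" if "P S" for S
  proof (rule independent_if_scalars_zero)
    show "finite S" using that by (simp add: P_def)
    fix f x assume "(\<Sum>x\<in>S. f x *\<^sub>R x) = 0" "x \<in> S"
    then show "f x = 0" using coeff[OF that, of x f] by (simp add: B_def)
  qed
  have "P {}" by (simp add: P_def)
  moreover have "card S < Suc CARD('n)" if "P S" for S
    using independent_bound[OF indep[OF that]] by simp
  ultimately obtain S where S: "P S" "\<And>T. P T \<Longrightarrow> card T \<le> card S"
    using ex_has_greatest_nat[of P "{}" card "Suc CARD('n)"] by blast
  have "span S = UNIV"
  proof (rule ccontr)
    assume "span S \<noteq> UNIV"
    then obtain v where v: "v \<notin> span S" by auto
    define w where "w = v - (\<Sum>s\<in>S. B s v *\<^sub>R s)"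
    have "w \<noteq> 0"
    proof
      assume "w = 0"
      then have eq: "v = (\<Sum>s\<in>S. B s v *\<^sub>R s)" by (simp add: w_def)
      have "v \<in> span S" by (subst eq) (intro span_sum span_scale span_base)
      then show False using v by contradiction
    qed
    have orth: "B s w = 0" if "s \<in> S" for s
    proof -
      have "B s v = B s (w + (\<Sum>s\<in>S. B s v *\<^sub>R s))" by (simp add: w_def)
      also have "\<dots> = B s w + B s v" by (simp add: B_add coeff[OF S(1) that])
      finally show ?thesis by simp
    qed
    define u where "u = (1 / sqrt (B w w)) *\<^sub>R w"
    have "B u u = 1" using B_pos[OF \<open>w \<noteq> 0\<close>] by (simp add: u_def B_scale)
    moreover have "B s u = 0" if "s \<in> S" for s using orth[OF that] by (simp add: u_def B_scale)
    moreover have "u \<notin> S" using calculation by force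
    ultimately have "P (insert u S)" using S(1) B_sym by (auto simp: P_def)
    then have "card (insert u S) \<le> card S" by (rule S(2))
    then show False using \<open>u \<notin> S\<close> S(1) by (simp add: P_def)
  qed
  then have "card S = CARD('n)"
    using dim_eq_card_independent[OF indep[OF S(1)]] by (metis DIM_cart DIM_real dim_UNIV dim_span mult.right_neutral)
  then obtain e where "bij_betw e (UNIV :: 'n set) S"
    using finite_same_card_bij[of "UNIV :: 'n set" S] S(1) by (auto simp: P_def)
  then have "B (e i) (e j) = (if i = j then 1 else 0)" for i j
    using S(1) unfolding P_def bij_betw_def by (metis UNIV_I imageI injD)
  then show ?thesis unfolding B_def by blast
qed

text \<open>With the \<open>e i\<close> as rows of a matrix E the hypothesis reads E A E^T = 1, so
  E^T E is the inverse of A, and taking determinants gives det A times the square of det E equal to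
  1.\<close>

lemma orthonormal_sum_matrix_inv:
  fixes A :: "real^'n^'n" and e :: "'n \<Rightarrow> real^'n"
  assumes "\<And>i j. e i \<bullet> (A *v e j) = (if i = j then 1 else 0)"
  shows "(\<Sum>i\<in>UNIV. e i $ k * e i $ l) = matrix_inv A $ k $ l" "det A > 0"
proof -
  define E where "E = (\<chi> i. e i)"
  have *: "E ** (A ** transpose E) = mat 1"
  proof -
    have "(E ** (A ** transpose E)) $ i $ j = e i \<bullet> (A *v e j)" for i j
      by (simp add: E_def matrix_matrix_mult_def transpose_def inner_vec_def matrix_vector_mult_def)
    then show ?thesis using assms by (simp add: vec_eq_iff mat_def)
  qed
  then have "(A ** transpose E) ** E = mat 1" using matrix_left_right_inverse by blast
  then have "A ** (transpose E ** E) = mat 1" by (simp add: matrix_mul_assoc)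
  then have "matrix_inv A = transpose E ** E" by (rule matrix_inv_unique)
  then show "(\<Sum>i\<in>UNIV. e i $ k * e i $ l) = matrix_inv A $ k $ l"
    by (simp add: E_def matrix_matrix_mult_def transpose_def)
  have "det E * (det A * det E) = 1" using * by (metis det_I det_mul det_transpose)
  then have "det A * (det E)\<^sup>2 = 1" by (simp add: power2_eq_square algebra_simps)
  then show "det A > 0" by (metis zero_less_mult_pos2 zero_less_one zero_less_power2 mult_zero_right power_zero_numeral zero_neq_one)
qed

lemma spd_det_pos: "spd A \<Longrightarrow> det A > 0"
  using spd_orthonormal_exists orthonormal_sum_matrix_inv(2) by metis

lemma spd_scaleR: "spd A \<Longrightarrow> c > 0 \<Longrightarrow> spd (c *\<^sub>R A)"
  by (simp add: spd_def scaleR_matrix_vector_assoc[symmetric])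

subsection \<open>Derivatives of determinants and inverses\<close>

lemma has_derivative_vec_nth:
  "(f has_derivative f') F \<Longrightarrow> ((\<lambda>x. f x $ i) has_derivative (\<lambda>v. f' v $ i)) F"
  by (rule bounded_linear.has_derivative[OF bounded_linear_vec_nth])

lemma has_derivative_det_at_mat_1:
  fixes B :: "'a::real_normed_vector \<Rightarrow> real^'n^'n"
  assumes "(B has_derivative B') (at x)" "B x = mat 1"
  shows "((\<lambda>y. det (B y)) has_derivative (\<lambda>v. \<Sum>i\<in>UNIV. B' v $ i $ i)) (at x)"
proof -
  have "((\<lambda>y. det (B y)) has_derivative (\<lambda>v. \<Sum>p\<in>{p. p permutes UNIV}.
      of_int (sign p) * (\<Sum>i\<in>UNIV. B' v $ i $ p i * (\<Prod>j\<in>UNIV - {i}. B x $ j $ p j)))) (at x)"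
    unfolding det_def
    by (intro has_derivative_sum has_derivative_mult_right has_derivative_prod has_derivative_vec_nth assms)
  moreover have prods: "(\<Prod>j\<in>UNIV - {i}. B x $ j $ p j) = (if p = id then 1 else 0)"
    if "p permutes UNIV" for p i
  proof (cases "p = id")
    case False
    then obtain j where j: "p j \<noteq> j" by (auto simp: fun_eq_iff)
    \<comment> \<open>A permutation that moves \<open>j\<close> also moves \<open>p j\<close>. Hence
      some moved index differs from \<open>i\<close>, and the product over the other indices
      contains an off-diagonal entry of the identity matrix.\<close>
    then have "p (p j) \<noteq> p j" using permutes_inj[OF that] by (auto dest: injD)
    then obtain j' where "j' \<noteq> i" "p j' \<noteq> j'" using j by metis
    then have "\<exists>j\<in>UNIV - {i}. B x $ j $ p j = 0"
      by (intro bexI[of _ j']) (auto simp: assms mat_def)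
    then show ?thesis using False by simp
  qed (simp add: assms mat_def)
  moreover have "(\<Sum>p\<in>{p. p permutes UNIV}. of_int (sign p) *
        (\<Sum>i\<in>UNIV. B' v $ i $ p i * (\<Prod>j\<in>UNIV - {i}. B x $ j $ p j)))
      = (\<Sum>p\<in>{p. p permutes (UNIV :: 'n set)}. if p = id then (\<Sum>i\<in>UNIV. B' v $ i $ i) else 0)" for v
    by (rule sum.cong) (auto simp: prods sign_id)
  moreover have "(\<Sum>p\<in>{p. p permutes (UNIV::'n set)}. if p = id then (\<Sum>i\<in>UNIV. B' v $ i $ i) else 0)
      = (\<Sum>i\<in>UNIV. B' v $ i $ i)" for v
    by (subst sum.delta) (auto simp: permutes_id)
  ultimately show ?thesis by simp
qed

text \<open>Jacobi's formula. Multiplying by the constant inverse of \<open>A x\<close> reduces it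
  to the derivative of the determinant at the identity, which is the trace.\<close>

lemma has_derivative_det:
  fixes A :: "'a::real_normed_vector \<Rightarrow> real^'n^'n"
  assumes "(A has_derivative A') (at x)" "det (A x) \<noteq> 0"
  shows "((\<lambda>y. det (A y)) has_derivative
    (\<lambda>v. det (A x) * (\<Sum>i\<in>UNIV. \<Sum>j\<in>UNIV. matrix_inv (A x) $ i $ j * A' v $ j $ i))) (at x)"
proof -
  define C where "C = matrix_inv (A x)"
  have "bounded_linear ((**) C)"
    unfolding linear_conv_bounded_linear[symmetric]
    by (rule linearI) (simp_all add: matrix_matrix_mult_def vec_eq_iff sum.distrib algebra_simps sum_distrib_left)
  then have "((\<lambda>y. C ** A y) has_derivative (\<lambda>v. C ** A' v)) (at x)"
    using assms(1) by (rule bounded_linear.has_derivative)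
  then have "((\<lambda>y. det (C ** A y)) has_derivative (\<lambda>v. \<Sum>i\<in>UNIV. (C ** A' v) $ i $ i)) (at x)"
    by (rule has_derivative_det_at_mat_1) (simp add: C_def matrix_inv_mult assms)
  then have "((\<lambda>y. det (A x) * det (C ** A y)) has_derivative
      (\<lambda>v. det (A x) * (\<Sum>i\<in>UNIV. (C ** A' v) $ i $ i))) (at x)"
    by (rule has_derivative_mult_right)
  moreover have "det (A x) * det (C ** A y) = det (A y)" for y
  proof -
    have "det (A x) * det C = 1"
      unfolding C_def det_mul[symmetric] by (simp add: matrix_inv_mult assms)
    then show ?thesis by (simp add: det_mul)
  qed
  ultimately show ?thesis by (simp add: matrix_matrix_mult_def C_def)
qed

section \<open>Partial derivatives\<close>

lemma pd_works: "f differentiable (at x) \<Longrightarrow> (f has_derivative frechet_derivative f (at x)) (at x)"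
  using frechet_derivative_works by blast

lemma pd_nth:
  "f differentiable (at x) \<Longrightarrow> pd i (\<lambda>x. f x $ k) x = pd i f x $ k"
  by (subst pd_eqI[OF has_derivative_vec_nth[OF pd_works]]) (simp_all add: pd_def)

lemma pd_mult:
  fixes f g :: "real^'m \<Rightarrow> real"
  shows "f differentiable (at x) \<Longrightarrow> g differentiable (at x) \<Longrightarrow>
    pd i (\<lambda>x. f x * g x) x = pd i f x * g x + f x * pd i g x"
  by (subst pd_eqI[OF has_derivative_mult[OF pd_works pd_works]]) (simp_all add: pd_def)

lemma pd_sum:
  assumes "\<And>j. j \<in> J \<Longrightarrow> f j differentiable (at x)"
  shows "pd i (\<lambda>x. \<Sum>j\<in>J. f j x) x = (\<Sum>j\<in>J. pd i (f j) x)"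
  by (subst pd_eqI[OF has_derivative_sum[OF pd_works]]) (simp_all add: pd_def assms)

lemma pd_const: "pd i (\<lambda>x. c) x = 0"
  by (subst pd_eqI[OF has_derivative_const]) simp

lemma vec_eq_sum_axis: "(v :: real^'n) = (\<Sum>c\<in>UNIV. v $ c *\<^sub>R axis c 1)"
  by (simp add: vec_eq_iff axis_def if_distrib sum.delta cong: if_cong)

lemma frechet_derivative_eq_sum_pd:
  assumes "f differentiable (at x)"
  shows "frechet_derivative f (at x) v = (\<Sum>c\<in>UNIV. v $ c *\<^sub>R pd c f x)"
proof -
  have l: "linear (frechet_derivative f (at x))"
    using pd_works[OF assms] by (rule has_derivative_linear)
  have "frechet_derivative f (at x) v = frechet_derivative f (at x) (\<Sum>c\<in>UNIV. v $ c *\<^sub>R axis c 1)"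
    by (rule arg_cong[OF vec_eq_sum_axis])
  also have "\<dots> = (\<Sum>c\<in>UNIV. frechet_derivative f (at x) (v $ c *\<^sub>R axis c 1))"
    by (rule linear_sum[OF l])
  also have "\<dots> = (\<Sum>c\<in>UNIV. v $ c *\<^sub>R pd c f x)"
    unfolding pd_def by (rule sum.cong[OF refl]) (rule linear_cmul[OF l])
  finally show ?thesis .
qed

lemma pd_compose:
  assumes "F differentiable (at x)" "H differentiable (at (F x))"
  shows "pd i (\<lambda>x. H (F x)) x = (\<Sum>c\<in>UNIV. pd i F x $ c *\<^sub>R pd c H (F x))"
proof -
  have "((\<lambda>x. H (F x)) has_derivative
      (\<lambda>v. frechet_derivative H (at (F x)) (frechet_derivative F (at x) v))) (at x)"
    by (rule has_derivative_compose[where g = H, OF pd_works[OF assms(1)] pd_works[OF assms(2)]])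
  then have "pd i (\<lambda>x. H (F x)) x = frechet_derivative H (at (F x)) (pd i F x)"
    unfolding pd_def[of i F] by (rule pd_eqI)
  then show ?thesis by (simp only: frechet_derivative_eq_sum_pd[OF assms(2)])
qed

lemma pd_matrix_inv:
  fixes G :: "real^'m \<Rightarrow> real^'k^'k"
  assumes "open W" "smooth_on W G" "x \<in> W" "\<And>x. x \<in> W \<Longrightarrow> det (G x) \<noteq> 0"
  shows "pd i (\<lambda>x. matrix_inv (G x) $ k $ l) x =
    - (\<Sum>a\<in>UNIV. \<Sum>b\<in>UNIV. matrix_inv (G x) $ k $ a * pd i G x $ a $ b * matrix_inv (G x) $ b $ l)"
proof -
  let ?I = "\<lambda>k l x. matrix_inv (G x) $ k $ l"
  have dI: "?I k l differentiable (at x)" for k l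
    by (rule smooth_on_imp_differentiable[OF _ assms(3)]) (intro smooth_intros assms)
  have dG: "G differentiable (at x)" by (rule smooth_on_imp_differentiable[OF assms(2,3)])
  have dG1: "(\<lambda>x. G x $ a) differentiable (at x)" for a
    by (rule smooth_on_imp_differentiable[OF _ assms(3)]) (intro smooth_intros assms)
  have dG2: "(\<lambda>x. G x $ a $ b) differentiable (at x)" for a b
    by (rule smooth_on_imp_differentiable[OF _ assms(3)]) (intro smooth_intros assms)
  have pG: "pd i (\<lambda>x. G x $ a $ b) x = pd i G x $ a $ b" for a b
    by (simp add: pd_nth dG dG1)
  \<comment> \<open>This differentiates the identity stating that the inverse times \<open>G\<close>
    is constant. Multiplying by the inverse on the right afterwards isolates the derivative of the
    inverse.\<close>
  have eq: "(\<Sum>a\<in>UNIV. pd i (?I k a) x * G x $ a $ b) = - (\<Sum>a\<in>UNIV. ?I k a x * pd i G x $ a $ b)" for b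
  proof -
    have "pd i (\<lambda>x. \<Sum>a\<in>UNIV. ?I k a x * G x $ a $ b) x = pd i (\<lambda>x. if k = b then 1 else 0 :: real) x"
      by (rule pd_cong_open[OF assms(1,3)]) (simp add: matrix_inv_mult_nth assms(4))
    then have "pd i (\<lambda>x. \<Sum>a\<in>UNIV. ?I k a x * G x $ a $ b) x = 0" by (simp add: pd_const)
    moreover have "pd i (\<lambda>x. \<Sum>a\<in>UNIV. ?I k a x * G x $ a $ b) x
        = (\<Sum>a\<in>UNIV. pd i (?I k a) x * G x $ a $ b + ?I k a x * pd i G x $ a $ b)"
      by (subst pd_sum) (auto simp: pd_mult dI dG2 pG intro!: differentiable_mult)
    ultimately show ?thesis by (simp add: sum.distrib)
  qed
  have "pd i (?I k l) x = (\<Sum>a\<in>UNIV. pd i (?I k a) x * (if a = l then 1 else 0))"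
    by (simp add: if_distrib cong: if_cong)
  also have "\<dots> = (\<Sum>a\<in>UNIV. \<Sum>b\<in>UNIV. pd i (?I k a) x * (G x $ a $ b * ?I b l x))"
    by (simp only: sum_distrib_left[symmetric] matrix_inv_mult_nth(1)[OF assms(4)[OF assms(3)]])
  also have "\<dots> = (\<Sum>b\<in>UNIV. (\<Sum>a\<in>UNIV. pd i (?I k a) x * G x $ a $ b) * ?I b l x)"
    by (subst sum.swap) (simp add: sum_distrib_right mult.assoc)
  also have "\<dots> = - (\<Sum>b\<in>UNIV. \<Sum>a\<in>UNIV. ?I k a x * pd i G x $ a $ b * ?I b l x)"
    by (simp add: eq sum_distrib_right sum_negf)
  also have "\<dots> = - (\<Sum>a\<in>UNIV. \<Sum>b\<in>UNIV. ?I k a x * pd i G x $ a $ b * ?I b l x)"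
    unfolding neg_equal_iff_equal by (rule sum.swap)
  finally show ?thesis .
qed

lemma pd_sqrt_det:
  fixes G :: "real^'m \<Rightarrow> real^'k^'k"
  assumes "G differentiable (at x)" "det (G x) > 0"
  shows "pd i (\<lambda>x. sqrt (det (G x))) x =
    sqrt (det (G x)) / 2 * (\<Sum>a\<in>UNIV. \<Sum>b\<in>UNIV. matrix_inv (G x) $ a $ b * pd i G x $ b $ a)"
proof -
  let ?D = "det (G x)" and ?T = "\<lambda>v. \<Sum>a\<in>UNIV. \<Sum>b\<in>UNIV. matrix_inv (G x) $ a $ b * frechet_derivative G (at x) v $ b $ a"
  have "((\<lambda>x. sqrt (det (G x))) has_derivative (\<lambda>v. (?D * ?T v) * (inverse (sqrt ?D) / 2))) (at x)"
    by (rule has_derivative_real_sqrt[OF assms(2) has_derivative_det[OF pd_works[OF assms(1)]]])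
       (use assms(2) in simp)
  then have "pd i (\<lambda>x. sqrt (det (G x))) x = (?D * ?T (axis i 1)) * (inverse (sqrt ?D) / 2)"
    by (rule pd_eqI)
  also have "\<dots> = (?D * inverse (sqrt ?D)) / 2 * ?T (axis i 1)" by simp
  also have "?D * inverse (sqrt ?D) = sqrt ?D"
    using assms(2) by (simp add: divide_inverse[symmetric] real_div_sqrt)
  finally show ?thesis by (simp add: pd_def)
qed

section \<open>The tension field in divergence form\<close>

text \<open>The Christoffel symbols and the tension field as functions of arbitrary coordinate matrices, so
  that they can be applied to a conformally changed metric.\<close>

definition chris :: "(real^'k \<Rightarrow> real^'k^'k) \<Rightarrow> real^'k \<Rightarrow> 'k \<Rightarrow> 'k \<Rightarrow> 'k \<Rightarrow> real" where
  "chris G x k i j = (\<Sum>l\<in>UNIV. matrix_inv (G x) $ k $ l *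
        (pd i G x $ j $ l + pd j G x $ i $ l - pd l G x $ i $ j)) / 2"

definition tens :: "(real^'m \<Rightarrow> real^'m^'m) \<Rightarrow> (real^'n \<Rightarrow> real^'n^'n) \<Rightarrow> (real^'m \<Rightarrow> real^'n)
    \<Rightarrow> real^'m \<Rightarrow> real^'n" where
  "tens G H F x = (\<Sum>i\<in>UNIV. \<Sum>j\<in>UNIV. matrix_inv (G x) $ i $ j *\<^sub>R
     (pd i (pd j F) x + (\<chi> a. \<Sum>b\<in>UNIV. \<Sum>b'\<in>UNIV. chris H (F x) a b b' * pd i F x $ b * pd j F x $ b')
       - (\<Sum>k\<in>UNIV. chris G x k i j *\<^sub>R pd k F x)))"

lemma tension_field_eq_tens:
  "tension_field M g N h c d f x
    = tens (metric_matrix M g c) (metric_matrix N h d) (local_rep c d f) x"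
  by (simp add: tension_field_def tens_def second_fundamental_form_def pullback_conn_def Let_def
      christoffel_def chris_def)

lemma sum_rotate3:
  fixes f :: "'i::finite \<Rightarrow> 'j::finite \<Rightarrow> 'k::finite \<Rightarrow> real"
  shows "(\<Sum>k\<in>UNIV. \<Sum>i\<in>UNIV. \<Sum>j\<in>UNIV. f i j k) = (\<Sum>i\<in>UNIV. \<Sum>j\<in>UNIV. \<Sum>k\<in>UNIV. f i j k)"
proof -
  have "(\<Sum>k\<in>UNIV. \<Sum>i\<in>UNIV. \<Sum>j\<in>UNIV. f i j k) = (\<Sum>i\<in>UNIV. \<Sum>k\<in>UNIV. \<Sum>j\<in>UNIV. f i j k)"
    by (rule sum.swap)
  also have "\<dots> = (\<Sum>i\<in>UNIV. \<Sum>j\<in>UNIV. \<Sum>k\<in>UNIV. f i j k)"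
    by (rule sum.cong[OF refl]) (rule sum.swap)
  finally show ?thesis .
qed

text \<open>The coordinate identity \<open>\<partial>\<^sub>k (\<surd>g g\<^sup>k\<^sup>l) = - \<surd>g g\<^sup>i\<^sup>j \<Gamma>\<^sup>l\<^sub>i\<^sub>j\<close>, with \<open>dg k i j\<close> for \<open>\<partial>\<^sub>k g\<^sub>i\<^sub>j\<close> and with the
  derivatives of \<open>\<surd>g\<close> and \<open>g\<^sup>k\<^sup>l\<close> inserted.\<close>

lemma divergence_inverse_metric_algebra:
  fixes gi :: "'m::finite \<Rightarrow> 'm \<Rightarrow> real" and dg :: "'m \<Rightarrow> 'm \<Rightarrow> 'm \<Rightarrow> real"
  assumes gi: "\<And>k l. gi k l = gi l k" and dg: "\<And>k i j. dg k i j = dg k j i"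
  shows "(\<Sum>k\<in>UNIV. (s / 2 * (\<Sum>i\<in>UNIV. \<Sum>j\<in>UNIV. gi i j * dg k j i)) * gi k l
            + s * - (\<Sum>i\<in>UNIV. \<Sum>j\<in>UNIV. gi k i * dg k i j * gi j l))
    = - s * (\<Sum>i\<in>UNIV. \<Sum>j\<in>UNIV. gi i j * ((\<Sum>p\<in>UNIV. gi l p * (dg i j p + dg j i p - dg p i j)) / 2))"
proof -
  \<comment> \<open>Both sides are combinations of these contractions. Interchanging
    \<open>i\<close> and \<open>j\<close> identifies \<open>T2\<close> with \<open>T1\<close>, so
    the Christoffel side is \<open>T1 - T3 / 2\<close> and the derivatives of the density and of the
    inverse give the same terms with the opposite sign.\<close>
  define T1 where "T1 = (\<Sum>i\<in>UNIV. \<Sum>j\<in>UNIV. \<Sum>p\<in>UNIV. gi i j * gi l p * dg i j p)"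
  define T2 where "T2 = (\<Sum>i\<in>UNIV. \<Sum>j\<in>UNIV. \<Sum>p\<in>UNIV. gi i j * gi l p * dg j i p)"
  define T3 where "T3 = (\<Sum>i\<in>UNIV. \<Sum>j\<in>UNIV. \<Sum>p\<in>UNIV. gi i j * gi l p * dg p i j)"
  have "T2 = (\<Sum>j\<in>UNIV. \<Sum>i\<in>UNIV. \<Sum>p\<in>UNIV. gi i j * gi l p * dg j i p)"
    unfolding T2_def by (rule sum.swap)
  also have "\<dots> = T1" unfolding T1_def by (intro sum.cong refl) (metis gi)
  finally have T21: "T2 = T1" .
  have "(\<Sum>k\<in>UNIV. (\<Sum>i\<in>UNIV. \<Sum>j\<in>UNIV. gi i j * dg k j i) * gi k l)
      = (\<Sum>k\<in>UNIV. \<Sum>i\<in>UNIV. \<Sum>j\<in>UNIV. gi i j * gi l k * dg k i j)"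
    unfolding sum_distrib_right
    by (intro sum.cong refl) (metis gi dg mult.assoc mult.commute)
  also have "\<dots> = T3" unfolding T3_def by (rule sum_rotate3)
  finally have A: "(\<Sum>k\<in>UNIV. (\<Sum>i\<in>UNIV. \<Sum>j\<in>UNIV. gi i j * dg k j i) * gi k l) = T3" .
  have B: "(\<Sum>k\<in>UNIV. \<Sum>i\<in>UNIV. \<Sum>j\<in>UNIV. gi k i * dg k i j * gi j l) = T1"
    unfolding T1_def by (intro sum.cong refl) (simp add: gi[of _ l])
  have L: "(\<Sum>k\<in>UNIV. (s / 2 * (\<Sum>i\<in>UNIV. \<Sum>j\<in>UNIV. gi i j * dg k j i)) * gi k l
            + s * - (\<Sum>i\<in>UNIV. \<Sum>j\<in>UNIV. gi k i * dg k i j * gi j l)) = s / 2 * T3 - s * T1"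
  proof -
    have "(\<Sum>k\<in>UNIV. (c * X k) * Y k + s * - Z k) = c * (\<Sum>k\<in>UNIV. X k * Y k) - s * (\<Sum>k\<in>UNIV. Z k)"
      for c and X Y Z :: "'m \<Rightarrow> real"
      by (simp add: sum.distrib sum_subtractf sum_distrib_left mult.assoc)
    then show ?thesis unfolding A[symmetric] B[symmetric] .
  qed
  have R: "(\<Sum>i\<in>UNIV. \<Sum>j\<in>UNIV. gi i j * ((\<Sum>p\<in>UNIV. gi l p * (dg i j p + dg j i p - dg p i j)) / 2))
      = (T1 + T2 - T3) / 2"
    unfolding T1_def T2_def T3_def
    by (simp add: sum.distrib[symmetric] sum_subtractf[symmetric] sum_distrib_left sum_divide_distrib
        algebra_simps)
  show ?thesis unfolding L R T21 by (simp add: field_simps)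
qed

text \<open>Pure index algebra: \<open>s\<close> stands for the volume density,
  \<open>dS k l\<close> for the derivative of \<open>s * gi k l\<close> in direction
  \<open>k\<close>, \<open>Fd\<close> and \<open>Fdd\<close> for the derivatives of the map,
  \<open>dh c a b\<close> for those of the target metric. Both sides reduce to four contractions:
  second derivatives (\<open>A1\<close>), derivatives of \<open>h\<close> (\<open>A2\<close>,
  \<open>A3\<close>), and the Christoffel symbols of the domain (\<open>A4\<close>), which enter on
  the left through \<open>dS\<close>.\<close>

lemma tension_divergence_algebra:
  fixes gi :: "'m::finite \<Rightarrow> 'm \<Rightarrow> real" and \<Gamma> :: "'m \<Rightarrow> 'm \<Rightarrow> 'm \<Rightarrow> real"
    and Fd :: "'m \<Rightarrow> 'n::finite \<Rightarrow> real" and Fdd :: "'m \<Rightarrow> 'm \<Rightarrow> 'n \<Rightarrow> real"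
    and h hi :: "'n \<Rightarrow> 'n \<Rightarrow> real" and dh :: "'n \<Rightarrow> 'n \<Rightarrow> 'n \<Rightarrow> real"
  assumes gi: "\<And>k l. gi k l = gi l k" and dh: "\<And>c a b. dh c a b = dh c b a"
    and inv: "\<And>a c. (\<Sum>b\<in>UNIV. h a b * hi b c) = (if a = c then 1 else 0)"
    and dS: "\<And>l. (\<Sum>k\<in>UNIV. dS k l) = - s * (\<Sum>i\<in>UNIV. \<Sum>j\<in>UNIV. gi i j * \<Gamma> l i j)"
  shows "(\<Sum>k\<in>UNIV. \<Sum>l\<in>UNIV. dS k l * (\<Sum>b\<in>UNIV. h a b * Fd l b) + s * gi k l *
        (\<Sum>b\<in>UNIV. (\<Sum>c\<in>UNIV. Fd k c * dh c a b) * Fd l b + h a b * Fdd k l b))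
      - s / 2 * (\<Sum>k\<in>UNIV. \<Sum>l\<in>UNIV. gi k l * (\<Sum>b\<in>UNIV. \<Sum>c\<in>UNIV. dh a b c * Fd k b * Fd l c))
    = s * (\<Sum>b\<in>UNIV. h a b * (\<Sum>i\<in>UNIV. \<Sum>j\<in>UNIV. gi i j * (Fdd i j b
        + (\<Sum>c\<in>UNIV. \<Sum>d\<in>UNIV. ((\<Sum>p\<in>UNIV. hi b p * (dh c d p + dh d c p - dh p c d)) / 2) * Fd i c * Fd j d)
        - (\<Sum>k\<in>UNIV. \<Gamma> k i j * Fd k b))))"
proof -
  define Q where "Q l = (\<Sum>b\<in>UNIV. h a b * Fd l b)" for l
  define A1 where "A1 = (\<Sum>i\<in>UNIV. \<Sum>j\<in>UNIV. gi i j * (\<Sum>b\<in>UNIV. h a b * Fdd i j b))"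
  define A2 where "A2 = (\<Sum>i\<in>UNIV. \<Sum>j\<in>UNIV. gi i j * (\<Sum>c\<in>UNIV. \<Sum>d\<in>UNIV. dh c d a * Fd i c * Fd j d))"
  define A2' where "A2' = (\<Sum>i\<in>UNIV. \<Sum>j\<in>UNIV. gi i j * (\<Sum>c\<in>UNIV. \<Sum>d\<in>UNIV. dh d c a * Fd i c * Fd j d))"
  define A3 where "A3 = (\<Sum>i\<in>UNIV. \<Sum>j\<in>UNIV. gi i j * (\<Sum>c\<in>UNIV. \<Sum>d\<in>UNIV. dh a c d * Fd i c * Fd j d))"
  define A4 where "A4 = (\<Sum>i\<in>UNIV. \<Sum>j\<in>UNIV. gi i j * (\<Sum>l\<in>UNIV. \<Gamma> l i j * Q l))"
  have "A2' = (\<Sum>j\<in>UNIV. \<Sum>i\<in>UNIV. gi i j * (\<Sum>c\<in>UNIV. \<Sum>d\<in>UNIV. dh d c a * Fd i c * Fd j d))"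
    unfolding A2'_def by (rule sum.swap)
  also have "\<dots> = (\<Sum>j\<in>UNIV. \<Sum>i\<in>UNIV. gi j i * (\<Sum>d\<in>UNIV. \<Sum>c\<in>UNIV. dh d c a * Fd j d * Fd i c))"
  proof (intro sum.cong refl)
    fix i j
    have "(\<Sum>c\<in>UNIV. \<Sum>d\<in>UNIV. dh d c a * Fd i c * Fd j d) = (\<Sum>d\<in>UNIV. \<Sum>c\<in>UNIV. dh d c a * Fd j d * Fd i c)"
      by (subst sum.swap) (simp only: mult_ac)
    then show "gi i j * (\<Sum>c\<in>UNIV. \<Sum>d\<in>UNIV. dh d c a * Fd i c * Fd j d)
        = gi j i * (\<Sum>d\<in>UNIV. \<Sum>c\<in>UNIV. dh d c a * Fd j d * Fd i c)"
      using gi[of i j] by simp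
  qed
  also have "\<dots> = A2" unfolding A2_def ..
  finally have A22: "A2' = A2" .
  have D: "(\<Sum>k\<in>UNIV. \<Sum>l\<in>UNIV. dS k l * Q l) = - s * A4"
  proof -
    have "(\<Sum>k\<in>UNIV. \<Sum>l\<in>UNIV. dS k l * Q l) = (\<Sum>l\<in>UNIV. (\<Sum>k\<in>UNIV. dS k l) * Q l)"
      by (subst sum.swap) (simp add: sum_distrib_right)
    also have "\<dots> = - s * (\<Sum>l\<in>UNIV. \<Sum>i\<in>UNIV. \<Sum>j\<in>UNIV. gi i j * (\<Gamma> l i j * Q l))"
      by (simp add: dS sum_distrib_left sum_distrib_right mult.assoc sum_negf)
    also have "(\<Sum>l\<in>UNIV. \<Sum>i\<in>UNIV. \<Sum>j\<in>UNIV. gi i j * (\<Gamma> l i j * Q l)) = A4"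
      unfolding A4_def by (subst sum_rotate3) (simp add: sum_distrib_left)
    finally show ?thesis .
  qed
  have E: "(\<Sum>k\<in>UNIV. \<Sum>l\<in>UNIV. s * gi k l *
        (\<Sum>b\<in>UNIV. (\<Sum>c\<in>UNIV. Fd k c * dh c a b) * Fd l b + h a b * Fdd k l b)) = s * (A2 + A1)"
  proof -
    have "(\<Sum>b\<in>UNIV. (\<Sum>c\<in>UNIV. Fd k c * dh c a b) * Fd l b)
        = (\<Sum>c\<in>UNIV. \<Sum>d\<in>UNIV. dh c d a * Fd k c * Fd l d)" for k l
      unfolding sum_distrib_right
      by (subst sum.swap, intro sum.cong refl, subst dh) (simp add: mult_ac)
    then show ?thesis unfolding A1_def A2_def
      by (simp add: sum.distrib sum_distrib_left[symmetric] distrib_left mult.assoc)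
  qed
  have L: "(\<Sum>k\<in>UNIV. \<Sum>l\<in>UNIV. dS k l * (\<Sum>b\<in>UNIV. h a b * Fd l b) + s * gi k l *
        (\<Sum>b\<in>UNIV. (\<Sum>c\<in>UNIV. Fd k c * dh c a b) * Fd l b + h a b * Fdd k l b))
      - s / 2 * (\<Sum>k\<in>UNIV. \<Sum>l\<in>UNIV. gi k l * (\<Sum>b\<in>UNIV. \<Sum>c\<in>UNIV. dh a b c * Fd k b * Fd l c))
      = - s * A4 + s * (A2 + A1) - s / 2 * A3"
    unfolding D[symmetric] E[symmetric] A3_def Q_def by (simp only: sum.distrib)
  \<comment> \<open>Lowering the upper index of the target Christoffel symbol cancels the inverse
    metric inside it; only first derivatives of \<open>h\<close> survive.\<close>
  have hh: "(\<Sum>b\<in>UNIV. h a b * ((\<Sum>p\<in>UNIV. hi b p * (dh c d p + dh d c p - dh p c d)) / 2))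
      = (dh c d a + dh d c a - dh a c d) / 2" for c d
  proof -
    have "(\<Sum>b\<in>UNIV. h a b * ((\<Sum>p\<in>UNIV. hi b p * (dh c d p + dh d c p - dh p c d)) / 2))
        = (\<Sum>b\<in>UNIV. \<Sum>p\<in>UNIV. h a b * hi b p * ((dh c d p + dh d c p - dh p c d) / 2))"
      by (simp add: sum_distrib_left sum_divide_distrib mult.assoc)
    also have "\<dots> = (\<Sum>p\<in>UNIV. (\<Sum>b\<in>UNIV. h a b * hi b p) * ((dh c d p + dh d c p - dh p c d) / 2))"
      by (subst sum.swap) (simp only: sum_distrib_right)
    also have "\<dots> = (\<Sum>p\<in>UNIV. if a = p then (dh c d p + dh d c p - dh p c d) / 2 else 0)"
      unfolding inv by (intro sum.cong) auto
    finally show ?thesis by simp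
  qed
  have trm: "(\<Sum>b\<in>UNIV. h a b * (Fdd i j b
        + (\<Sum>c\<in>UNIV. \<Sum>d\<in>UNIV. ((\<Sum>p\<in>UNIV. hi b p * (dh c d p + dh d c p - dh p c d)) / 2) * Fd i c * Fd j d)
        - (\<Sum>k\<in>UNIV. \<Gamma> k i j * Fd k b)))
      = (\<Sum>b\<in>UNIV. h a b * Fdd i j b)
        + (\<Sum>c\<in>UNIV. \<Sum>d\<in>UNIV. (dh c d a + dh d c a - dh a c d) / 2 * Fd i c * Fd j d)
        - (\<Sum>l\<in>UNIV. \<Gamma> l i j * Q l)" for i j
  proof -
    define W where "W b c d = (\<Sum>p\<in>UNIV. hi b p * (dh c d p + dh d c p - dh p c d)) / 2" for b c d
    have 1: "(\<Sum>b\<in>UNIV. h a b * (\<Sum>c\<in>UNIV. \<Sum>d\<in>UNIV. W b c d * Fd i c * Fd j d))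
        = (\<Sum>c\<in>UNIV. \<Sum>d\<in>UNIV. (\<Sum>b\<in>UNIV. h a b * W b c d) * Fd i c * Fd j d)"
      unfolding sum_distrib_left sum_distrib_right by (subst sum_rotate3) (simp add: mult.assoc)
    have 2: "(\<Sum>b\<in>UNIV. h a b * (\<Sum>k\<in>UNIV. \<Gamma> k i j * Fd k b)) = (\<Sum>l\<in>UNIV. \<Gamma> l i j * Q l)"
      unfolding Q_def sum_distrib_left by (subst sum.swap) (simp add: mult_ac)
    have "(\<Sum>b\<in>UNIV. h a b * (Fdd i j b + (\<Sum>c\<in>UNIV. \<Sum>d\<in>UNIV. W b c d * Fd i c * Fd j d)
        - (\<Sum>k\<in>UNIV. \<Gamma> k i j * Fd k b)))
      = (\<Sum>b\<in>UNIV. h a b * Fdd i j b) + (\<Sum>b\<in>UNIV. h a b * (\<Sum>c\<in>UNIV. \<Sum>d\<in>UNIV. W b c d * Fd i c * Fd j d))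
        - (\<Sum>b\<in>UNIV. h a b * (\<Sum>k\<in>UNIV. \<Gamma> k i j * Fd k b))"
      by (simp only: distrib_left right_diff_distrib sum.distrib sum_subtractf)
    also have "\<dots> = (\<Sum>b\<in>UNIV. h a b * Fdd i j b)
        + (\<Sum>c\<in>UNIV. \<Sum>d\<in>UNIV. (\<Sum>b\<in>UNIV. h a b * W b c d) * Fd i c * Fd j d)
        - (\<Sum>l\<in>UNIV. \<Gamma> l i j * Q l)"
      unfolding 1 2 ..
    finally show ?thesis unfolding W_def hh .
  qed
  have "(\<Sum>b\<in>UNIV. h a b * (\<Sum>i\<in>UNIV. \<Sum>j\<in>UNIV. gi i j * (Fdd i j b
        + (\<Sum>c\<in>UNIV. \<Sum>d\<in>UNIV. ((\<Sum>p\<in>UNIV. hi b p * (dh c d p + dh d c p - dh p c d)) / 2) * Fd i c * Fd j d)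
        - (\<Sum>k\<in>UNIV. \<Gamma> k i j * Fd k b))))
      = (\<Sum>i\<in>UNIV. \<Sum>j\<in>UNIV. gi i j * (\<Sum>b\<in>UNIV. h a b * (Fdd i j b
        + (\<Sum>c\<in>UNIV. \<Sum>d\<in>UNIV. ((\<Sum>p\<in>UNIV. hi b p * (dh c d p + dh d c p - dh p c d)) / 2) * Fd i c * Fd j d)
        - (\<Sum>k\<in>UNIV. \<Gamma> k i j * Fd k b))))"
    (is "(\<Sum>b\<in>UNIV. h a b * (\<Sum>i\<in>UNIV. \<Sum>j\<in>UNIV. gi i j * ?Z b i j)) = _")
    unfolding sum_distrib_left by (subst sum_rotate3) (simp only: mult.left_commute)
  also have "\<dots> = A1 + (A2 + A2' - A3) / 2 - A4"
  proof -
    have q: "gi i j * (\<Sum>c\<in>UNIV. \<Sum>d\<in>UNIV. (dh c d a + dh d c a - dh a c d) / 2 * Fd i c * Fd j d)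
      = (gi i j * (\<Sum>c\<in>UNIV. \<Sum>d\<in>UNIV. dh c d a * Fd i c * Fd j d)
      + gi i j * (\<Sum>c\<in>UNIV. \<Sum>d\<in>UNIV. dh d c a * Fd i c * Fd j d)
      - gi i j * (\<Sum>c\<in>UNIV. \<Sum>d\<in>UNIV. dh a c d * Fd i c * Fd j d)) / 2" for i j
      by (simp add: sum.distrib[symmetric] sum_subtractf[symmetric] sum_distrib_left sum_divide_distrib
          algebra_simps add_divide_distrib diff_divide_distrib)
    have gen: "(\<Sum>i\<in>UNIV. \<Sum>j\<in>UNIV. gi i j * (X i j + Y i j - Z i j))
      = (\<Sum>i\<in>UNIV. \<Sum>j\<in>UNIV. gi i j * X i j) + (\<Sum>i\<in>UNIV. \<Sum>j\<in>UNIV. gi i j * Y i j)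
        - (\<Sum>i\<in>UNIV. \<Sum>j\<in>UNIV. gi i j * Z i j)" for X Y Z :: "'m \<Rightarrow> 'm \<Rightarrow> real"
      by (simp only: distrib_left right_diff_distrib sum.distrib sum_subtractf)
    show ?thesis
      unfolding trm gen q A1_def A2_def A2'_def A3_def A4_def
      by (simp add: sum.distrib sum_subtractf sum_divide_distrib[symmetric])
  qed
  also note R = calculation
  show ?thesis unfolding L R A22 by (simp add: field_simps)
qed

text \<open>Product and chain rule turn the divergence into the data of the two algebraic lemmas:
  the derivatives of the density and of the inverse matrix feed the first, whose result is the
  assumption on \<open>dS\<close> in the second.\<close>

lemma tension_divergence:
  fixes G :: "real^'m \<Rightarrow> real^'m^'m" and H :: "real^'n \<Rightarrow> real^'n^'n" and F :: "real^'m \<Rightarrow> real^'n"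
  assumes W: "open W" "x \<in> W" and V: "open V" "F x \<in> V"
    and G: "smooth_on W G" "\<And>y. y \<in> W \<Longrightarrow> spd (G y)"
    and H: "smooth_on V H" "\<And>y. y \<in> V \<Longrightarrow> spd (H y)"
    and F: "smooth_on W F"
  shows "(\<Sum>k\<in>UNIV. pd k (\<lambda>y. \<Sum>l\<in>UNIV. (sqrt (det (G y)) * matrix_inv (G y) $ k $ l) *
        (\<Sum>b\<in>UNIV. H (F y) $ a $ b * pd l F y $ b)) x)
      - sqrt (det (G x)) / 2 * (\<Sum>k\<in>UNIV. \<Sum>l\<in>UNIV. matrix_inv (G x) $ k $ l *
        (\<Sum>b\<in>UNIV. \<Sum>c\<in>UNIV. pd a H (F x) $ b $ c * pd k F x $ b * pd l F x $ c))
    = sqrt (det (G x)) * (\<Sum>b\<in>UNIV. H (F x) $ a $ b * tens G H F x $ b)"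
proof -
  let ?s = "\<lambda>y. sqrt (det (G y))" and ?gi = "\<lambda>k l y. matrix_inv (G y) $ k $ l"
  define dS where "dS k l = pd k (\<lambda>y. ?s y * ?gi k l y) x" for k l
  note smd = smooth_on_imp_differentiable[OF _ W(2)]
  have detG: "det (G y) > 0" if "y \<in> W" for y using spd_det_pos G(2) that by blast
  have detG0: "det (G y) \<noteq> 0" if "y \<in> W" for y using detG[OF that] by simp
  have Gsym: "G y $ i $ j = G y $ j $ i" if "y \<in> W" for y i j using G(2)[OF that] by (simp add: spd_def)
  have Hsym: "H y $ i $ j = H y $ j $ i" if "y \<in> V" for y i j using H(2)[OF that] by (simp add: spd_def)
  have detGx: "det (G x) \<noteq> 0" using detG[OF W(2)] by simp
  have detHx: "det (H (F x)) \<noteq> 0" using spd_det_pos[OF H(2)[OF V(2)]] by simp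
  have ds: "?s differentiable (at x)"
    by (rule smd) (intro smooth_intros W G detG detG0; assumption)
  have dgi: "?gi k l differentiable (at x)" for k l
    by (rule smd) (intro smooth_intros W G detG detG0; assumption)
  have dF: "F differentiable (at x)" and dG: "G differentiable (at x)"
    by (rule smd, fact)+
  have dpF: "pd l F differentiable (at x)" for l by (rule smd) (intro smooth_intros F)
  have dpFb: "(\<lambda>y. pd l F y $ b) differentiable (at x)" for l b
    by (rule smd) (intro smooth_intros F W)
  have dH: "H differentiable (at (F x))" by (rule smooth_on_imp_differentiable[OF H(1) V(2)])
  have dHa: "(\<lambda>z. H z $ a $ b) differentiable (at (F x))" for a b
    by (rule smooth_on_imp_differentiable[OF _ V(2)]) (intro smooth_intros H V)
  have dHF: "(\<lambda>y. H (F y) $ a $ b) differentiable (at x)" for b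
    using differentiable_compose[OF dHa dF] .
  have pH: "pd c (\<lambda>z. H z $ a $ b) (F x) = pd c H (F x) $ a $ b" for a b c
  proof -
    have "(\<lambda>z. H z $ a) differentiable (at (F x))"
      by (rule smooth_on_imp_differentiable[OF _ V(2)]) (intro smooth_intros H V)
    then show ?thesis by (simp add: pd_nth dH)
  qed
  have pG: "pd c (\<lambda>z. G z $ a $ b) x = pd c G x $ a $ b" for a b c
  proof -
    have "(\<lambda>z. G z $ a) differentiable (at x)" by (rule smd) (intro smooth_intros G W)
    then show ?thesis by (simp add: pd_nth dG)
  qed
  have dHsym: "pd c H (F x) $ a $ b = pd c H (F x) $ b $ a" for a b c
    unfolding pH[symmetric] by (rule pd_cong_open[OF V]) (rule Hsym)
  have dGsym: "pd c G x $ a $ b = pd c G x $ b $ a" for a b c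
    unfolding pG[symmetric] by (rule pd_cong_open[OF W]) (rule Gsym)
  have gisym: "?gi k l x = ?gi l k x" for k l
    by (rule matrix_inv_sym[OF detGx]) (rule Gsym[OF W(2)])
  have dQ: "(\<lambda>y. \<Sum>b\<in>UNIV. H (F y) $ a $ b * pd l F y $ b) differentiable (at x)" for l
    by (intro differentiable_sum ballI differentiable_mult dHF dpFb) auto
  have pQ: "pd k (\<lambda>y. \<Sum>b\<in>UNIV. H (F y) $ a $ b * pd l F y $ b) x
      = (\<Sum>b\<in>UNIV. (\<Sum>c\<in>UNIV. pd k F x $ c * pd c H (F x) $ a $ b) * pd l F x $ b
          + H (F x) $ a $ b * pd k (pd l F) x $ b)" for k l
  proof -
    have "pd k (\<lambda>y. H (F y) $ a $ b) x = (\<Sum>c\<in>UNIV. pd k F x $ c * pd c H (F x) $ a $ b)" for b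
      by (simp add: pd_compose[OF dF dHa] pH)
    moreover have "pd k (\<lambda>y. pd l F y $ b) x = pd k (pd l F) x $ b" for b
      by (rule pd_nth[OF dpF])
    ultimately show ?thesis
      by (simp add: pd_sum pd_mult differentiable_mult dHF dpFb)
  qed
  have "pd k (\<lambda>y. \<Sum>l\<in>UNIV. (?s y * ?gi k l y) * (\<Sum>b\<in>UNIV. H (F y) $ a $ b * pd l F y $ b)) x
      = (\<Sum>l\<in>UNIV. dS k l * (\<Sum>b\<in>UNIV. H (F x) $ a $ b * pd l F x $ b)
        + ?s x * ?gi k l x * (\<Sum>b\<in>UNIV. (\<Sum>c\<in>UNIV. pd k F x $ c * pd c H (F x) $ a $ b) * pd l F x $ b
          + H (F x) $ a $ b * pd k (pd l F) x $ b))" for k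
    unfolding dS_def pQ[symmetric]
    by (subst pd_sum) (simp_all add: pd_mult[OF differentiable_mult[OF ds dgi] dQ] differentiable_mult ds dgi dQ)
  moreover have "(\<Sum>k\<in>UNIV. dS k l) = - ?s x * (\<Sum>i\<in>UNIV. \<Sum>j\<in>UNIV. ?gi i j x * chris G x l i j)" for l
  proof -
    have "dS k l = (?s x / 2 * (\<Sum>i\<in>UNIV. \<Sum>j\<in>UNIV. ?gi i j x * pd k G x $ j $ i)) * ?gi k l x
        + ?s x * - (\<Sum>i\<in>UNIV. \<Sum>j\<in>UNIV. ?gi k i x * pd k G x $ i $ j * ?gi j l x)" for k
      unfolding dS_def pd_mult[OF ds dgi] pd_sqrt_det[OF dG detG[OF W(2)]]
      by (subst pd_matrix_inv[OF W(1) G(1) W(2)]) (simp_all add: detG0)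
    then show ?thesis
      unfolding chris_def
      by (simp only: divergence_inverse_metric_algebra[where gi = "\<lambda>k l. ?gi k l x"
            and dg = "\<lambda>k i j. pd k G x $ i $ j", OF gisym dGsym])
  qed
  moreover have "tens G H F x $ b = (\<Sum>i\<in>UNIV. \<Sum>j\<in>UNIV. ?gi i j x * (pd i (pd j F) x $ b
        + (\<Sum>c\<in>UNIV. \<Sum>d\<in>UNIV. chris H (F x) b c d * pd i F x $ c * pd j F x $ d)
        - (\<Sum>k\<in>UNIV. chris G x k i j * pd k F x $ b)))" for b
    unfolding tens_def by (simp add: sum_component)
  ultimately show ?thesis
    using tension_divergence_algebra[where gi = "\<lambda>k l. ?gi k l x" and s = "?s x" and dS = dS
        and dh = "\<lambda>c a b. pd c H (F x) $ a $ b" and h = "\<lambda>a b. H (F x) $ a $ b" and a = a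
        and hi = "\<lambda>a b. matrix_inv (H (F x)) $ a $ b" and \<Gamma> = "\<lambda>l i j. chris G x l i j"
        and Fd = "\<lambda>k b. pd k F x $ b" and Fdd = "\<lambda>i j b. pd i (pd j F) x $ b",
        OF gisym dHsym matrix_inv_mult_nth(1)[OF detHx]]
    by (simp only: chris_def[of H])
qed

section \<open>Charts and tangent vectors\<close>

locale smooth_mfd =
  fixes M :: "('a, 'm::finite) manifold"
  assumes smooth: "smooth_manifold M"
begin

lemma topspace_eq: "topspace (topo M) = (\<Union>c\<in>atlas M. fst c)"
  using smooth by (simp add: smooth_manifold_def)

lemma hausdorff: "Hausdorff_space (topo M)"
  using smooth by (simp add: smooth_manifold_def)

lemma chart_open: "c \<in> atlas M \<Longrightarrow> openin (topo M) (fst c)"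
  and chart_image_open: "c \<in> atlas M \<Longrightarrow> open (chart_image c)"
  and chart_homeo: "c \<in> atlas M \<Longrightarrow>
    homeomorphic_map (subtopology (topo M) (fst c)) (top_of_set (chart_image c)) (snd c)"
  using smooth by (auto simp: smooth_manifold_def)

lemma smooth_transition: "c \<in> atlas M \<Longrightarrow> c' \<in> atlas M \<Longrightarrow>
    smooth_on (snd c ` (fst c \<inter> fst c')) (local_rep c c' id)"
  using smooth by (auto simp: smooth_manifold_def)

lemma charts_atD: "c \<in> charts_at M p \<Longrightarrow> c \<in> atlas M" "c \<in> charts_at M p \<Longrightarrow> p \<in> fst c"
  by (auto simp: charts_at_def)

lemma charts_at_ex: "p \<in> topspace (topo M) \<Longrightarrow> \<exists>c. c \<in> charts_at M p"
  by (auto simp: topspace_eq charts_at_def)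

lemma chart_topspace: "c \<in> atlas M \<Longrightarrow> topspace (subtopology (topo M) (fst c)) = fst c"
  by (auto simp: topspace_eq)

lemma chart_inj: "c \<in> atlas M \<Longrightarrow> inj_on (snd c) (fst c)"
  using homeomorphic_imp_injective_map[OF chart_homeo] chart_topspace by metis

lemma chart_inv_left: "c \<in> atlas M \<Longrightarrow> p \<in> fst c \<Longrightarrow> chart_inv c (snd c p) = p"
  by (simp add: chart_inv_def chart_inj inv_into_f_f)

lemma chart_inv_right: "x \<in> chart_image c \<Longrightarrow> snd c (chart_inv c x) = x"
  by (simp add: chart_inv_def chart_image_def f_inv_into_f)

lemma chart_inv_in: "x \<in> chart_image c \<Longrightarrow> chart_inv c x \<in> fst c"
  by (simp add: chart_inv_def chart_image_def inv_into_into)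

lemma chart_image_in: "p \<in> fst c \<Longrightarrow> snd c p \<in> chart_image c"
  by (simp add: chart_image_def)

lemma chart_continuous:
  "c \<in> atlas M \<Longrightarrow> continuous_map (subtopology (topo M) (fst c)) euclidean (snd c)"
  using homeomorphic_imp_continuous_map[OF chart_homeo, of c] by (simp add: continuous_map_in_subtopology)

lemma chart_inv_image:
  assumes "c \<in> atlas M" "V \<subseteq> chart_image c"
  shows "chart_inv c ` V = {p \<in> fst c. snd c p \<in> V}"
proof (intro equalityI subsetI)
  fix p assume "p \<in> chart_inv c ` V"
  then obtain x where "x \<in> V" "p = chart_inv c x" by auto
  then show "p \<in> {p \<in> fst c. snd c p \<in> V}"
    using assms(2) chart_inv_right[of x c] chart_inv_in[of x c] by auto
next
  fix p assume "p \<in> {p \<in> fst c. snd c p \<in> V}"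
  then show "p \<in> chart_inv c ` V" using chart_inv_left[OF assms(1), of p] by (metis (no_types, lifting) image_eqI mem_Collect_eq)
qed

lemma open_chart_image:
  assumes "c \<in> atlas M" "openin (topo M) U"
  shows "open (snd c ` (fst c \<inter> U))"
proof -
  have "openin (subtopology (topo M) (fst c)) (fst c \<inter> U)"
    using assms(2) by (simp add: openin_subtopology_Int2)
  then have "openin (top_of_set (chart_image c)) (snd c ` (fst c \<inter> U))"
    using homeomorphic_imp_open_map[OF chart_homeo[OF assms(1)]] unfolding open_map_def by simp
  then show ?thesis by (rule openin_open_trans[OF _ chart_image_open[OF assms(1)]])
qed

lemma openin_chart_preimage:
  assumes "c \<in> atlas M" "open V"
  shows "openin (topo M) {p \<in> fst c. snd c p \<in> V}"
proof -
  have "openin (subtopology (topo M) (fst c)) {p \<in> topspace (subtopology (topo M) (fst c)). snd c p \<in> V}"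
    using assms(2) by (intro openin_continuous_map_preimage[OF chart_continuous[OF assms(1)]]) simp
  then have "openin (subtopology (topo M) (fst c)) {p \<in> fst c. snd c p \<in> V}"
    by (simp only: chart_topspace[OF assms(1)])
  then show ?thesis using chart_open[OF assms(1)] by (simp add: openin_open_subtopology)
qed

lemma openin_chart_inv_image:
  "c \<in> atlas M \<Longrightarrow> open V \<Longrightarrow> V \<subseteq> chart_image c \<Longrightarrow> openin (topo M) (chart_inv c ` V)"
  by (simp add: chart_inv_image openin_chart_preimage)

lemma chart_inv_continuous:
  assumes "c \<in> atlas M"
  shows "continuous_map (top_of_set (chart_image c)) (topo M) (chart_inv c)"
proof -
  have "{x \<in> chart_image c. chart_inv c x \<in> U} = snd c ` (fst c \<inter> U)" for U
  proof (intro equalityI subsetI)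
    fix x assume "x \<in> {x \<in> chart_image c. chart_inv c x \<in> U}"
    then show "x \<in> snd c ` (fst c \<inter> U)"
      using chart_inv_right[of x c] chart_inv_in[of x c] by (intro image_eqI[of _ _ "chart_inv c x"]) auto
  next
    fix x assume "x \<in> snd c ` (fst c \<inter> U)"
    then show "x \<in> {x \<in> chart_image c. chart_inv c x \<in> U}"
      using chart_inv_left[OF assms] chart_image_in[of _ c] by auto
  qed
  then have "openin (top_of_set (chart_image c)) {x \<in> chart_image c. chart_inv c x \<in> U}"
    if "openin (topo M) U" for U
    using open_chart_image[OF assms that] by (simp add: openin_open_eq chart_image_open[OF assms])
      (auto simp: chart_image_def)
  moreover have "chart_inv c \<in> chart_image c \<rightarrow> topspace (topo M)"
    using chart_inv_in[of _ c] assms by (auto simp: topspace_eq)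
  ultimately show ?thesis by (simp add: continuous_map_def)
qed

lemma open_overlap: "c \<in> atlas M \<Longrightarrow> c' \<in> atlas M \<Longrightarrow> open (snd c ` (fst c \<inter> fst c'))"
  by (rule open_chart_image[OF _ chart_open])

lemma local_rep_id [simp]: "local_rep c c' id = (\<lambda>x. snd c' (chart_inv c x))"
  by (simp add: local_rep_def)

lemma overlap_image:
  assumes "c \<in> atlas M"
  shows "x \<in> snd c ` (fst c \<inter> fst c') \<longleftrightarrow> x \<in> chart_image c \<and> chart_inv c x \<in> fst c'"
proof
  assume "x \<in> snd c ` (fst c \<inter> fst c')"
  then show "x \<in> chart_image c \<and> chart_inv c x \<in> fst c'"
    using chart_inv_left[OF assms] chart_image_in[of _ c] by auto
next
  assume "x \<in> chart_image c \<and> chart_inv c x \<in> fst c'"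
  then show "x \<in> snd c ` (fst c \<inter> fst c')"
    using chart_inv_right[of x c] chart_inv_in[of x c] by (intro image_eqI[of _ _ "chart_inv c x"]) auto
qed

section \<open>Transition maps and tangent vectors in charts\<close>

lemma transition_has_derivative:
  assumes "c \<in> charts_at M p" "c' \<in> charts_at M p"
  shows "((\<lambda>x. snd c' (chart_inv c x)) has_derivative
    frechet_derivative (\<lambda>x. snd c' (chart_inv c x)) (at (snd c p))) (at (snd c p))"
  by (rule smooth_on_has_derivative[OF smooth_transition[of c c', simplified]])
     (use assms in \<open>auto simp: charts_at_def\<close>)

lemma transition_linear:
  assumes "c \<in> charts_at M p" "c' \<in> charts_at M p"
  shows "linear (frechet_derivative (\<lambda>x. snd c' (chart_inv c x)) (at (snd c p)))"
  using transition_has_derivative[OF assms] by (rule has_derivative_linear)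

lemma local_rep_change_source:
  assumes "c \<in> charts_at M p" "c' \<in> charts_at M p"
    "(local_rep c' d f has_derivative L) (at (snd c' p))"
  shows "(local_rep c d f has_derivative
    (\<lambda>v. L (frechet_derivative (\<lambda>x. snd c' (chart_inv c x)) (at (snd c p)) v))) (at (snd c p))"
proof -
  let ?U = "snd c ` (fst c \<inter> fst c')"
  have at: "c \<in> atlas M" "c' \<in> atlas M" using assms by (auto simp: charts_at_def)
  have "(local_rep c' d f has_derivative L) (at (snd c' (chart_inv c (snd c p))))"
    using assms(3) chart_inv_left[OF at(1)] charts_atD(2)[OF assms(1)] by simp
  then have "((\<lambda>x. local_rep c' d f (snd c' (chart_inv c x))) has_derivative
    (\<lambda>v. L (frechet_derivative (\<lambda>x. snd c' (chart_inv c x)) (at (snd c p)) v))) (at (snd c p))"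
    by (rule has_derivative_compose[OF transition_has_derivative[OF assms(1,2)]])
  moreover have eq: "local_rep c' d f (snd c' (chart_inv c x)) = local_rep c d f x" if "x \<in> ?U" for x
    using that chart_inv_left[OF at(1)] chart_inv_left[OF at(2)] by (auto simp: local_rep_def)
  have "snd c p \<in> ?U" using assms by (auto simp: charts_at_def)
  ultimately show ?thesis
    by (rule has_derivative_cong_open[OF open_overlap[OF at] _ eq, THEN iffD1, rotated -1])
qed

lemma transition_self:
  assumes "c \<in> charts_at M p"
  shows "frechet_derivative (\<lambda>x. snd c (chart_inv c x)) (at (snd c p)) = (\<lambda>v. v)"
proof (rule frechet_derivative_eqI)
  show "((\<lambda>x. snd c (chart_inv c x)) has_derivative (\<lambda>v. v)) (at (snd c p))"
    by (rule has_derivative_cong_open[OF chart_image_open[of c] chart_image_in[of p c],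
          of "\<lambda>x. x", THEN iffD1])
       (use chart_inv_right[of _ c] assms in \<open>auto simp: charts_at_def\<close>)
qed

text \<open>The cocycle rule for transition derivatives is the change of source chart applied to the
  identity map. It is what makes \<open>tvec\<close> satisfy the transformation law.\<close>

lemma transition_chain:
  assumes "c \<in> charts_at M p" "c' \<in> charts_at M p" "c'' \<in> charts_at M p"
  shows "frechet_derivative (\<lambda>x. snd c'' (chart_inv c x)) (at (snd c p)) v
    = frechet_derivative (\<lambda>x. snd c'' (chart_inv c' x)) (at (snd c' p))
        (frechet_derivative (\<lambda>x. snd c' (chart_inv c x)) (at (snd c p)) v)"
  using frechet_derivative_eqI[OF local_rep_change_source[OF assms(1,2), of c'' id]]
    transition_has_derivative[OF assms(2,3)] by simp

text \<open>The tangent vector with components \<open>w\<close> in the chart \<open>c\<close>. By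
  \<open>tvec_self\<close> and \<open>tvec_comp\<close> this inverts evaluation at \<open>c\<close>,
  so one chart identifies the tangent space with the coordinate space.\<close>

definition tvec :: "('a, 'm) chart \<Rightarrow> 'a \<Rightarrow> real^'m \<Rightarrow> ('a, 'm) tangent_vec" where
  "tvec c p w = (\<lambda>c'. if c' \<in> charts_at M p
     then frechet_derivative (\<lambda>x. snd c' (chart_inv c x)) (at (snd c p)) w else 0)"

lemma tvec_in: "c \<in> charts_at M p \<Longrightarrow> tvec c p w \<in> tangent_space M p"
  unfolding tangent_space_def tvec_def by (auto intro: transition_chain)

lemma tvec_self: "c \<in> charts_at M p \<Longrightarrow> tvec c p w c = w"
  by (simp add: tvec_def transition_self)

lemma tangent_change:
  "v \<in> tangent_space M p \<Longrightarrow> c \<in> charts_at M p \<Longrightarrow> c' \<in> charts_at M p \<Longrightarrow>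
    v c' = frechet_derivative (\<lambda>x. snd c' (chart_inv c x)) (at (snd c p)) (v c)"
  unfolding tangent_space_def local_rep_id by blast

lemma tangent_outside: "v \<in> tangent_space M p \<Longrightarrow> c \<notin> charts_at M p \<Longrightarrow> v c = 0"
  unfolding tangent_space_def by blast

lemma tvec_comp: "c \<in> charts_at M p \<Longrightarrow> v \<in> tangent_space M p \<Longrightarrow> tvec c p (v c) = v"
proof
  fix c' assume c: "c \<in> charts_at M p" and v: "v \<in> tangent_space M p"
  show "tvec c p (v c) c' = v c'"
  proof (cases "c' \<in> charts_at M p")
    case True
    then show ?thesis unfolding tvec_def tangent_change[OF v c True] by (rule if_P)
  next
    case False
    then show ?thesis by (simp add: tvec_def tangent_outside[OF v])
  qed
qed

lemma tangent_eqI: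
  assumes "c \<in> charts_at M p" "u \<in> tangent_space M p" "v \<in> tangent_space M p" "u c = v c"
  shows "u = v"
proof -
  have "tvec c p (u c) = tvec c p (v c)" using assms(4) by (rule arg_cong)
  then show ?thesis unfolding tvec_comp[OF assms(1,2)] tvec_comp[OF assms(1,3)] .
qed

lemma coord_vec_eq: "coord_vec M c p i = tvec c p (axis i 1)"
  unfolding coord_vec_def tvec_def local_rep_id ..

lemma tangent_zero: "(\<lambda>_. 0) \<in> tangent_space M p"
  unfolding tangent_space_def local_rep_id using linear_0[OF transition_linear] by auto

lemma tangent_lincomb:
  assumes "u \<in> tangent_space M p" "v \<in> tangent_space M p"
  shows "(\<lambda>c. r *\<^sub>R u c + v c) \<in> tangent_space M p"
proof -
  have "r *\<^sub>R u c' + v c' = frechet_derivative (\<lambda>x. snd c' (chart_inv c x)) (at (snd c p)) (r *\<^sub>R u c + v c)"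
    if "c \<in> charts_at M p" "c' \<in> charts_at M p" for c c'
  proof -
    let ?D = "frechet_derivative (\<lambda>x. snd c' (chart_inv c x)) (at (snd c p))"
    have "?D (r *\<^sub>R u c + v c) = r *\<^sub>R ?D (u c) + ?D (v c)"
      using linear_add[OF transition_linear[OF that]] linear_cmul[OF transition_linear[OF that]]
      by presburger
    moreover have "?D (u c) = u c'" by (rule tangent_change[OF assms(1) that, symmetric])
    moreover have "?D (v c) = v c'" by (rule tangent_change[OF assms(2) that, symmetric])
    ultimately show ?thesis by presburger
  qed
  note change = this
  show ?thesis
    unfolding tangent_space_def local_rep_id mem_Collect_eq
  proof (intro conjI ballI allI impI)
    fix c assume "c \<notin> charts_at M p"
    then show "r *\<^sub>R u c + v c = 0"
      by (simp add: tangent_outside[OF assms(1)] tangent_outside[OF assms(2)])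
  qed (rule change)
qed

lemma tangent_sum:
  assumes "finite I" "\<And>i. i \<in> I \<Longrightarrow> u i \<in> tangent_space M p"
  shows "(\<lambda>c. \<Sum>i\<in>I. a i *\<^sub>R u i c) \<in> tangent_space M p"
  using assms
proof (induction I rule: finite_induct)
  case empty
  then show ?case by (simp add: tangent_zero)
next
  case (insert i I)
  then show ?case using tangent_lincomb[of "u i" p "\<lambda>c. \<Sum>i\<in>I. a i *\<^sub>R u i c" "a i"] by simp
qed

end

section \<open>Riemannian metrics and the energy density in coordinates\<close>

locale riem_mfd =
  fixes M :: "('a, 'm::finite) manifold" and g :: "('a, 'm) metric"
  assumes riem: "riemannian_manifold M g"
begin

sublocale smooth_mfd M
  using riem by unfold_locales (simp add: riemannian_manifold_def)

lemma metric_sym: "p \<in> topspace (topo M) \<Longrightarrow> u \<in> tangent_space M p \<Longrightarrow> v \<in> tangent_space M p \<Longrightarrow>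
    g p u v = g p v u"
  and metric_lincomb: "p \<in> topspace (topo M) \<Longrightarrow> u \<in> tangent_space M p \<Longrightarrow> v \<in> tangent_space M p \<Longrightarrow>
    w \<in> tangent_space M p \<Longrightarrow> g p (\<lambda>c. r *\<^sub>R u c + v c) w = r * g p u w + g p v w"
  and metric_pos: "p \<in> topspace (topo M) \<Longrightarrow> u \<in> tangent_space M p \<Longrightarrow> u \<noteq> (\<lambda>_. 0) \<Longrightarrow> g p u u > 0"
  and metric_matrix_smooth: "c \<in> atlas M \<Longrightarrow> smooth_on (chart_image c) (metric_matrix M g c)"
  using riem unfolding riemannian_manifold_def riemannian_metric_def by blast+

lemma chart_in_topspace: "c \<in> charts_at M p \<Longrightarrow> p \<in> topspace (topo M)"
  by (auto simp: charts_at_def topspace_eq)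

lemma metric_zero: "p \<in> topspace (topo M) \<Longrightarrow> w \<in> tangent_space M p \<Longrightarrow> g p (\<lambda>_. 0) w = 0"
  using metric_lincomb[of p "\<lambda>_. 0" "\<lambda>_. 0" w 1] tangent_zero by simp

lemma metric_sum:
  assumes "p \<in> topspace (topo M)" "finite I" "\<And>i. i \<in> I \<Longrightarrow> u i \<in> tangent_space M p"
    "w \<in> tangent_space M p"
  shows "g p (\<lambda>c. \<Sum>i\<in>I. a i *\<^sub>R u i c) w = (\<Sum>i\<in>I. a i * g p (u i) w)"
  using assms(2,3)
proof (induction I rule: finite_induct)
  case empty
  then show ?case by (simp add: metric_zero assms)
next
  case (insert i I)
  then show ?case
    using metric_lincomb[OF assms(1) _ tangent_sum assms(4), of "u i" I u "a i" a] by simp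
qed

lemma tangent_expand:
  assumes c: "c \<in> charts_at M p" and v: "v \<in> tangent_space M p"
  shows "v = (\<lambda>c'. \<Sum>i\<in>UNIV. v c $ i *\<^sub>R coord_vec M c p i c')"
proof (rule tangent_eqI[OF c v])
  show "(\<lambda>c'. \<Sum>i\<in>UNIV. v c $ i *\<^sub>R coord_vec M c p i c') \<in> tangent_space M p"
    by (rule tangent_sum) (auto simp: coord_vec_eq tvec_in[OF c])
  show "v c = (\<Sum>i\<in>UNIV. v c $ i *\<^sub>R coord_vec M c p i c)"
    using vec_eq_sum_axis[of "v c"] by (simp add: coord_vec_eq tvec_self[OF c])
qed

lemma metric_coords:
  assumes c: "c \<in> charts_at M p" and u: "u \<in> tangent_space M p" and v: "v \<in> tangent_space M p"
  shows "g p u v = u c \<bullet> (metric_matrix M g c (snd c p) *v v c)"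
proof -
  let ?e = "coord_vec M c p"
  have p: "p \<in> topspace (topo M)" by (rule chart_in_topspace[OF c])
  have e: "?e i \<in> tangent_space M p" for i by (simp add: coord_vec_eq tvec_in[OF c])
  have ev: "g p (?e i) v = (\<Sum>j\<in>UNIV. v c $ j * g p (?e i) (?e j))" for i
  proof -
    \<comment> \<open>The definition of a metric gives linearity in the first argument only; the
      second argument is reached through symmetry.\<close>
    have "g p (?e i) v = g p v (?e i)" using p e v by (rule metric_sym)
    also have "\<dots> = g p (\<lambda>c'. \<Sum>j\<in>UNIV. v c $ j *\<^sub>R ?e j c') (?e i)"
      using tangent_expand[OF c v] by simp
    also have "\<dots> = (\<Sum>j\<in>UNIV. v c $ j * g p (?e j) (?e i))"
      by (rule metric_sum[OF p]) (auto simp: e)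
    finally show ?thesis using metric_sym[OF p e e] by simp
  qed
  have "g p u v = g p (\<lambda>c'. \<Sum>j\<in>UNIV. u c $ j *\<^sub>R ?e j c') v"
    using tangent_expand[OF c u] by simp
  also have "\<dots> = (\<Sum>j\<in>UNIV. u c $ j * g p (?e j) v)"
    by (rule metric_sum[OF p]) (auto simp: e v)
  finally show ?thesis
    using chart_inv_left[of c p] charts_atD[OF c]
    by (simp add: ev inner_vec_def matrix_vector_mult_def metric_matrix_def Let_def mult.commute)
qed

lemma metric_matrix_spd:
  assumes "c \<in> atlas M" "x \<in> chart_image c"
  shows "spd (metric_matrix M g c x)"
proof -
  define p where "p = chart_inv c x"
  have c: "c \<in> charts_at M p" using assms chart_inv_in[of x c] by (auto simp: charts_at_def p_def)
  have x: "snd c p = x" using assms chart_inv_right by (simp add: p_def)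
  have p: "p \<in> topspace (topo M)" by (rule chart_in_topspace[OF c])
  have "metric_matrix M g c x $ i $ j = metric_matrix M g c x $ j $ i" for i j
    using metric_sym[OF p] tvec_in[OF c]
    by (simp add: metric_matrix_def Let_def p_def[symmetric] coord_vec_eq)
  moreover have "w \<bullet> (metric_matrix M g c x *v w) > 0" if "w \<noteq> 0" for w
  proof -
    have "tvec c p w \<noteq> (\<lambda>_. 0)" using tvec_self[OF c, of w] that by auto
    then have "g p (tvec c p w) (tvec c p w) > 0" using metric_pos[OF p tvec_in[OF c]] by blast
    then show ?thesis using metric_coords[OF c tvec_in[OF c] tvec_in[OF c]] by (simp add: tvec_self[OF c] x)
  qed
  ultimately show ?thesis by (simp add: spd_def)
qed

lemma orthonormal_basis_ex:
  assumes c: "c \<in> charts_at M p"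
  shows "\<exists>e. orthonormal_basis M g p e"
proof -
  obtain E :: "'m \<Rightarrow> real^'m" where E: "\<forall>i j. E i \<bullet> (metric_matrix M g c (snd c p) *v E j) = (if i = j then 1 else 0)"
    using spd_orthonormal_exists[OF metric_matrix_spd[OF charts_atD(1)[OF c] chart_image_in[OF charts_atD(2)[OF c]]]] ..
  have "orthonormal_basis M g p (\<lambda>i. tvec c p (E i))"
    unfolding orthonormal_basis_def
    by (intro conjI allI tvec_in[OF c])
       (simp only: metric_coords[OF c tvec_in[OF c] tvec_in[OF c]] tvec_self[OF c] E[rule_format])
  then show ?thesis by blast
qed

lemma orthonormal_basis_sum:
  assumes c: "c \<in> charts_at M p" and e: "orthonormal_basis M g p e"
  shows "(\<Sum>i\<in>UNIV. e i c $ k * e i c $ l) = matrix_inv (metric_matrix M g c (snd c p)) $ k $ l"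
  by (rule orthonormal_sum_matrix_inv(1))
     (use e metric_coords[OF c, symmetric] in \<open>simp add: orthonormal_basis_def\<close>)

end

text \<open>The squared Hilbert-Schmidt norm in coordinates, where \<open>A k\<close> is the
  \<open>k\<close>-th partial derivative of the map. Phrased for bare matrices so that it can be
  differentiated along a variation.\<close>

definition edens :: "real^'m^'m \<Rightarrow> real^'n^'n \<Rightarrow> ('m \<Rightarrow> real^'n) \<Rightarrow> real" where
  "edens G H A = (\<Sum>k\<in>UNIV. \<Sum>l\<in>UNIV. matrix_inv G $ k $ l *
     (\<Sum>a\<in>UNIV. \<Sum>b\<in>UNIV. H $ a $ b * A k $ a * A l $ b))"

section \<open>The differential and the Hilbert-Schmidt norm in charts\<close>

locale riem_pair = M: riem_mfd M g + N: riem_mfd N h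
  for M :: "('a, 'm::finite) manifold" and g :: "('a, 'm) metric"
    and N :: "('b, 'n::finite) manifold" and h :: "('b, 'n) metric"
begin

lemma local_rep_change_target:
  assumes f: "continuous_map (topo M) (topo N) f"
    and c: "c \<in> charts_at M p" and d: "d \<in> charts_at N (f p)" "d' \<in> charts_at N (f p)"
    and F: "(local_rep c d f has_derivative L) (at (snd c p))"
  shows "(local_rep c d' f has_derivative
    (\<lambda>v. frechet_derivative (\<lambda>x. snd d' (chart_inv d x)) (at (snd d (f p))) (L v))) (at (snd c p))"
proof -
  define U where "U = {q \<in> topspace (topo M). f q \<in> fst d \<inter> fst d'}"
  have d_at: "d \<in> atlas N" "d' \<in> atlas N" using d by (auto simp: charts_at_def)
  have "openin (topo M) U" unfolding U_def
    by (rule openin_continuous_map_preimage[OF f]) (use d_at N.chart_open in blast)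
  then have op: "open (snd c ` (fst c \<inter> U))"
    using M.open_chart_image M.charts_atD[OF c] by blast
  have x: "snd c p \<in> snd c ` (fst c \<inter> U)"
    using M.charts_atD[OF c] M.chart_in_topspace[OF c] d by (auto simp: U_def charts_at_def)
  have Fx: "local_rep c d f (snd c p) = snd d (f p)"
    using M.chart_inv_left M.charts_atD[OF c] by (simp add: local_rep_def)
  have der: "((\<lambda>x. snd d' (chart_inv d (local_rep c d f x))) has_derivative
    (\<lambda>v. frechet_derivative (\<lambda>x. snd d' (chart_inv d x)) (at (snd d (f p))) (L v))) (at (snd c p))"
    by (rule has_derivative_compose[where f = "local_rep c d f" and g = "\<lambda>y. snd d' (chart_inv d y)", OF F])
       (use N.transition_has_derivative[OF d] Fx in simp)
  have eq: "snd d' (chart_inv d (local_rep c d f x)) = local_rep c d' f x"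
    if x: "x \<in> snd c ` (fst c \<inter> U)" for x
  proof -
    obtain q where q: "q \<in> fst c" "q \<in> U" "x = snd c q" using x by auto
    then have "chart_inv c x = q" using M.chart_inv_left M.charts_atD[OF c] by simp
    then show ?thesis using q N.chart_inv_left[OF d_at(1)] by (simp add: local_rep_def U_def)
  qed
  show ?thesis
    by (rule has_derivative_cong_open[OF op x eq, THEN iffD1, OF _ der])
qed

text \<open>\<open>differential\<close> is computed in an arbitrarily chosen chart
  \<open>c0\<close>. Changing the source chart from \<open>c0\<close> to \<open>c\<close> is
  absorbed by the transformation law of \<open>v\<close>, and changing the target chart is the
  transformation law of the result.\<close>

lemma differential_coords:
  assumes f: "continuous_map (topo M) (topo N) f"
    and c: "c \<in> charts_at M p" and d: "d \<in> charts_at N (f p)"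
    and F: "local_rep c d f differentiable (at (snd c p))" and v: "v \<in> tangent_space M p"
  shows "differential M N f p v \<in> tangent_space N (f p)"
    and "differential M N f p v d = frechet_derivative (local_rep c d f) (at (snd c p)) (v c)"
proof -
  let ?L = "frechet_derivative (local_rep c d f) (at (snd c p))"
  define c0 where "c0 = (SOME c. c \<in> charts_at M p)"
  have c0: "c0 \<in> charts_at M p" unfolding c0_def using c by (rule someI)
  have F0: "(local_rep c d f has_derivative ?L) (at (snd c p))" using F by (rule pd_works)
  have eq: "frechet_derivative (local_rep c0 d' f) (at (snd c0 p)) (v c0)
      = frechet_derivative (\<lambda>x. snd d' (chart_inv d x)) (at (snd d (f p))) (?L (v c))"
    if "d' \<in> charts_at N (f p)" for d'
    by (subst frechet_derivative_eqI[OF M.local_rep_change_source[OF c0 c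
          local_rep_change_target[OF f c d that F0]]])
       (simp add: M.tangent_change[OF v c0 c, symmetric])
  have "differential M N f p v = N.tvec d (f p) (?L (v c))"
    unfolding differential_def Let_def c0_def[symmetric] N.tvec_def by (rule ext) (simp add: eq)
  then show "differential M N f p v \<in> tangent_space N (f p)"
    "differential M N f p v d = ?L (v c)"
    by (simp_all add: N.tvec_in[OF d] N.tvec_self[OF d])
qed

text \<open>The chosen orthonormal basis enters only through the sums of products of its components,
  and these are the entries of the inverse metric matrix.\<close>

lemma hs_norm_coords:
  assumes f: "continuous_map (topo M) (topo N) f"
    and c: "c \<in> charts_at M p" and d: "d \<in> charts_at N (f p)"
    and F: "local_rep c d f differentiable (at (snd c p))"
  shows "(hs_norm M g N h f p)\<^sup>2 = edens (metric_matrix M g c (snd c p))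
    (metric_matrix N h d (snd d (f p))) (\<lambda>k. pd k (local_rep c d f) (snd c p))"
proof -
  define e where "e = (SOME e. orthonormal_basis M g p e)"
  have e: "orthonormal_basis M g p e"
    unfolding e_def using M.orthonormal_basis_ex[OF c] by (rule someI_ex)
  then have et: "e i \<in> tangent_space M p" for i by (simp add: orthonormal_basis_def)
  let ?df = "\<lambda>i. differential M N f p (e i)"
  let ?H = "metric_matrix N h d (snd d (f p))" and ?G = "metric_matrix M g c (snd c p)"
  let ?A = "\<lambda>k. pd k (local_rep c d f) (snd c p)"
  have fp: "f p \<in> topspace (topo N)" by (rule N.chart_in_topspace[OF d])
  have df: "?df i \<in> tangent_space N (f p)" "?df i d = (\<Sum>k\<in>UNIV. e i c $ k *\<^sub>R ?A k)" for i
    using differential_coords[OF f c d F et] by (auto simp: frechet_derivative_eq_sum_pd[OF F])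
  \<comment> \<open>Squaring cancels the square root only for a nonnegative sum. Positivity of the
    metric is given for nonzero vectors, hence the separate zero case.\<close>
  have nn: "h (f p) (?df i) (?df i) \<ge> 0" for i
    using N.metric_pos[OF fp df(1)] N.metric_zero[OF fp N.tangent_zero]
    by (cases "?df i = (\<lambda>_. 0)") (auto simp: less_imp_le)
  have "(hs_norm M g N h f p)\<^sup>2 = (\<Sum>i\<in>UNIV. h (f p) (?df i) (?df i))"
    unfolding hs_norm_def Let_def e_def[symmetric] by (simp add: nn sum_nonneg)
  also have "\<dots> = (\<Sum>i\<in>UNIV. \<Sum>k\<in>UNIV. \<Sum>l\<in>UNIV. e i c $ k * e i c $ l * (?A k \<bullet> (?H *v ?A l)))"
  proof (rule sum.cong[OF refl])
    fix i
    have ms: "?H *v (\<Sum>l\<in>UNIV. e i c $ l *\<^sub>R ?A l) = (\<Sum>l\<in>UNIV. e i c $ l *\<^sub>R (?H *v ?A l))"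
      by (simp add: linear_sum[OF matrix_vector_mul_linear] matrix_vector_mult_scaleR)
    have "h (f p) (?df i) (?df i) = ?df i d \<bullet> (?H *v ?df i d)"
      by (rule N.metric_coords[OF d df(1) df(1)])
    also have "\<dots> = (\<Sum>k\<in>UNIV. \<Sum>l\<in>UNIV. e i c $ k * e i c $ l * (?A k \<bullet> (?H *v ?A l)))"
      unfolding df(2) ms
      by (simp add: inner_sum_left inner_sum_right sum_distrib_left mult.assoc)
        (subst sum.swap, simp add: mult.left_commute)
    finally show "h (f p) (?df i) (?df i)
      = (\<Sum>k\<in>UNIV. \<Sum>l\<in>UNIV. e i c $ k * e i c $ l * (?A k \<bullet> (?H *v ?A l)))" .
  qed
  also have "\<dots> = (\<Sum>k\<in>UNIV. \<Sum>l\<in>UNIV. matrix_inv ?G $ k $ l * (?A k \<bullet> (?H *v ?A l)))"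
    by (subst sum_rotate3) (simp only: sum_distrib_right[symmetric] M.orthonormal_basis_sum[OF c e])
  also have "\<dots> = edens ?G ?H ?A"
    unfolding edens_def inner_vec_def matrix_vector_mult_def
    by (simp add: sum_distrib_left mult_ac)
  finally show ?thesis .
qed

end

section \<open>Change of variables over an arbitrary finite index type\<close>

text \<open>The library's change of variables theorem is stated for well-ordered index types, so we
  transfer it along a well-ordered copy of the index type.\<close>

typedef 'm wo = "UNIV :: 'm set" by auto

instance wo :: (finite) finite
proof
  have "range (Abs_wo :: 'a \<Rightarrow> 'a wo) = UNIV" by (metis Rep_wo_inverse surjI)
  then show "finite (UNIV :: 'a wo set)" by (metis finite finite_imageI)
qed

definition wo_rank :: "'m::finite wo \<Rightarrow> nat" where
  "wo_rank = (SOME f. inj f)"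

lemma inj_wo_rank: "inj wo_rank"
proof -
  have "\<exists>f :: 'm::finite wo \<Rightarrow> nat. inj f"
    using finite_imp_inj_to_nat_seg[of "UNIV :: 'm wo set"] by auto
  then show ?thesis unfolding wo_rank_def by (rule someI_ex)
qed

instantiation wo :: (finite) wellorder
begin
definition "x \<le> y \<longleftrightarrow> wo_rank x \<le> wo_rank (y :: 'a wo)"
definition "x < y \<longleftrightarrow> wo_rank x < wo_rank (y :: 'a wo)"
instance
proof
  fix P :: "'a wo \<Rightarrow> bool" and a
  assume *: "\<And>x. (\<And>y. y < x \<Longrightarrow> P y) \<Longrightarrow> P x"
  show "P a" by (induction a rule: measure_induct[of wo_rank]) (auto intro: * simp: less_wo_def)
qed (auto simp: less_eq_wo_def less_wo_def dest: injD[OF inj_wo_rank])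

end

definition to_wo :: "real^'m \<Rightarrow> real^('m::finite wo)" where
  "to_wo x = (\<chi> i. x $ Rep_wo i)"

definition of_wo :: "real^('m::finite wo) \<Rightarrow> real^'m" where
  "of_wo x = (\<chi> i. x $ Abs_wo i)"

lemma of_to_wo [simp]: "of_wo (to_wo x) = x" "to_wo (of_wo y) = y"
  by (simp_all add: of_wo_def to_wo_def vec_eq_iff Abs_wo_inverse Rep_wo_inverse)

lemma bounded_linear_to_wo: "bounded_linear to_wo"
  and bounded_linear_of_wo: "bounded_linear of_wo"
  unfolding linear_conv_bounded_linear[symmetric]
  by (auto intro!: linearI simp: to_wo_def of_wo_def vec_eq_iff)

lemma bij_Rep_wo: "bij Rep_wo"
  by (rule bij_betw_byWitness[where f' = Abs_wo]) (auto simp: Rep_wo_inverse Abs_wo_inverse)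

lemma bij_Abs_wo: "bij Abs_wo"
  by (rule bij_betw_byWitness[where f' = Rep_wo]) (auto simp: Rep_wo_inverse Abs_wo_inverse)

lemma prod_Basis_cart: "(\<Prod>b\<in>(Basis :: (real^'n) set). f b) = (\<Prod>i\<in>UNIV. f (axis i 1))"
proof -
  have inj: "inj (\<lambda>i::'n. axis i (1::real))" by (rule injI) (simp add: axis_eq_axis)
  have "(Basis :: (real^'n) set) = range (\<lambda>i. axis i 1)" by (auto simp: Basis_vec_def)
  then show ?thesis by (rule prod.reindex_cong[OF inj]) (rule refl)
qed

text \<open>Relabelling coordinates maps boxes to boxes with the same side lengths, and Lebesgue
  measure is determined by its values on boxes.\<close>

lemma distr_lborel_to_wo: "distr lborel borel (to_wo :: real^'m::finite \<Rightarrow> _) = lborel"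
proof (rule lborel_eqI[symmetric])
  fix l u :: "real^('m wo)"
  assume lu: "\<And>b. b \<in> Basis \<Longrightarrow> l \<bullet> b \<le> u \<bullet> b"
  have "l $ i \<le> u $ i" for i
    using lu[of "axis i 1"] by (simp add: inner_axis axis_in_Basis_iff)
  then have lu': "of_wo l \<bullet> b \<le> of_wo u \<bullet> b" if "b \<in> Basis" for b
    using that by (auto simp: Basis_vec_def inner_axis of_wo_def)
  have "to_wo -` box l u = box (of_wo l) (of_wo u)"
    by (auto simp: mem_box_cart to_wo_def of_wo_def) (metis Rep_wo_inverse Abs_wo_inverse UNIV_I)+
  then have "emeasure (distr lborel borel to_wo) (box l u) = emeasure lborel (box (of_wo l) (of_wo u))"
    by (subst emeasure_distr)
      (simp_all add: borel_measurable_continuous_onI[OF linear_continuous_on[OF bounded_linear_to_wo]])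
  also have "\<dots> = ennreal (\<Prod>b\<in>Basis. (of_wo u - of_wo l) \<bullet> b)"
    by (rule emeasure_lborel_box[OF lu'])
  also have "(\<Prod>b\<in>Basis. (of_wo u - of_wo l) \<bullet> b) = (\<Prod>i\<in>UNIV. u $ Abs_wo i - l $ Abs_wo i)"
    by (simp add: prod_Basis_cart inner_axis of_wo_def)
  also have "\<dots> = (\<Prod>b\<in>Basis. (u - l) \<bullet> b)"
    using prod.reindex_bij_betw[OF bij_Abs_wo, of "\<lambda>i. u $ i - l $ i"]
    by (simp add: prod_Basis_cart inner_axis)
  finally show "emeasure (distr lborel borel to_wo) (box l u) = ennreal (\<Prod>b\<in>Basis. (u - l) \<bullet> b)" .
qed simp

text \<open>Conjugation with the bijection of index types matches the permutations in the Leibniz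
  formula. It sends transpositions to transpositions, so it preserves signs.\<close>

lemma det_reindex_wo:
  fixes A :: "real^'m::finite^'m"
  shows "det (\<chi> i j. A $ Rep_wo i $ Rep_wo j) = det A"
proof -
  let ?B = "\<chi> i j. A $ Rep_wo i $ Rep_wo j"
  define \<phi> where "\<phi> p = Rep_wo \<circ> p \<circ> Abs_wo" for p :: "'m wo \<Rightarrow> 'm wo"
  define \<psi> where "\<psi> q = Abs_wo \<circ> q \<circ> Rep_wo" for q :: "'m \<Rightarrow> 'm"
  have [simp]: "Rep_wo (Abs_wo x) = x" for x :: 'm by (simp add: Abs_wo_inverse)
  have [simp]: "Abs_wo (Rep_wo x) = x" for x :: "'m wo" by (rule Rep_wo_inverse)
  have perm: "p permutes UNIV \<longleftrightarrow> bij p" for p :: "'z \<Rightarrow> 'z"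
    by (simp add: permutes_univ bij_iff)
  have bij: "bij_betw \<phi> {p. p permutes UNIV} {q. q permutes UNIV}"
  proof (rule bij_betw_byWitness[where f' = \<psi>])
    show "\<phi> ` {p. p permutes UNIV} \<subseteq> {q. q permutes UNIV}"
      unfolding perm \<phi>_def by (auto intro!: bij_comp bij_Rep_wo bij_Abs_wo)
    show "\<psi> ` {q. q permutes UNIV} \<subseteq> {p. p permutes UNIV}"
      unfolding perm \<psi>_def by (auto intro!: bij_comp bij_Rep_wo bij_Abs_wo)
  qed (auto simp: \<phi>_def \<psi>_def fun_eq_iff)
  have sgn: "sign (\<phi> p) = sign p" if "p permutes UNIV" for p
    using that finite
  proof (induction p rule: permutes_induct)
    case id
    have "\<phi> id = id" by (simp add: \<phi>_def fun_eq_iff)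
    then show ?case by (simp only: sign_id)
  next
    case (swap a b p)
    have eq: "\<phi> (Transposition.transpose a b \<circ> p) = Transposition.transpose (Rep_wo a) (Rep_wo b) \<circ> \<phi> p"
      by (auto simp: \<phi>_def fun_eq_iff Transposition.transpose_def Rep_wo_inject)
    have "\<phi> p permutes UNIV" using bij swap by (auto simp: bij_betw_def)
    then have p: "permutation (\<phi> p)" "permutation p"
      using swap permutation_permutes finite by blast+
    have "Rep_wo a \<noteq> Rep_wo b" using swap by (simp add: Rep_wo_inject)
    then show ?case
      unfolding eq sign_compose[OF permutation_swap_id p(1)] sign_compose[OF permutation_swap_id p(2)]
      using swap by (simp add: sign_swap_id)
  qed
  have "det A = (\<Sum>q\<in>{q. q permutes UNIV}. of_int (sign q) * (\<Prod>i\<in>UNIV. A $ i $ q i))"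
    by (simp add: det_def)
  also have "\<dots> = (\<Sum>p\<in>{p. p permutes UNIV}. of_int (sign (\<phi> p)) * (\<Prod>i\<in>UNIV. A $ i $ \<phi> p i))"
    by (rule sum.reindex_bij_betw[OF bij, symmetric])
  also have "\<dots> = (\<Sum>p\<in>{p. p permutes UNIV}. of_int (sign p) * (\<Prod>i\<in>UNIV. ?B $ i $ p i))"
  proof (rule sum.cong[OF refl])
    fix p :: "'m wo \<Rightarrow> 'm wo" assume "p \<in> {p. p permutes UNIV}"
    moreover have "(\<Prod>i\<in>UNIV. A $ i $ \<phi> p i) = (\<Prod>i\<in>UNIV. ?B $ i $ p i)"
      using prod.reindex_bij_betw[OF bij_Rep_wo, of "\<lambda>i. A $ i $ \<phi> p i"] by (simp add: \<phi>_def)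
    ultimately show "of_int (sign (\<phi> p)) * (\<Prod>i\<in>UNIV. A $ i $ \<phi> p i)
        = of_int (sign p) * (\<Prod>i\<in>UNIV. ?B $ i $ p i)"
      by (simp add: sgn)
  qed
  finally show ?thesis by (simp add: det_def)
qed

text \<open>Translates between absolute integrability, in which the change of variables theorem is
  phrased, and nonnegative integrals, in which the measure is defined. The value infinity accounts
  for the nonintegrable case.\<close>

lemma nn_integral_eq_integral_or_top:
  fixes h :: "'a::euclidean_space \<Rightarrow> real"
  assumes "S \<in> sets borel" "(\<lambda>x. indicator S x * h x) \<in> borel_measurable borel"
    "\<And>x. x \<in> S \<Longrightarrow> h x \<ge> 0"
  shows "(\<integral>\<^sup>+x\<in>S. ennreal (h x) \<partial>lborel)
    = (if h absolutely_integrable_on S then ennreal (integral S h) else \<infinity>)"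
proof -
  let ?f = "\<lambda>x. indicator S x * h x"
  have f: "?f \<in> borel_measurable lborel" using assms(2) by simp
  have nn: "?f x \<ge> 0" for x using assms(3) by (auto simp: indicator_def)
  have eq: "(\<integral>\<^sup>+x\<in>S. ennreal (h x) \<partial>lborel) = (\<integral>\<^sup>+x. ennreal (?f x) \<partial>lborel)"
    by (intro nn_integral_cong) (auto simp: indicator_def)
  have abs: "h absolutely_integrable_on S \<longleftrightarrow> integrable lborel ?f"
    unfolding set_integrable_def real_scaleR_def by (rule integrable_completion[OF f])
  show ?thesis
  proof (cases "integrable lborel ?f")
    case True
    have "(\<integral>\<^sup>+x. ennreal (?f x) \<partial>lborel) = ennreal (\<integral>x. ?f x \<partial>lborel)"
      by (rule nn_integral_eq_integral[OF True]) (simp add: nn)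
    moreover have "set_integrable lborel S h" using True by (simp add: set_integrable_def)
    from set_borel_integral_eq_integral(2)[OF this] have "(\<integral>x. ?f x \<partial>lborel) = integral S h"
      by (simp add: set_lebesgue_integral_def)
    ultimately show ?thesis using True by (simp add: eq abs)
  next
    case False
    then have "(\<integral>\<^sup>+x. ennreal (?f x) \<partial>lborel) = \<infinity>"
      using integrableI_nonneg[OF f] nn by (auto simp: less_top[symmetric])
    then show ?thesis using False by (simp add: eq abs)
  qed
qed

text \<open>Measurability is asked of the functions \<open>f\<close> and \<open>h\<close> on the
  whole space, while \<open>h\<close> is tied to the Jacobian on \<open>S\<close> alone. In the
  application both are volume densities extended by zero.\<close>

lemma nn_integral_change_of_variables_wo:
  fixes \<theta> :: "real^'k::{finite,wellorder} \<Rightarrow> real^'k::_" and f h :: "real^'k::_ \<Rightarrow> real"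
  assumes S: "S \<in> sets borel" "\<theta> ` S \<in> sets borel"
    and der: "\<And>x. x \<in> S \<Longrightarrow> (\<theta> has_derivative \<theta>' x) (at x)" and inj: "inj_on \<theta> S"
    and f: "f \<in> borel_measurable borel" "\<And>x. f x \<ge> 0" and h: "h \<in> borel_measurable borel" "\<And>x. h x \<ge> 0"
    and fh: "\<And>x. x \<in> S \<Longrightarrow> h x = \<bar>det (matrix (\<theta>' x))\<bar> * f (\<theta> x)"
  shows "(\<integral>\<^sup>+y\<in>\<theta> ` S. ennreal (f y) \<partial>lborel) = (\<integral>\<^sup>+x\<in>S. ennreal (h x) \<partial>lborel)"
proof -
  have S': "S \<in> sets lebesgue" using S(1) by simp
  \<comment> \<open>The underlying theorem concerns vector-valued integrands, so real functions pass
    through \<open>real^1\<close>. The value \<open>b\<close> is left free, so that integrability on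
    either side can be converted into integrability on the other with the same value.\<close>
  have "(\<lambda>x. \<bar>det (matrix (\<theta>' x))\<bar> * f (\<theta> x)) absolutely_integrable_on S \<and>
      integral S (\<lambda>x. \<bar>det (matrix (\<theta>' x))\<bar> * f (\<theta> x)) = b
      \<longleftrightarrow> f absolutely_integrable_on (\<theta> ` S) \<and> integral (\<theta> ` S) f = b" for b
    using has_absolute_integral_change_of_variables[OF S' has_derivative_at_withinI[OF der] inj,
        of "\<lambda>x. vec (f x) :: real^1" "vec b"]
    unfolding absolutely_integrable_on_1_iff integral_on_1_eq by (simp add: vec_eq_iff)
  moreover have "(\<lambda>x. \<bar>det (matrix (\<theta>' x))\<bar> * f (\<theta> x)) absolutely_integrable_on S \<longleftrightarrow> h absolutely_integrable_on S"
    by (rule absolutely_integrable_spike_eq[of "{}"]) (auto simp: fh)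
  moreover have "integral S (\<lambda>x. \<bar>det (matrix (\<theta>' x))\<bar> * f (\<theta> x)) = integral S h"
    by (rule integral_cong) (simp add: fh)
  ultimately have *: "h absolutely_integrable_on S \<and> integral S h = b
      \<longleftrightarrow> f absolutely_integrable_on (\<theta> ` S) \<and> integral (\<theta> ` S) f = b" for b by simp
  have "(\<integral>\<^sup>+y\<in>\<theta> ` S. ennreal (f y) \<partial>lborel)
    = (if f absolutely_integrable_on \<theta> ` S then ennreal (integral (\<theta> ` S) f) else \<infinity>)"
    using S f by (intro nn_integral_eq_integral_or_top) auto
  moreover have "(\<integral>\<^sup>+x\<in>S. ennreal (h x) \<partial>lborel)
    = (if h absolutely_integrable_on S then ennreal (integral S h) else \<infinity>)"
    using S h by (intro nn_integral_eq_integral_or_top) auto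
  ultimately show ?thesis using *[of "integral S h"] *[of "integral (\<theta> ` S) f"] by auto
qed

lemma nn_integral_of_wo:
  fixes f :: "real^'m::finite \<Rightarrow> ennreal"
  assumes "f \<in> borel_measurable borel"
  shows "(\<integral>\<^sup>+y. f (of_wo y) \<partial>lborel) = (\<integral>\<^sup>+x. f x \<partial>lborel)"
proof -
  have m: "of_wo \<in> borel_measurable borel" "to_wo \<in> borel_measurable borel"
    by (auto intro!: borel_measurable_continuous_onI linear_continuous_on bounded_linear_of_wo bounded_linear_to_wo)
  have "(\<integral>\<^sup>+y. f (of_wo y) \<partial>lborel) = (\<integral>\<^sup>+y. f (of_wo y) \<partial>distr lborel borel to_wo)"
    by (simp only: distr_lborel_to_wo)
  also have "\<dots> = (\<integral>\<^sup>+x. f (of_wo (to_wo x)) \<partial>lborel)"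
    using measurable_compose[OF m(1) assms] m(2) by (intro nn_integral_distr) auto
  finally show ?thesis by simp
qed

lemma nn_integral_change_of_variables:
  fixes \<theta> :: "real^'m::finite \<Rightarrow> real^'m" and f h :: "real^'m \<Rightarrow> real"
  assumes S: "S \<in> sets borel" "\<theta> ` S \<in> sets borel"
    and der: "\<And>x. x \<in> S \<Longrightarrow> (\<theta> has_derivative \<theta>' x) (at x)" and inj: "inj_on \<theta> S"
    and f: "f \<in> borel_measurable borel" "\<And>x. f x \<ge> 0" and h: "h \<in> borel_measurable borel" "\<And>x. h x \<ge> 0"
    and fh: "\<And>x. x \<in> S \<Longrightarrow> h x = \<bar>det (matrix (\<theta>' x))\<bar> * f (\<theta> x)"
  shows "(\<integral>\<^sup>+y\<in>\<theta> ` S. ennreal (f y) \<partial>lborel) = (\<integral>\<^sup>+x\<in>S. ennreal (h x) \<partial>lborel)"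
proof -
  have m: "of_wo \<in> borel_measurable borel" "to_wo \<in> borel_measurable borel"
    by (auto intro!: borel_measurable_continuous_onI linear_continuous_on bounded_linear_of_wo bounded_linear_to_wo)
  have im: "to_wo ` T = of_wo -` T" for T :: "(real^'m) set"
    by (auto simp: image_iff) (metis of_to_wo(2))
  have mem: "y \<in> to_wo ` T \<longleftrightarrow> of_wo y \<in> T" for y and T :: "(real^'m) set" by (simp add: im)
  have imS: "to_wo ` T \<in> sets borel" if "T \<in> sets borel" for T :: "(real^'m) set"
    using measurable_sets[OF m(1) that] by (simp add: im)
  define \<eta> where "\<eta> y = to_wo (\<theta> (of_wo y))" for y
  define \<eta>' where "\<eta>' y v = to_wo (\<theta>' (of_wo y) (of_wo v))" for y v
  have \<eta>S: "\<eta> ` (to_wo ` S) = to_wo ` (\<theta> ` S)" by (simp add: \<eta>_def image_image)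
  have "(\<integral>\<^sup>+y\<in>\<eta> ` (to_wo ` S). ennreal (f (of_wo y)) \<partial>lborel)
      = (\<integral>\<^sup>+y\<in>to_wo ` S. ennreal (h (of_wo y)) \<partial>lborel)"
  proof (rule nn_integral_change_of_variables_wo[where \<theta>' = \<eta>'])
    show "to_wo ` S \<in> sets borel" "\<eta> ` (to_wo ` S) \<in> sets borel"
      using S by (simp_all only: \<eta>S imS)
    show "inj_on \<eta> (to_wo ` S)"
    proof (rule inj_onI)
      fix y z assume yz: "y \<in> to_wo ` S" "z \<in> to_wo ` S" "\<eta> y = \<eta> z"
      then have "of_wo (\<eta> y) = of_wo (\<eta> z)" by simp
      then have "\<theta> (of_wo y) = \<theta> (of_wo z)" by (simp add: \<eta>_def)
      then have "of_wo y = of_wo z" using inj yz by (simp add: mem inj_on_def)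
      then have "to_wo (of_wo y) = to_wo (of_wo z)" by simp
      then show "y = z" by simp
    qed
    fix y assume "y \<in> to_wo ` S"
    then have y: "of_wo y \<in> S" by (simp add: mem)
    note d = der[OF y]
    have "((\<lambda>y. \<theta> (of_wo y)) has_derivative (\<lambda>v. \<theta>' (of_wo y) (of_wo v))) (at y)"
      by (rule has_derivative_compose[where g = \<theta>, OF bounded_linear.has_derivative[OF bounded_linear_of_wo has_derivative_ident] d])
    then show "(\<eta> has_derivative \<eta>' y) (at y)"
      unfolding \<eta>_def[abs_def] \<eta>'_def[abs_def] by (rule bounded_linear.has_derivative[OF bounded_linear_to_wo])
    have "matrix (\<eta>' y) = (\<chi> i j. matrix (\<theta>' (of_wo y)) $ Rep_wo i $ Rep_wo j)"
    proof -
      have ax: "of_wo (axis j 1) = axis (Rep_wo j) (1::real)" for j :: "'m wo"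
        by (auto simp: of_wo_def axis_def vec_eq_iff Rep_wo_inverse Abs_wo_inverse)
      show ?thesis by (simp add: matrix_def \<eta>'_def to_wo_def ax)
    qed
    then have "det (matrix (\<eta>' y)) = det (matrix (\<theta>' (of_wo y)))" by (simp add: det_reindex_wo)
    then show "h (of_wo y) = \<bar>det (matrix (\<eta>' y))\<bar> * f (of_wo (\<eta> y))"
      using fh[OF y] by (simp add: \<eta>_def)
  qed (use f h m measurable_compose in \<open>auto\<close>)
  moreover have "(\<integral>\<^sup>+y\<in>to_wo ` T. ennreal (u (of_wo y)) \<partial>lborel) = (\<integral>\<^sup>+x\<in>T. ennreal (u x) \<partial>lborel)"
    if "T \<in> sets borel" "u \<in> borel_measurable borel" for T and u :: "real^'m \<Rightarrow> real"
  proof -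
    have "(\<integral>\<^sup>+y\<in>to_wo ` T. ennreal (u (of_wo y)) \<partial>lborel)
        = (\<integral>\<^sup>+y. ennreal (u (of_wo y)) * indicator T (of_wo y) \<partial>lborel)"
      by (intro nn_integral_cong) (simp add: indicator_def mem)
    also have "\<dots> = (\<integral>\<^sup>+x\<in>T. ennreal (u x) \<partial>lborel)"
      using that by (intro nn_integral_of_wo[where f = "\<lambda>x. ennreal (u x) * indicator T x"]
          borel_measurable_times_ennreal borel_measurable_indicator measurable_compose[OF _ measurable_ennreal]) auto
    finally show ?thesis .
  qed
  ultimately show ?thesis using S f(1) h(1) unfolding \<eta>S by simp
qed

section \<open>The Riemannian measure\<close>

context smooth_mfd begin

text \<open>Carries the Borel sets of the manifold; as a measure it is zero.\<close>

definition borel_M :: "'a measure" where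
  "borel_M = sigma (topspace (topo M)) {U. openin (topo M) U}"

lemma openin_Pow: "{U. openin (topo M) U} \<subseteq> Pow (topspace (topo M))"
  using openin_subset by auto

lemma sets_borel_M: "sets borel_M = sigma_sets (topspace (topo M)) {U. openin (topo M) U}"
  and space_borel_M [simp]: "space borel_M = topspace (topo M)"
  unfolding borel_M_def using openin_Pow by (simp_all add: sets_measure_of space_measure_of)

lemma openin_sets_borel_M: "openin (topo M) U \<Longrightarrow> U \<in> sets borel_M"
  by (simp add: sets_borel_M)

lemma chart_sets_borel_M: "c \<in> atlas M \<Longrightarrow> fst c \<in> sets borel_M"
  by (simp add: openin_sets_borel_M chart_open)

lemma chart_inv_preimage:
  "c \<in> atlas M \<Longrightarrow> A \<subseteq> fst c \<Longrightarrow> chart_inv c -` A \<inter> chart_image c = snd c ` A"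
  using chart_inv_left[of c] chart_inv_right[of _ c] chart_image_in[of _ c]
  by (auto simp: image_iff subset_iff) force+

lemma chart_inv_measurable:
  assumes "c \<in> atlas M"
  shows "chart_inv c \<in> measurable (restrict_space borel (chart_image c)) borel_M"
  unfolding borel_M_def
proof (rule measurable_measure_of[OF openin_Pow])
  show "chart_inv c \<in> space (restrict_space borel (chart_image c)) \<rightarrow> topspace (topo M)"
    using chart_inv_in[of _ c] assms by (auto simp: space_restrict_space topspace_eq)
  fix U assume "U \<in> {U. openin (topo M) U}"
  then have U: "openin (topo M) U" by simp
  have "chart_inv c -` U \<inter> chart_image c = chart_inv c -` (fst c \<inter> U) \<inter> chart_image c"
    using chart_inv_in[of _ c] by auto
  also have "\<dots> = snd c ` (fst c \<inter> U)" by (rule chart_inv_preimage[OF assms]) simp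
  finally have "chart_inv c -` U \<inter> chart_image c \<in> sets borel"
    using open_chart_image[OF assms U] by simp
  then show "chart_inv c -` U \<inter> space (restrict_space borel (chart_image c))
      \<in> sets (restrict_space borel (chart_image c))"
    using chart_image_open[OF assms] by (simp add: sets_restrict_space_iff space_restrict_space)
qed

lemma chart_image_borel:
  assumes "c \<in> atlas M" "A \<in> sets borel_M" "A \<subseteq> fst c"
  shows "snd c ` A \<in> sets borel"
  using measurable_sets[OF chart_inv_measurable[OF assms(1)] assms(2)] chart_image_open[OF assms(1)]
  by (simp add: sets_restrict_space_iff space_restrict_space chart_inv_preimage[OF assms(1,3)])

lemma continuous_map_borel_M:
  fixes u :: "'a \<Rightarrow> 'b::topological_space"
  assumes "continuous_map (topo M) euclidean u"
  shows "u \<in> borel_measurable borel_M"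
proof (rule borel_measurableI)
  fix S :: "'b set" assume "open S"
  then have "openin (topo M) {x \<in> topspace (topo M). u x \<in> S}"
    by (intro openin_continuous_map_preimage[OF assms]) simp
  moreover have "u -` S \<inter> space borel_M = {x \<in> topspace (topo M). u x \<in> S}" by auto
  ultimately show "u -` S \<inter> space borel_M \<in> sets borel_M" using openin_sets_borel_M by simp
qed

lemma finite_atlas_cover:
  assumes "compact_space (topo M)"
  shows "\<exists>n f. (\<forall>i<n. f i \<in> atlas M) \<and> topspace (topo M) = (\<Union>i<(n::nat). fst (f i))"
proof -
  have "\<exists>\<F>. finite \<F> \<and> \<F> \<subseteq> fst ` atlas M \<and> topspace (topo M) \<subseteq> \<Union> \<F>"
    using assms chart_open unfolding compact_space_alt by (auto simp: topspace_eq)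
  then obtain \<F> where "finite \<F>" "\<F> \<subseteq> fst ` atlas M" and cov: "topspace (topo M) \<subseteq> \<Union> \<F>" by blast
  then obtain C where C: "C \<subseteq> atlas M" "finite C" "\<F> = fst ` C" by (meson finite_subset_image)
  then obtain n and f :: "nat \<Rightarrow> _" where nf: "C = f ` {i. i < n}"
    using finite_imp_nat_seg_image_inj_on[OF C(2)] by auto
  show ?thesis
  proof (intro exI conjI allI impI)
    show "f i \<in> atlas M" if "i < n" for i using that C nf by auto
    show "topspace (topo M) = (\<Union>i<n. fst (f i))"
      using cov C nf by (auto simp: topspace_eq)
  qed
qed

\<comment> \<open>Chart densities and existence of the Riemannian measure\<close>
end

context riem_mfd begin

text \<open>Zero outside the chart image, which makes the density Borel on the whole coordinate
  space and lets it cut off integrands where \<open>chart_inv\<close> has no meaning.\<close>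

definition vol :: "('a, 'm) chart \<Rightarrow> real^'m \<Rightarrow> real" where
  "vol c x = (if x \<in> chart_image c then sqrt (det (metric_matrix M g c x)) else 0)"

lemma metric_det_pos: "c \<in> atlas M \<Longrightarrow> x \<in> chart_image c \<Longrightarrow> det (metric_matrix M g c x) > 0"
  by (rule spd_det_pos[OF metric_matrix_spd])

lemma vol_nonneg: "c \<in> atlas M \<Longrightarrow> vol c x \<ge> 0"
  using metric_det_pos[of c x] by (auto simp: vol_def less_imp_le)

lemma vol_smooth: "c \<in> atlas M \<Longrightarrow> smooth_on (chart_image c) (vol c)"
  by (subst smooth_on_cong[OF chart_image_open, of c _ "\<lambda>x. sqrt (det (metric_matrix M g c x))"])
     (auto simp: vol_def intro!: smooth_intros chart_image_open metric_matrix_smooth metric_det_pos)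

lemma vol_measurable: 
  assumes "c \<in> atlas M" shows "vol c \<in> borel_measurable borel"
proof -
  have "vol c = (\<lambda>x. indicator (chart_image c) x *\<^sub>R vol c x)" by (auto simp: vol_def indicator_def)
  then show ?thesis
    using borel_measurable_continuous_on_indicator[OF _ smooth_on_imp_continuous_on[OF vol_smooth[OF assms]]]
      chart_image_open[OF assms] by simp
qed

text \<open>The metric matrices in two charts are related by congruence with the Jacobian matrix of
  the transition map, so that its determinant enters twice.\<close>

lemma metric_det_change:
  assumes "c \<in> charts_at M p" "c' \<in> charts_at M p"
  shows "det (metric_matrix M g c (snd c p)) =
    (det (matrix (frechet_derivative (\<lambda>x. snd c' (chart_inv c x)) (at (snd c p)))))\<^sup>2
      * det (metric_matrix M g c' (snd c' p))"
proof -
  let ?J = "matrix (frechet_derivative (\<lambda>x. snd c' (chart_inv c x)) (at (snd c p)))"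
  let ?G' = "metric_matrix M g c' (snd c' p)"
  have "metric_matrix M g c (snd c p) $ i $ j = (transpose ?J ** (?G' ** ?J)) $ i $ j" for i j
  proof -
    have "chart_inv c (snd c p) = p" using chart_inv_left assms(1) by (simp add: charts_at_def)
    then have "metric_matrix M g c (snd c p) $ i $ j = g p (coord_vec M c p i) (coord_vec M c p j)"
      by (simp add: metric_matrix_def Let_def)
    also have "\<dots> = coord_vec M c p i c' \<bullet> (?G' *v coord_vec M c p j c')"
      unfolding coord_vec_eq by (rule metric_coords[OF assms(2) tvec_in[OF assms(1)] tvec_in[OF assms(1)]])
    also have "\<dots> = (transpose ?J ** (?G' ** ?J)) $ i $ j"
      using assms(2)
      by (simp add: coord_vec_def matrix_matrix_mult_def transpose_def matrix_def inner_vec_def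
          matrix_vector_mult_def)
    finally show ?thesis .
  qed
  then have "metric_matrix M g c (snd c p) = transpose ?J ** (?G' ** ?J)" by (simp add: vec_eq_iff)
  then show ?thesis by (simp add: det_mul power2_eq_square)
qed

definition chart_measure :: "('a, 'm) chart \<Rightarrow> 'a set \<Rightarrow> ennreal" where
  "chart_measure c A = (\<integral>\<^sup>+x\<in>snd c ` A. ennreal (vol c x) \<partial>lborel)"

lemma chart_measure_eq: "A \<subseteq> fst c \<Longrightarrow>
    chart_measure c A = (\<integral>\<^sup>+x\<in>snd c ` A. ennreal (sqrt (det (metric_matrix M g c x))) \<partial>lborel)"
  unfolding chart_measure_def by (intro nn_integral_cong) (auto simp: vol_def indicator_def chart_image_def)

text \<open>The square root of \<open>metric_det_change\<close> is exactly the Jacobian factor in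
  the change of variables, so both charts assign the same measure to a set inside their
  overlap.\<close>

lemma chart_measure_change:
  assumes c: "c \<in> atlas M" "c' \<in> atlas M" and A: "A \<in> sets borel_M" "A \<subseteq> fst c" "A \<subseteq> fst c'"
  shows "chart_measure c' A = chart_measure c A"
proof -
  let ?\<theta> = "\<lambda>x. snd c' (chart_inv c x)"
  have im: "?\<theta> ` (snd c ` A) = snd c' ` A"
    using chart_inv_left[OF c(1)] A(2) by (force simp: image_image)
  have "(\<integral>\<^sup>+y\<in>?\<theta> ` (snd c ` A). ennreal (vol c' y) \<partial>lborel) = (\<integral>\<^sup>+x\<in>snd c ` A. ennreal (vol c x) \<partial>lborel)"
  proof (rule nn_integral_change_of_variables)
    show "snd c ` A \<in> sets borel" "?\<theta> ` snd c ` A \<in> sets borel"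
      unfolding im using chart_image_borel c A by auto
    show "inj_on ?\<theta> (snd c ` A)"
    proof (rule inj_onI)
      fix x y assume "x \<in> snd c ` A" "y \<in> snd c ` A" and eq: "?\<theta> x = ?\<theta> y"
      then obtain p q where pq: "p \<in> A" "x = snd c p" "q \<in> A" "y = snd c q" by auto
      then have "snd c' p = snd c' q" using eq A(2) chart_inv_left[OF c(1)] by (simp add: subset_iff)
      then have "p = q" using chart_inj[OF c(2)] pq A(3) by (meson inj_onD subsetD)
      then show "x = y" using pq by simp
    qed
    fix x assume "x \<in> snd c ` A"
    then obtain p where p: "p \<in> A" "x = snd c p" by auto
    have cp: "c \<in> charts_at M p" "c' \<in> charts_at M p" using p c A by (auto simp: charts_at_def)
    show "(?\<theta> has_derivative frechet_derivative ?\<theta> (at x)) (at x)"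
      unfolding p by (rule transition_has_derivative[OF cp])
    have "?\<theta> x = snd c' p" using p A chart_inv_left[OF c(1)] by auto
    moreover have "snd c p \<in> chart_image c" "snd c' p \<in> chart_image c'"
      using chart_image_in[OF charts_atD(2)[OF cp(1)]] chart_image_in[OF charts_atD(2)[OF cp(2)]] by auto
    ultimately show "vol c x = \<bar>det (matrix (frechet_derivative ?\<theta> (at x)))\<bar> * vol c' (?\<theta> x)"
      using metric_det_change[OF cp] p by (simp add: vol_def real_sqrt_mult)
  qed (use vol_measurable vol_nonneg c in auto)
  then show ?thesis unfolding im chart_measure_def .
qed

lemma indicator_disjoint_suminf:
  assumes "disjoint_family A"
  shows "(\<Sum>i. indicator (A i) x :: ennreal) = indicator (\<Union>i. A i) x"
proof (cases "x \<in> (\<Union>i. A i)")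
  case True
  then obtain j where j: "x \<in> A j" by auto
  have "indicator (A i) x = (if i = j then 1 else 0 :: ennreal)" for i
    using assms j by (auto simp: disjoint_family_on_def indicator_def)
  then show ?thesis using True sums_unique[OF sums_single[of j "\<lambda>_. 1::ennreal"]] by simp
qed (auto simp: indicator_def)

lemma chart_measure_suminf:
  assumes c: "c \<in> atlas M" and A: "\<And>i. A i \<in> sets borel_M" "\<And>i. A i \<subseteq> fst c" "disjoint_family A"
  shows "(\<Sum>i. chart_measure c (A i)) = chart_measure c (\<Union>i. A i)"
proof -
  have "disjoint_family (\<lambda>i. snd c ` A i)"
    unfolding disjoint_family_on_def
  proof (intro ballI impI)
    fix i j :: nat assume "i \<noteq> j"
    then have "A i \<inter> A j = {}" using A(3) by (auto simp: disjoint_family_on_def)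
    then show "snd c ` A i \<inter> snd c ` A j = {}"
      using inj_on_image_Int[OF chart_inj[OF c] A(2)[of i] A(2)[of j]] by simp
  qed
  note ind = indicator_disjoint_suminf[OF this]
  have "(\<Sum>i. chart_measure c (A i)) = (\<integral>\<^sup>+x. (\<Sum>i. ennreal (vol c x) * indicator (snd c ` A i) x) \<partial>lborel)"
    unfolding chart_measure_def
    by (rule nn_integral_suminf[symmetric])
       (use chart_image_borel[OF c A(1,2)] vol_measurable[OF c] in
         \<open>auto intro!: borel_measurable_times_ennreal borel_measurable_indicator\<close>)
  also have "\<dots> = (\<integral>\<^sup>+x. ennreal (vol c x) * indicator (\<Union>i. snd c ` A i) x \<partial>lborel)"
    by (simp add: ind)
  finally show ?thesis by (simp add: chart_measure_def image_UN)
qed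

lemma chart_measure_empty: "chart_measure c {} = 0" by (simp add: chart_measure_def)

text \<open>Since \<open>riemannian_measure\<close> is a \<open>SOME\<close> term, its properties
  depend on this. A finite cover by charts is cut into disjoint Borel pieces, each piece is measured
  in its own chart, and chart independence shows that the sum is right for every chart of the
  atlas.\<close>

lemma riemannian_measure_exists:
  assumes "compact_space (topo M)"
  shows "\<exists>\<mu>. is_riemannian_measure M g \<mu>"
proof -
  obtain n :: nat and f where "\<forall>i<n. f i \<in> atlas M" and cov: "topspace (topo M) = (\<Union>i<n. fst (f i))"
    using finite_atlas_cover[OF assms] by blast
  then have f: "\<And>i. i < n \<Longrightarrow> f i \<in> atlas M" by blast
  \<comment> \<open>Each point is assigned to the first chart of the cover containing it, which
    makes the pieces disjoint.\<close>
  define D where "D k = fst (f k) - (\<Union>j<k. fst (f j))" for k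
  have D: "D k \<in> sets borel_M" "D k \<subseteq> fst (f k)" if k: "k < n" for k
  proof -
    have "(\<Union>j<k. fst (f j)) \<in> sets borel_M"
      by (rule sets.finite_UN) (use k in \<open>simp_all add: chart_sets_borel_M f\<close>)
    then show "D k \<in> sets borel_M"
      unfolding D_def by (intro sets.Diff chart_sets_borel_M f k)
    show "D k \<subseteq> fst (f k)" by (simp add: D_def)
  qed
  have D_disj: "D j \<inter> D k = {}" if "j \<noteq> k" for j k
  proof (cases "j < k")
    case True
    then show ?thesis by (auto simp: D_def)
  next
    case False
    then have "k < j" using that by simp
    then show ?thesis by (auto simp: D_def)
  qed
  have D_cov: "\<exists>k<n. p \<in> D k" if "p \<in> topspace (topo M)" for p
  proof -
    have "\<exists>k. k < n \<and> p \<in> fst (f k)" using that cov by auto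
    then obtain k where "k < n \<and> p \<in> fst (f k)" "\<And>j. j < k \<Longrightarrow> \<not> (j < n \<and> p \<in> fst (f j))"
      using exists_least_iff[of "\<lambda>k. k < n \<and> p \<in> fst (f k)"] by blast
    then show ?thesis by (intro exI[of _ k]) (auto simp: D_def)
  qed
  define \<mu>' where "\<mu>' A = (\<Sum>k<n. chart_measure (f k) (A \<inter> D k))" for A
  define \<mu> where "\<mu> = measure_of (topspace (topo M)) (sets borel_M) \<mu>'"
  have sub: "sets borel_M \<subseteq> Pow (topspace (topo M))" using sets.space_closed[of borel_M] by simp
  have sa: "sigma_algebra (topspace (topo M)) (sets borel_M)"
    using sets.sigma_algebra_axioms[of borel_M] by simp
  have "positive (sets borel_M) \<mu>'" by (simp add: positive_def \<mu>'_def chart_measure_empty)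
  moreover have "countably_additive (sets borel_M) \<mu>'"
    unfolding countably_additive_def
  proof (intro allI impI)
    fix A :: "nat \<Rightarrow> 'a set"
    assume A: "range A \<subseteq> sets borel_M" "disjoint_family A"
    have "(\<Sum>i. \<mu>' (A i)) = (\<Sum>k<n. \<Sum>i. chart_measure (f k) (A i \<inter> D k))"
      unfolding \<mu>'_def by (rule suminf_sum) (rule summableI)
    also have "\<dots> = (\<Sum>k<n. chart_measure (f k) (\<Union>i. A i \<inter> D k))"
    proof (rule sum.cong[OF refl], rule chart_measure_suminf)
      fix k i assume "k \<in> {..<n}"
      then show "f k \<in> atlas M" "A i \<inter> D k \<in> sets borel_M" "A i \<inter> D k \<subseteq> fst (f k)"
        using f D[of k] A by auto
    next
      fix k show "disjoint_family (\<lambda>i. A i \<inter> D k)" using A(2) by (auto simp: disjoint_family_on_def)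
    qed
    moreover have "(\<Union>i. A i \<inter> D k) = (\<Union>i. A i) \<inter> D k" for k by blast
    ultimately show "(\<Sum>i. \<mu>' (A i)) = \<mu>' (\<Union>i. A i)" by (simp only: \<mu>'_def)
  qed
  ultimately have em: "emeasure \<mu> A = \<mu>' A" if "A \<in> sets borel_M" for A
    using that unfolding \<mu>_def
    by (intro emeasure_measure_of_sigma[OF sa]) auto
  have sets: "sets \<mu> = sets borel_M" "space \<mu> = topspace (topo M)"
    unfolding \<mu>_def using sub sigma_algebra.sigma_sets_eq[OF sa] by (simp_all add: sets_measure_of space_measure_of)
  \<comment> \<open>For an arbitrary chart \<open>c\<close> of the atlas every piece of
    \<open>A\<close> lies in two charts; measuring all pieces in \<open>c\<close> lets them
    recombine into \<open>A\<close>.\<close>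
  have "\<mu>' A = chart_measure c A" if c: "c \<in> atlas M" and A: "A \<in> sets borel_M" "A \<subseteq> fst c" for c A
  proof -
    have "\<mu>' A = (\<Sum>k<n. chart_measure c (A \<inter> D k))"
      unfolding \<mu>'_def
    proof (rule sum.cong[OF refl], rule chart_measure_change[OF c])
      fix k assume "k \<in> {..<n}"
      then show "f k \<in> atlas M" "A \<inter> D k \<in> sets borel_M" "A \<inter> D k \<subseteq> fst c" "A \<inter> D k \<subseteq> fst (f k)"
        using f D[of k] A by auto
    qed
    also have "\<dots> = (\<integral>\<^sup>+x. (\<Sum>k<n. ennreal (vol c x) * indicator (snd c ` (A \<inter> D k)) x) \<partial>lborel)"
      unfolding chart_measure_def
    proof (rule nn_integral_sum[symmetric])
      fix k assume "k \<in> {..<n}"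
      then have "snd c ` (A \<inter> D k) \<in> sets borel"
        using D[of k] A by (intro chart_image_borel[OF c]) auto
      then show "(\<lambda>x. ennreal (vol c x) * indicator (snd c ` (A \<inter> D k)) x) \<in> borel_measurable lborel"
        using vol_measurable[OF c] by (auto intro!: borel_measurable_times_ennreal borel_measurable_indicator)
    qed
    also have "\<dots> = chart_measure c A"
      unfolding chart_measure_def
    proof (rule nn_integral_cong)
      fix x :: "real^'m"
      have "(\<Sum>k<n. indicator (snd c ` (A \<inter> D k)) x :: ennreal) = indicator (snd c ` A) x"
      proof (cases "x \<in> snd c ` A")
        case True
        then obtain p where p: "p \<in> A" "x = snd c p" by auto
        then obtain k where k: "k < n" "p \<in> D k" using D_cov A sub by blast
        have "indicator (snd c ` (A \<inter> D j)) x = (if j = k then 1 else 0 :: ennreal)" for j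
        proof -
          have "x \<in> snd c ` (A \<inter> D j) \<longleftrightarrow> p \<in> D j"
            using p A(2) chart_inj[OF c] by (auto dest: inj_onD)
          moreover have "p \<in> D j \<longleftrightarrow> j = k" using k D_disj[of j k] by auto
          ultimately show ?thesis by (simp add: indicator_def)
        qed
        then show ?thesis using k True by simp
      next
        case False
        then show ?thesis by (auto simp: indicator_def)
      qed
      then show "(\<Sum>k<n. ennreal (vol c x) * indicator (snd c ` (A \<inter> D k)) x)
          = ennreal (vol c x) * indicator (snd c ` A) x"
        by (simp only: sum_distrib_left[symmetric])
    qed
    finally show ?thesis .
  qed
  then have "is_riemannian_measure M g \<mu>"
    unfolding is_riemannian_measure_def sets using em chart_measure_eq by (auto simp: sets_borel_M)
  then show ?thesis ..
qed

end

section \<open>Integration over a compact Riemannian manifold\<close>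

context riem_mfd begin

abbreviation "\<mu> \<equiv> riemannian_measure M g"

lemma is_riemannian_measure_mu:
  assumes "compact_space (topo M)"
  shows "is_riemannian_measure M g \<mu>"
  unfolding riemannian_measure_def using riemannian_measure_exists[OF assms] by (rule someI_ex)

context
  assumes compact: "compact_space (topo M)"
begin

lemma space_mu: "space \<mu> = topspace (topo M)"
  and sets_mu: "sets \<mu> = sets borel_M"
  using is_riemannian_measure_mu[OF compact] by (simp_all add: is_riemannian_measure_def sets_borel_M)

lemma emeasure_mu: "c \<in> atlas M \<Longrightarrow> A \<in> sets borel_M \<Longrightarrow> A \<subseteq> fst c \<Longrightarrow> emeasure \<mu> A = chart_measure c A"
  using is_riemannian_measure_mu[OF compact] chart_measure_eq[of A c]
  by (simp add: is_riemannian_measure_def sets_borel_M)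

lemma measurable_mu: "u \<in> borel_measurable borel_M \<Longrightarrow> u \<in> borel_measurable \<mu>"
  using measurable_cong_sets[OF sets_mu refl] by blast

text \<open>The measure is prescribed by its values on subsets of chart domains. Stated as an
  equality of measures, this prescription becomes usable for integrals.\<close>

lemma restrict_mu:
  assumes c: "c \<in> atlas M"
  shows "restrict_space \<mu> (fst c) =
    distr (density (restrict_space lborel (chart_image c)) (\<lambda>x. ennreal (vol c x)))
      (restrict_space \<mu> (fst c)) (chart_inv c)" (is "?R = distr ?D ?R _")
proof (rule measure_eqI)
  have "chart_inv c \<in> measurable ?D borel_M"
    using chart_inv_measurable[OF c]
    by (simp add: measurable_def sets_restrict_space space_restrict_space)
  then have meas: "chart_inv c \<in> measurable ?D ?R"
    using chart_inv_in[of _ c]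
    by (intro measurable_restrict_space2)
      (auto simp: space_restrict_space measurable_def sets_mu space_mu)
  have fst_c: "fst c \<in> sets \<mu>" using chart_sets_borel_M[OF c] by (simp add: sets_mu)
  have im: "chart_image c \<in> sets borel" using chart_image_open[OF c] by simp
  fix A assume "A \<in> sets ?R"
  then have A: "A \<in> sets borel_M" "A \<subseteq> fst c"
    using fst_c by (auto simp: sets_restrict_space_iff sets_mu)
  have sA: "snd c ` A \<in> sets borel" using chart_image_borel[OF c A] .
  have sub: "snd c ` A \<subseteq> chart_image c" using A by (auto simp: chart_image_def)
  have "emeasure (distr ?D ?R (chart_inv c)) A = emeasure ?D (chart_inv c -` A \<inter> space ?D)"
    using meas \<open>A \<in> sets ?R\<close> by (rule emeasure_distr)
  also have "chart_inv c -` A \<inter> space ?D = snd c ` A"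
    by (simp add: space_restrict_space chart_inv_preimage[OF c A(2)])
  also have "emeasure ?D (snd c ` A)
      = (\<integral>\<^sup>+x. ennreal (vol c x) * indicator (snd c ` A) x \<partial>restrict_space lborel (chart_image c))"
    using sA sub im vol_measurable[OF c]
    by (intro emeasure_density) (auto simp: sets_restrict_space_iff intro!: measurable_restrict_space1)
  also have "\<dots> = (\<integral>\<^sup>+x. ennreal (vol c x) * indicator (snd c ` A) x * indicator (chart_image c) x \<partial>lborel)"
    using im by (simp add: nn_integral_restrict_space)
  also have "\<dots> = chart_measure c A"
    unfolding chart_measure_def using sub by (intro nn_integral_cong) (auto simp: indicator_def)
  also have "\<dots> = emeasure ?R A"
    using emeasure_mu[OF c A] A fst_c by (simp add: emeasure_restrict_space)
  finally show "emeasure ?R A = emeasure (distr ?D ?R (chart_inv c)) A" by simp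
qed simp

lemma integral_mu_chart:
  fixes u :: "'a \<Rightarrow> real"
  assumes c: "c \<in> atlas M" and u: "u \<in> borel_measurable borel_M"
    and zero: "\<And>p. p \<in> topspace (topo M) \<Longrightarrow> p \<notin> fst c \<Longrightarrow> u p = 0"
  shows "(\<integral>p. u p \<partial>\<mu>) = (\<integral>x. vol c x * u (chart_inv c x) \<partial>lborel)"
proof -
  let ?R = "restrict_space \<mu> (fst c)" and ?L = "restrict_space lborel (chart_image c)"
  have fst_c: "fst c \<in> sets \<mu>" using chart_sets_borel_M[OF c] by (simp add: sets_mu)
  have im: "chart_image c \<in> sets borel" using chart_image_open[OF c] by simp
  have uR: "u \<in> borel_measurable ?R" by (rule measurable_restrict_space1[OF measurable_mu[OF u]])
  have meas: "chart_inv c \<in> measurable ?L ?R"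
    using chart_inv_in[of _ c] chart_inv_measurable[OF c]
    by (intro measurable_restrict_space2)
      (auto simp: space_restrict_space measurable_def sets_mu space_mu sets_restrict_space)
  have vL: "vol c \<in> borel_measurable ?L"
    using vol_measurable[OF c] by (auto intro!: measurable_restrict_space1)
  have "(\<integral>p. u p \<partial>\<mu>) = (\<integral>p. indicator (fst c) p *\<^sub>R u p \<partial>\<mu>)"
    by (rule Bochner_Integration.integral_cong) (auto simp: indicator_def space_mu zero)
  also have "\<dots> = integral\<^sup>L ?R u"
    using fst_c by (simp add: integral_restrict_space)
  also have "\<dots> = integral\<^sup>L (distr (density ?L (vol c)) ?R (chart_inv c)) u"
    by (subst restrict_mu[OF c]) (rule refl)
  also have "\<dots> = integral\<^sup>L (density ?L (vol c)) (\<lambda>x. u (chart_inv c x))"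
    by (rule integral_distr[OF _ uR]) (use meas in simp)
  also have "\<dots> = integral\<^sup>L ?L (\<lambda>x. vol c x *\<^sub>R u (chart_inv c x))"
    by (rule integral_density) (use measurable_compose[OF meas uR] vL vol_nonneg[OF c] in auto)
  also have "\<dots> = (\<integral>x. indicator (chart_image c) x *\<^sub>R (vol c x *\<^sub>R u (chart_inv c x)) \<partial>lborel)"
    using im by (simp add: integral_restrict_space)
  also have "\<dots> = (\<integral>x. vol c x * u (chart_inv c x) \<partial>lborel)"
    by (rule Bochner_Integration.integral_cong) (auto simp: indicator_def vol_def)
  finally show ?thesis .
qed

text \<open>Every point has an open neighbourhood of finite measure, and compactness leaves finitely
  many of them.\<close>

lemma finite_measure_mu: "finite_measure \<mu>"
proof
  have ex: "\<exists>U. openin (topo M) U \<and> p \<in> U \<and> emeasure \<mu> U < \<infinity>" if p: "p \<in> topspace (topo M)" for p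
  proof -
    obtain c where c: "c \<in> charts_at M p" using charts_at_ex[OF p] by blast
    have ca: "c \<in> atlas M" "p \<in> fst c" using charts_atD[OF c] by auto
    \<comment> \<open>The closed ball bounds the continuous density; the open ball of the same
      radius provides the open neighbourhood.\<close>
    obtain r where r: "r > 0" "cball (snd c p) r \<subseteq> chart_image c"
      using chart_image_open[OF ca(1)] chart_image_in[OF ca(2)] open_contains_cball by metis
    have sub: "ball (snd c p) r \<subseteq> chart_image c" using r(2) ball_subset_cball by blast
    define U where "U = chart_inv c ` ball (snd c p) r"
    have U: "openin (topo M) U" unfolding U_def by (rule openin_chart_inv_image[OF ca(1) _ sub]) simp
    have Uc: "U \<subseteq> fst c" unfolding U_def using sub chart_inv_in[of _ c] by auto
    have "p \<in> U" unfolding U_def using r chart_inv_left[OF ca] by (intro image_eqI[of _ _ "snd c p"]) auto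
    have sU: "snd c ` U = ball (snd c p) r"
      unfolding U_def image_image using chart_inv_right[of _ c] sub by (auto simp: subset_iff image_iff)
    obtain C where C: "\<And>x. x \<in> cball (snd c p) r \<Longrightarrow> vol c x \<le> C"
      using compact_imp_bounded[OF compact_continuous_image[OF
            continuous_on_subset[OF smooth_on_imp_continuous_on[OF vol_smooth[OF ca(1)]] r(2)] compact_cball]]
      by (auto simp: bounded_real) (metis abs_le_D1 dist_commute mem_cball)
    have "emeasure \<mu> U = (\<integral>\<^sup>+x\<in>ball (snd c p) r. ennreal (vol c x) \<partial>lborel)"
      using emeasure_mu[OF ca(1) openin_sets_borel_M[OF U] Uc] by (simp add: chart_measure_def sU)
    also have "\<dots> \<le> (\<integral>\<^sup>+x. ennreal C * indicator (cball (snd c p) r) x \<partial>lborel)"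
      using C by (intro nn_integral_mono) (auto simp: indicator_def intro!: ennreal_leI)
    also have "\<dots> = ennreal C * emeasure lborel (cball (snd c p) r)"
      by (simp add: nn_integral_cmult_indicator)
    also have "\<dots> < \<infinity>"
      using emeasure_lborel_cball_finite[of "snd c p" r] by (simp add: ennreal_mult_less_top)
    finally show ?thesis using U \<open>p \<in> U\<close> by blast
  qed
  define \<U> where "\<U> = {U. openin (topo M) U \<and> emeasure \<mu> U < \<infinity>}"
  have "\<exists>\<F>. finite \<F> \<and> \<F> \<subseteq> \<U> \<and> topspace (topo M) \<subseteq> \<Union> \<F>"
  proof -
    have "topspace (topo M) \<subseteq> \<Union> \<U>" using ex by (auto simp: \<U>_def)
    then show ?thesis
      using compact unfolding compact_space_alt by (auto simp: \<U>_def)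
  qed
  then obtain \<F> where F: "finite \<F>" "\<F> \<subseteq> \<U>" "topspace (topo M) \<subseteq> \<Union> \<F>" by blast
  have sF: "\<F> \<subseteq> sets \<mu>" using F(2) openin_sets_borel_M by (auto simp: \<U>_def sets_mu)
  have "emeasure \<mu> (space \<mu>) \<le> emeasure \<mu> (\<Union> \<F>)"
    using F sF by (intro emeasure_mono) (auto simp: space_mu intro!: sets.finite_Union)
  also have "\<dots> \<le> (\<Sum>U\<in>\<F>. emeasure \<mu> U)"
    using emeasure_subadditive_finite[OF F(1), of "\<lambda>U. U" \<mu>] sF by simp
  also have "\<dots> < \<infinity>" using F by (auto simp: \<U>_def)
  finally show "emeasure \<mu> (space \<mu>) \<noteq> \<infinity>" by simp
qed

end

end

section \<open>Differentiation under the integral sign\<close>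

text \<open>Dominated convergence for difference quotients along sequences tending to 0. By the mean
  value theorem each quotient equals a derivative at an intermediate time, so \<open>w\<close>
  dominates it.\<close>

lemma has_derivative_integral_at_0:
  fixes f f' :: "real \<Rightarrow> 'a \<Rightarrow> real"
  assumes "\<delta> > 0"
    and int: "\<And>t. \<bar>t\<bar> < \<delta> \<Longrightarrow> integrable M (f t)"
    and der: "\<And>t p. \<bar>t\<bar> < \<delta> \<Longrightarrow> p \<in> space M \<Longrightarrow> ((\<lambda>t. f t p) has_real_derivative f' t p) (at t)"
    and bd: "\<And>t p. \<bar>t\<bar> < \<delta> \<Longrightarrow> p \<in> space M \<Longrightarrow> \<bar>f' t p\<bar> \<le> w p"
    and w: "integrable M w"
  shows "((\<lambda>t. \<integral>p. f t p \<partial>M) has_real_derivative (\<integral>p. f' 0 p \<partial>M)) (at 0)"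
  unfolding has_field_derivative_iff add_0 diff_0_right tendsto_at_iff_sequentially
proof (intro allI impI)
  fix X :: "nat \<Rightarrow> real" assume X: "\<forall>i. X i \<in> UNIV - {0}" "X \<longlonglongrightarrow> 0"
  \<comment> \<open>Times outside the interval get the quotient 0, so measurability and the bound
    hold for every \<open>n\<close> while the limit is unaffected.\<close>
  define s where "s n p = (if \<bar>X n\<bar> < \<delta> then (f (X n) p - f 0 p) / X n else 0)" for n p
  have ev: "eventually (\<lambda>n. \<bar>X n\<bar> < \<delta>) sequentially"
    using tendstoD[OF X(2) \<open>\<delta> > 0\<close>] by (simp add: dist_real_def)
  have s_meas: "s n \<in> borel_measurable M" for n
  proof (cases "\<bar>X n\<bar> < \<delta>")
    case True
    have "f (X n) \<in> borel_measurable M" "f 0 \<in> borel_measurable M"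
      using int[OF True] int[of 0] \<open>\<delta> > 0\<close> by auto
    then have "(\<lambda>p. (f (X n) p - f 0 p) / X n) \<in> borel_measurable M" by measurable
    then show ?thesis using True by (simp add: s_def[abs_def])
  qed (simp add: s_def[abs_def])
  have lim: "(\<lambda>n. s n p) \<longlonglongrightarrow> f' 0 p" if "p \<in> space M" for p
  proof -
    have "((\<lambda>h. (f h p - f 0 p) / h) \<longlongrightarrow> f' 0 p) (at 0)"
      using der[of 0 p] that \<open>\<delta> > 0\<close> by (simp add: has_field_derivative_iff)
    then have "(\<lambda>n. (f (X n) p - f 0 p) / X n) \<longlonglongrightarrow> f' 0 p"
      unfolding tendsto_at_iff_sequentially using X by (auto simp: comp_def)
    then show ?thesis
      by (rule Lim_transform_eventually) (use ev in \<open>auto simp: s_def elim: eventually_mono\<close>)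
  qed
  have bound: "\<bar>s n p\<bar> \<le> w p" if p: "p \<in> space M" for n p
  proof (cases "\<bar>X n\<bar> < \<delta>")
    case True
    have d: "((\<lambda>t. f t p) has_real_derivative f' t p) (at t)" if "\<bar>t\<bar> \<le> \<bar>X n\<bar>" for t
      using der[of t p] p True that by simp
    have "\<exists>z. \<bar>z\<bar> < \<delta> \<and> f (X n) p - f 0 p = X n * f' z p"
    proof (cases "X n > 0")
      case pos: True
      then obtain z where "0 < z" "z < X n" "f (X n) p - f 0 p = (X n - 0) * f' z p"
        using MVT2[of 0 "X n" "\<lambda>t. f t p" "\<lambda>t. f' t p"] d by auto
      then show ?thesis using True by (intro exI[of _ z]) auto
    next
      case False
      then have neg: "X n < 0" using X(1)[rule_format, of n] by auto
      then obtain z where "X n < z" "z < 0" "f 0 p - f (X n) p = (0 - X n) * f' z p"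
        using MVT2[of "X n" 0 "\<lambda>t. f t p" "\<lambda>t. f' t p"] d by auto
      then show ?thesis using True by (intro exI[of _ z]) auto
    qed
    then obtain z where "\<bar>z\<bar> < \<delta>" "s n p = f' z p"
      using X(1) True by (auto simp: s_def)
    then show ?thesis using bd[of z p] p by simp
  next
    case False
    then show ?thesis using bd[of 0 p] p \<open>\<delta> > 0\<close> by (simp add: s_def)
  qed
  have "(\<lambda>n. \<integral>p. s n p \<partial>M) \<longlonglongrightarrow> (\<integral>p. f' 0 p \<partial>M)"
  proof (rule integral_dominated_convergence[OF _ s_meas w])
    show "f' 0 \<in> borel_measurable M" by (rule borel_measurable_LIMSEQ_real[OF lim s_meas])
  qed (use lim bound in auto)
  moreover have "eventually (\<lambda>n. (\<integral>p. s n p \<partial>M) = ((\<integral>p. f (X n) p \<partial>M) - (\<integral>p. f 0 p \<partial>M)) / X n) sequentially"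
    using ev
  proof (rule eventually_mono)
    fix n assume n: "\<bar>X n\<bar> < \<delta>"
    then show "(\<integral>p. s n p \<partial>M) = ((\<integral>p. f (X n) p \<partial>M) - (\<integral>p. f 0 p \<partial>M)) / X n"
      using int[OF n] int[of 0] \<open>\<delta> > 0\<close> by (simp add: s_def)
  qed
  ultimately show "((\<lambda>t. ((\<integral>p. f t p \<partial>M) - (\<integral>p. f 0 p \<partial>M)) / t) \<circ> X) \<longlonglongrightarrow> (\<integral>p. f' 0 p \<partial>M)"
    unfolding comp_def by (rule Lim_transform_eventually)
qed

lemma integrable_compact_support:
  fixes u :: "'a::euclidean_space \<Rightarrow> real"
  assumes "continuous_on UNIV u" "\<And>x. x \<notin> cball a r \<Longrightarrow> u x = 0"
  shows "integrable lborel u"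
proof -
  have "integrable lborel (\<lambda>x. indicator (cball a r) x *\<^sub>R u x)"
    by (rule borel_integrable_compact) (auto intro: continuous_on_subset[OF assms(1)])
  moreover have "(\<lambda>x. indicator (cball a r) x *\<^sub>R u x) = u"
    by (rule ext) (use assms(2) in \<open>auto simp: indicator_def\<close>)
  ultimately show ?thesis by simp
qed

text \<open>By translation invariance \<open>\<integral> u (x + t e\<^sub>k) dx\<close> does not depend on \<open>t\<close>.\<close>

lemma integral_pd_eq_0:
  fixes u :: "real^'m \<Rightarrow> real"
  assumes diff: "\<And>x. u differentiable (at x)" and cont: "continuous_on UNIV (pd k u)"
    and supp: "\<And>x. x \<notin> cball a r \<Longrightarrow> u x = 0"
  shows "(\<integral>x. pd k u x \<partial>lborel) = 0"
proof -
  let ?e = "axis k 1 :: real^'m"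
  have pd0: "pd k u x = 0" if "x \<notin> cball a r" for x
  proof -
    have "pd k u x = pd k (\<lambda>_. 0) x"
      by (rule pd_cong_open[of "- cball a r"]) (use that supp in auto)
    then show ?thesis by (simp add: pd_const)
  qed
  obtain C where C: "\<And>x. \<bar>pd k u x\<bar> \<le> C" 
  proof -
    have "bounded (pd k u ` cball a r)"
      by (intro compact_imp_bounded compact_continuous_image continuous_on_subset[OF cont]) auto
    then obtain C where C: "\<And>x. x \<in> cball a r \<Longrightarrow> \<bar>pd k u x\<bar> \<le> C"
      unfolding bounded_real by blast
    have "\<bar>pd k u x\<bar> \<le> max C 0" for x using C[of x] pd0[of x] by (cases "x \<in> cball a r") auto
    then show ?thesis by (rule that)
  qed
  have C0: "C \<ge> 0" using C[of a] by linarith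
  have cu: "continuous_on UNIV u"
    using diff by (simp add: continuous_at_imp_continuous_on differentiable_imp_continuous_within)
  have iu: "integrable lborel u" by (rule integrable_compact_support[OF cu supp])
  have shift: "integrable lborel (\<lambda>x. u (x + v))" "(\<integral>x. u (x + v) \<partial>lborel) = (\<integral>x. u x \<partial>lborel)" for v
    using iu integrable_distr[of "(+) v" lborel borel u] integral_distr[of "(+) v" lborel borel u]
      lborel_distr_plus[of v] by (simp_all add: add.commute borel_measurable_integrable)
  have der: "((\<lambda>t. u (x + t *\<^sub>R ?e)) has_real_derivative pd k u (x + t *\<^sub>R ?e)) (at t)" for x t
  proof -
    let ?D = "frechet_derivative u (at (x + t *\<^sub>R ?e))"
    have D: "(u has_derivative ?D) (at (x + t *\<^sub>R ?e))" by (rule pd_works[OF diff])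
    have "((\<lambda>t. u (x + t *\<^sub>R ?e)) has_derivative (\<lambda>h. ?D (h *\<^sub>R ?e))) (at t)"
      by (rule has_derivative_compose[where f = "\<lambda>t. x + t *\<^sub>R ?e", OF _ D]) (auto intro!: derivative_eq_intros)
    then show ?thesis unfolding has_field_derivative_def
      by (rule has_derivative_eq_rhs)
        (simp add: linear_cmul[OF has_derivative_linear[OF D]] fun_eq_iff pd_def)
  qed
  have "((\<lambda>t. \<integral>x. u (x + t *\<^sub>R ?e) \<partial>lborel) has_real_derivative (\<integral>x. pd k u (x + 0 *\<^sub>R ?e) \<partial>lborel)) (at 0)"
  \<comment> \<open>Translation by less than 1 moves the support into the ball of radius
    \<open>r + 1\<close>; a constant bound cut off there is integrable and dominates uniformly in
    \<open>t\<close>.\<close>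
  proof (rule has_derivative_integral_at_0[where \<delta> = 1 and w = "\<lambda>x. indicator (cball a (r + 1)) x *\<^sub>R C"])
    fix t x assume t: "\<bar>t\<bar> < (1::real)"
    show "\<bar>pd k u (x + t *\<^sub>R ?e)\<bar> \<le> indicator (cball a (r + 1)) x *\<^sub>R C"
    proof (cases "x \<in> cball a (r + 1)")
      case False
      have "norm (t *\<^sub>R ?e) \<le> 1" using t by (simp add: norm_axis_1)
      then have "dist a x \<le> dist a (x + t *\<^sub>R ?e) + 1"
        using dist_triangle[of a x "x + t *\<^sub>R ?e"] by (simp add: dist_norm)
      then have "x + t *\<^sub>R ?e \<notin> cball a r" using False by auto
      then show ?thesis using pd0 False by simp
    qed (use C in simp)
  next
    show "integrable lborel (\<lambda>x. indicator (cball a (r + 1)) x *\<^sub>R C)"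
      by (rule borel_integrable_compact) auto
  qed (use shift der in auto)
  moreover have "((\<lambda>t. \<integral>x. u (x + t *\<^sub>R ?e) \<partial>lborel) has_real_derivative 0) (at 0)"
    unfolding shift by simp
  ultimately show ?thesis using DERIV_unique by fastforce
qed

section \<open>The energy density along a variation\<close>

lemma smooth_on_edens [smooth_intros]:
  fixes G :: "'z::euclidean_space \<Rightarrow> real^'m^'m" and H :: "'z \<Rightarrow> real^'n^'n"
  assumes "open S" "smooth_on S G" "smooth_on S H" "\<And>k. smooth_on S (A k)" "\<And>x. x \<in> S \<Longrightarrow> det (G x) \<noteq> 0"
  shows "smooth_on S (\<lambda>x. edens (G x) (H x) (\<lambda>k. A k x))"
  unfolding edens_def by (intro smooth_intros assms)

lemma has_real_derivative_vec_nth: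
  "(\<phi> has_vector_derivative v) (at t) \<Longrightarrow> ((\<lambda>t. \<phi> t $ a) has_real_derivative v $ a) (at t)"
  unfolding has_vector_derivative_def has_field_derivative_def
  by (drule has_derivative_vec_nth[where i = a]) (erule has_derivative_eq_rhs, auto)

lemma has_vector_derivative_vec_nth:
  "(\<phi> has_vector_derivative v) (at t) \<Longrightarrow> ((\<lambda>t. \<phi> t $ a) has_vector_derivative v $ a) (at t)"
  unfolding has_vector_derivative_def
  by (drule has_derivative_vec_nth[where i = a]) (erule has_derivative_eq_rhs, simp)

lemma has_vector_derivative_chain:
  assumes "(\<phi> has_vector_derivative v) (at t)" "(f has_derivative L) (at (\<phi> t))"
  shows "((\<lambda>t. f (\<phi> t)) has_vector_derivative L v) (at t)"
  using vector_derivative_diff_chain_within[of \<phi> v t UNIV f L] assms(1)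
    has_derivative_at_withinI[OF assms(2), of "range \<phi>"] by (simp add: o_def)

lemma has_real_derivative_sum:
  "(\<And>i. i \<in> I \<Longrightarrow> (f i has_real_derivative D i) (at t)) \<Longrightarrow>
    ((\<lambda>t. \<Sum>i\<in>I. f i t) has_real_derivative (\<Sum>i\<in>I. D i)) (at t)"
  by (induction I rule: infinite_finite_induct) (auto intro: DERIV_add)

text \<open>The product rule differentiates each of the two factors \<open>A\<close>; symmetry of
  the inverse of \<open>G\<close> and of \<open>H\<close> merges these terms, whence the factor
  2.\<close>

lemma edens_has_real_derivative:
  fixes G :: "real^'m^'m" and H :: "real^'n \<Rightarrow> real^'n^'n"
  assumes \<phi>: "(\<phi> has_vector_derivative V) (at t)" and H: "H differentiable (at (\<phi> t))"
    and A: "\<And>k. (A k has_vector_derivative B k) (at t)"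
    and Gs: "\<And>k l. matrix_inv G $ k $ l = matrix_inv G $ l $ k"
    and Hs: "\<And>a b. H (\<phi> t) $ a $ b = H (\<phi> t) $ b $ a"
  shows "((\<lambda>t. edens G (H (\<phi> t)) (\<lambda>k. A k t)) has_real_derivative
    (\<Sum>k\<in>UNIV. \<Sum>l\<in>UNIV. matrix_inv G $ k $ l * (\<Sum>a\<in>UNIV. \<Sum>b\<in>UNIV.
       (\<Sum>c\<in>UNIV. V $ c * pd c H (\<phi> t) $ a $ b) * A k t $ a * A l t $ b))
    + 2 * (\<Sum>k\<in>UNIV. \<Sum>l\<in>UNIV. matrix_inv G $ k $ l * (\<Sum>a\<in>UNIV. \<Sum>b\<in>UNIV.
       H (\<phi> t) $ a $ b * B k $ a * A l t $ b))) (at t)"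
proof -
  define dH where "dH a b = (\<Sum>c\<in>UNIV. V $ c * pd c H (\<phi> t) $ a $ b)" for a b
  let ?g = "\<lambda>k l. matrix_inv G $ k $ l" and ?h = "\<lambda>a b. H (\<phi> t) $ a $ b"
  have "((\<lambda>t. H (\<phi> t)) has_vector_derivative frechet_derivative H (at (\<phi> t)) V) (at t)"
    by (rule has_vector_derivative_chain[OF \<phi> pd_works[OF H]])
  then have "((\<lambda>t. H (\<phi> t)) has_vector_derivative (\<Sum>c\<in>UNIV. V $ c *\<^sub>R pd c H (\<phi> t))) (at t)"
    by (simp only: frechet_derivative_eq_sum_pd[OF H])
  from has_real_derivative_vec_nth[OF has_vector_derivative_vec_nth[OF this]]
  have h': "((\<lambda>t. H (\<phi> t) $ a $ b) has_real_derivative dH a b) (at t)" for a b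
    by (simp add: dH_def sum_component)
  have A': "((\<lambda>t. A k t $ a) has_real_derivative B k $ a) (at t)" for k a
    by (rule has_real_derivative_vec_nth[OF A])
  have D: "((\<lambda>t. edens G (H (\<phi> t)) (\<lambda>k. A k t)) has_real_derivative
    (\<Sum>k\<in>UNIV. \<Sum>l\<in>UNIV. ?g k l * (\<Sum>a\<in>UNIV. \<Sum>b\<in>UNIV.
      (dH a b * A k t $ a + B k $ a * ?h a b) * A l t $ b + B l $ b * (?h a b * A k t $ a)))) (at t)"
    unfolding edens_def
    by (intro has_real_derivative_sum DERIV_cmult DERIV_mult h' A')
  define S1 where "S1 = (\<Sum>k\<in>UNIV. \<Sum>l\<in>UNIV. ?g k l * (\<Sum>a\<in>UNIV. \<Sum>b\<in>UNIV. dH a b * A k t $ a * A l t $ b))"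
  define S2 where "S2 = (\<Sum>k\<in>UNIV. \<Sum>l\<in>UNIV. ?g k l * (\<Sum>a\<in>UNIV. \<Sum>b\<in>UNIV. ?h a b * B k $ a * A l t $ b))"
  have "(\<Sum>k\<in>UNIV. \<Sum>l\<in>UNIV. ?g k l * (\<Sum>a\<in>UNIV. \<Sum>b\<in>UNIV. B l $ b * (?h a b * A k t $ a)))
      = (\<Sum>l\<in>UNIV. \<Sum>k\<in>UNIV. ?g k l * (\<Sum>a\<in>UNIV. \<Sum>b\<in>UNIV. B l $ b * (?h a b * A k t $ a)))"
    by (rule sum.swap)
  also have "\<dots> = S2"
    unfolding S2_def
  proof (intro sum.cong refl)
    fix k l
    have "(\<Sum>a\<in>UNIV. \<Sum>b\<in>UNIV. B l $ b * (?h a b * A k t $ a)) = (\<Sum>b\<in>UNIV. \<Sum>a\<in>UNIV. B l $ b * (?h a b * A k t $ a))"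
      by (rule sum.swap)
    also have "\<dots> = (\<Sum>a\<in>UNIV. \<Sum>b\<in>UNIV. ?h a b * B l $ a * A k t $ b)"
    proof (intro sum.cong refl)
      fix a b show "B l $ b * (?h a b * A k t $ a) = ?h b a * B l $ b * A k t $ a"
        using Hs[of a b] by simp
    qed
    finally show "?g k l * (\<Sum>a\<in>UNIV. \<Sum>b\<in>UNIV. B l $ b * (?h a b * A k t $ a))
        = ?g l k * (\<Sum>a\<in>UNIV. \<Sum>b\<in>UNIV. ?h a b * B l $ a * A k t $ b)"
      using Gs[of k l] by simp
  qed
  finally have S2': "(\<Sum>k\<in>UNIV. \<Sum>l\<in>UNIV. ?g k l * (\<Sum>a\<in>UNIV. \<Sum>b\<in>UNIV. B l $ b * (?h a b * A k t $ a))) = S2" .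
  have "(\<Sum>k\<in>UNIV. \<Sum>l\<in>UNIV. ?g k l * (\<Sum>a\<in>UNIV. \<Sum>b\<in>UNIV.
      (dH a b * A k t $ a + B k $ a * ?h a b) * A l t $ b + B l $ b * (?h a b * A k t $ a)))
    = (\<Sum>k\<in>UNIV. \<Sum>l\<in>UNIV. ?g k l * (\<Sum>a\<in>UNIV. \<Sum>b\<in>UNIV. dH a b * A k t $ a * A l t $ b))
      + (\<Sum>k\<in>UNIV. \<Sum>l\<in>UNIV. ?g k l * (\<Sum>a\<in>UNIV. \<Sum>b\<in>UNIV. B k $ a * ?h a b * A l t $ b))
      + (\<Sum>k\<in>UNIV. \<Sum>l\<in>UNIV. ?g k l * (\<Sum>a\<in>UNIV. \<Sum>b\<in>UNIV. B l $ b * (?h a b * A k t $ a)))"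
    by (simp only: sum.distrib distrib_left distrib_right)
  also have "\<dots> = S1 + 2 * S2"
    unfolding S2' S1_def[symmetric] by (simp add: S2_def mult.commute)
  finally show ?thesis using D unfolding S1_def S2_def dH_def by simp
qed

lemma (in smooth_mfd) continuous_map_charts:
  fixes u :: "'a \<Rightarrow> 'b::topological_space"
  assumes "\<And>p. p \<in> topspace (topo M) \<Longrightarrow> \<exists>c\<in>charts_at M p. \<exists>V. open V \<and> snd c p \<in> V \<and>
    V \<subseteq> chart_image c \<and> continuous_on V (\<lambda>x. u (chart_inv c x))"
  shows "continuous_map (topo M) euclidean u"
  unfolding continuous_map_def
proof (intro conjI allI impI)
  fix S :: "'b set" assume "openin euclidean S"
  then have S: "open S" by simp
  show "openin (topo M) {p \<in> topspace (topo M). u p \<in> S}"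
  proof (subst openin_subopen, intro ballI)
    fix p assume p: "p \<in> {p \<in> topspace (topo M). u p \<in> S}"
    then obtain c V where c: "c \<in> charts_at M p" and V: "open V" "snd c p \<in> V" "V \<subseteq> chart_image c"
      "continuous_on V (\<lambda>x. u (chart_inv c x))" using assms[of p] by blast
    have ca: "c \<in> atlas M" "p \<in> fst c" using charts_atD[OF c] by auto
    define W where "W = (\<lambda>x. u (chart_inv c x)) -` S \<inter> V"
    have W: "open W" unfolding W_def using V(4)[unfolded continuous_on_open_vimage[OF V(1)]] S by simp
    have sub: "W \<subseteq> chart_image c" using V(3) by (auto simp: W_def)
    show "\<exists>T. openin (topo M) T \<and> p \<in> T \<and> T \<subseteq> {p \<in> topspace (topo M). u p \<in> S}"
    proof (intro exI conjI)
      show "openin (topo M) (chart_inv c ` W)" by (rule openin_chart_inv_image[OF ca(1) W sub])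
      show "p \<in> chart_inv c ` W"
        using p V(2) chart_inv_left[OF ca] by (intro image_eqI[of _ _ "snd c p"]) (auto simp: W_def)
      show "chart_inv c ` W \<subseteq> {p \<in> topspace (topo M). u p \<in> S}"
        using sub chart_inv_in[of _ c] ca(1) by (auto simp: W_def topspace_eq)
    qed
  qed
qed simp

lemma (in smooth_mfd) continuous_map_bounded:
  fixes u :: "'a \<Rightarrow> real"
  assumes "compact_space (topo M)" "continuous_map (topo M) euclidean u"
  shows "\<exists>C. \<forall>p\<in>topspace (topo M). \<bar>u p\<bar> \<le> C"
proof -
  have "compactin euclidean (u ` topspace (topo M))"
    using assms by (intro image_compactin[where X = "topo M"]) (auto simp: compact_space_def)
  then show ?thesis using compact_imp_bounded[of "u ` topspace (topo M)"] by (auto simp: bounded_real)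
qed

section \<open>Smoothness in time and space, and differentiability of the energy\<close>

locale energy_variation = riem_pair M g N h
  for M :: "('a, 'm::finite) manifold" and g :: "('a, 'm) metric"
    and N :: "('b, 'n::finite) manifold" and h :: "('b, 'n) metric" +
  fixes \<alpha> :: real and f :: "'a \<Rightarrow> 'b" and \<epsilon> :: real and F :: "real \<Rightarrow> 'a \<Rightarrow> 'b"
  assumes compact: "compact_space (topo M)" and eps: "\<epsilon> > 0"
    and var: "smooth_variation M N f \<epsilon> F"
begin

text \<open>\<open>Phi c d\<close> is the variation in coordinates, with domain \<open>Om c d\<close>, and \<open>dens c d\<close> is
  its energy density; \<open>Q\<close> is the integrand of the \<open>\<alpha>\<close>-energy and \<open>q c d\<close> its coordinate expression.\<close>

definition Om :: "('a, 'm) chart \<Rightarrow> ('b, 'n) chart \<Rightarrow> (real \<times> (real^'m)) set" where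
  "Om c d = {(t, x). t \<in> {-\<epsilon><..<\<epsilon>} \<and> x \<in> chart_image c \<and> F t (chart_inv c x) \<in> fst d}"

definition Phi :: "('a, 'm) chart \<Rightarrow> ('b, 'n) chart \<Rightarrow> real \<times> (real^'m) \<Rightarrow> real^'n" where
  "Phi c d = (\<lambda>(t, x). local_rep c d (F t) x)"

definition dens :: "('a, 'm) chart \<Rightarrow> ('b, 'n) chart \<Rightarrow> real \<times> (real^'m) \<Rightarrow> real" where
  "dens c d z = edens (metric_matrix M g c (snd z)) (metric_matrix N h d (Phi c d z))
     (\<lambda>k. frechet_derivative (Phi c d) (at z) (0, axis k 1))"

definition Q :: "real \<Rightarrow> 'a \<Rightarrow> real" where
  "Q t p = (1 + (hs_norm M g N h (F t) p)\<^sup>2) powr \<alpha>"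

definition q :: "('a, 'm) chart \<Rightarrow> ('b, 'n) chart \<Rightarrow> real \<times> (real^'m) \<Rightarrow> real" where
  "q c d z = (1 + dens c d z) powr \<alpha>"

lemma F_continuous_product:
  "continuous_map (prod_topology (top_of_set {-\<epsilon><..<\<epsilon>}) (topo M)) (topo N) (\<lambda>(t, p). F t p)"
  and Phi_smooth: "c \<in> atlas M \<Longrightarrow> d \<in> atlas N \<Longrightarrow> smooth_on (Om c d) (Phi c d)"
  and F_0: "p \<in> topspace (topo M) \<Longrightarrow> F 0 p = f p"
  using var by (auto simp: smooth_variation_def Om_def Phi_def)

lemma F_continuous: 
  assumes "\<bar>t\<bar> < \<epsilon>" shows "continuous_map (topo M) (topo N) (F t)"
proof -
  have "continuous_map (topo M) (prod_topology (top_of_set {-\<epsilon><..<\<epsilon>}) (topo M)) (\<lambda>p. (t, p))"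
    using assms by (intro continuous_map_pairedI) (auto simp: continuous_map_in_subtopology)
  from continuous_map_compose[OF this F_continuous_product] show ?thesis by (simp add: o_def)
qed

text \<open>\<open>smooth_on\<close> is meaningful on open sets. Openness of the domain in time and
  space together comes from the joint continuity required of a variation.\<close>

lemma Om_open:
  assumes "c \<in> atlas M" "d \<in> atlas N"
  shows "open (Om c d)"
proof -
  let ?P = "{-\<epsilon><..<\<epsilon>} \<times> chart_image c"
  have P: "open ?P" using M.chart_image_open[OF assms(1)] by (intro open_Times) auto
  have "continuous_map (top_of_set ?P) (prod_topology (top_of_set {-\<epsilon><..<\<epsilon>}) (topo M))
      (\<lambda>z. (fst z, chart_inv c (snd z)))"
  proof (rule continuous_map_pairedI)
    show "continuous_map (top_of_set ?P) (top_of_set {-\<epsilon><..<\<epsilon>}) fst"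
      by (auto simp: continuous_map_in_subtopology intro: continuous_intros)
    have "continuous_map (top_of_set ?P) (top_of_set (chart_image c)) snd"
      by (auto simp: continuous_map_in_subtopology intro: continuous_intros)
    from continuous_map_compose[OF this M.chart_inv_continuous[OF assms(1)]]
    show "continuous_map (top_of_set ?P) (topo M) (\<lambda>z. chart_inv c (snd z))" by (simp add: o_def)
  qed
  from continuous_map_compose[OF this F_continuous_product]
  have "continuous_map (top_of_set ?P) (topo N) (\<lambda>z. F (fst z) (chart_inv c (snd z)))" by (simp add: o_def)
  from openin_continuous_map_preimage[OF this N.chart_open[OF assms(2)]]
  have "openin (top_of_set ?P) {z \<in> ?P. F (fst z) (chart_inv c (snd z)) \<in> fst d}" by simp
  moreover have "{z \<in> ?P. F (fst z) (chart_inv c (snd z)) \<in> fst d} = Om c d"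
    by (auto simp: Om_def)
  ultimately show ?thesis using openin_open_trans[OF _ P] by simp
qed

lemma Om_D:
  assumes "c \<in> atlas M" "d \<in> atlas N" "(t, x) \<in> Om c d"
  shows "\<bar>t\<bar> < \<epsilon>" "x \<in> chart_image c" "c \<in> charts_at M (chart_inv c x)"
    "d \<in> charts_at N (F t (chart_inv c x))" "snd c (chart_inv c x) = x"
    "Phi c d (t, x) = snd d (F t (chart_inv c x))" "Phi c d (t, x) \<in> chart_image d"
  using assms M.chart_inv_in[of x c] M.chart_inv_right[of x c]
  by (auto simp: Om_def charts_at_def Phi_def local_rep_def chart_image_def)

lemma Phi_slice:
  assumes "c \<in> atlas M" "d \<in> atlas N" "(t, x) \<in> Om c d"
  shows "(local_rep c d (F t) has_derivative (\<lambda>v. frechet_derivative (Phi c d) (at (t, x)) (0, v))) (at x)"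
proof -
  have "((\<lambda>y. Phi c d (t, y)) has_derivative (\<lambda>v. frechet_derivative (Phi c d) (at (t, x)) (0, v))) (at x)"
    by (rule has_derivative_compose[where f = "\<lambda>y. (t, y)" and g = "Phi c d",
          OF _ smooth_on_has_derivative[OF Phi_smooth[OF assms(1,2)] assms(3)]])
       (auto intro!: derivative_eq_intros)
  then show ?thesis by (simp add: Phi_def)
qed

lemma hs_norm_dens:
  assumes "c \<in> atlas M" "d \<in> atlas N" "(t, x) \<in> Om c d"
  shows "(hs_norm M g N h (F t) (chart_inv c x))\<^sup>2 = dens c d (t, x)"
proof -
  note D = Om_D[OF assms] and sl = Phi_slice[OF assms]
  have "local_rep c d (F t) differentiable (at (snd c (chart_inv c x)))"
    unfolding D(5) using sl by (auto simp: differentiable_def)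
  from hs_norm_coords[OF F_continuous[OF D(1)] D(3,4) this]
  show ?thesis unfolding D(5) D(6)[symmetric] dens_def by (simp add: pd_eqI[OF sl])
qed

lemma Q_eq_q:
  "c \<in> atlas M \<Longrightarrow> d \<in> atlas N \<Longrightarrow> (t, x) \<in> Om c d \<Longrightarrow> Q t (chart_inv c x) = q c d (t, x)"
  by (simp add: Q_def q_def hs_norm_dens)

lemma dens_nonneg:
  assumes "c \<in> atlas M" "d \<in> atlas N" "z \<in> Om c d" shows "dens c d z \<ge> 0"
  using hs_norm_dens[OF assms(1,2), of "fst z" "snd z"] assms(3) by (metis prod.collapse zero_le_power2)

lemma dens_smooth:
  assumes "c \<in> atlas M" "d \<in> atlas N"
  shows "smooth_on (Om c d) (dens c d)"
  unfolding dens_def[abs_def]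
proof (rule smooth_on_edens[OF Om_open[OF assms]])
  have sub: "snd ` Om c d \<subseteq> chart_image c" "Phi c d ` Om c d \<subseteq> chart_image d"
    using Om_D[OF assms] by auto
  show "smooth_on (Om c d) (\<lambda>z. metric_matrix M g c (snd z))"
    by (rule smooth_on_compose[OF Om_open[OF assms] M.chart_image_open[OF assms(1)]
          M.metric_matrix_smooth[OF assms(1)] _ sub(1)])
       (intro smooth_intros Om_open assms)
  show "smooth_on (Om c d) (\<lambda>z. metric_matrix N h d (Phi c d z))"
    by (rule smooth_on_compose[OF Om_open[OF assms] N.chart_image_open[OF assms(2)]
          N.metric_matrix_smooth[OF assms(2)] Phi_smooth[OF assms] sub(2)])
  show "smooth_on (Om c d) (\<lambda>z. frechet_derivative (Phi c d) (at z) (0, axis k 1))" for k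
    by (rule smooth_on_frechet_derivative[OF Phi_smooth[OF assms]])
  fix z assume "z \<in> Om c d"
  then show "det (metric_matrix M g c (snd z)) \<noteq> 0"
    using M.metric_det_pos[OF assms(1), of "snd z"] sub by auto
qed

lemma q_smooth:
  assumes "c \<in> atlas M" "d \<in> atlas N"
  shows "smooth_on (Om c d) (q c d)"
  unfolding q_def[abs_def]
  by (intro smooth_intros Om_open dens_smooth assms) (use dens_nonneg[OF assms] in force)

lemma Om_chart_ex:
  assumes "p \<in> topspace (topo M)" "\<bar>t\<bar> < \<epsilon>"
  obtains c d where "c \<in> charts_at M p" "c \<in> atlas M" "d \<in> atlas N" "(t, snd c p) \<in> Om c d"
proof -
  obtain c where c: "c \<in> charts_at M p" using M.charts_at_ex[OF assms(1)] by blast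
  have "F t p \<in> topspace (topo N)"
    using continuous_map_image_subset_topspace[OF F_continuous[OF assms(2)]] assms(1) by auto
  then obtain d where d: "d \<in> charts_at N (F t p)" using N.charts_at_ex by blast
  show ?thesis
  proof (rule that[OF c M.charts_atD(1)[OF c] N.charts_atD(1)[OF d]])
    show "(t, snd c p) \<in> Om c d"
      using M.charts_atD[OF c] N.charts_atD[OF d] assms(2) M.chart_inv_left[of c p] M.chart_image_in[of p c]
      by (simp add: Om_def abs_less_iff minus_less_iff)
  qed
qed

lemma slice_open: "open S \<Longrightarrow> open {x. (t, x) \<in> S}"
  for S :: "(real \<times> (real^'m)) set"
  using open_vimage[of S "\<lambda>x. (t, x)"] continuous_on_Pair[OF continuous_on_const continuous_on_id, of UNIV t]
  by (simp add: vimage_def)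

lemma Q_continuous:
  assumes "\<bar>t\<bar> < \<epsilon>" shows "continuous_map (topo M) euclidean (Q t)"
proof (rule M.continuous_map_charts)
  fix p assume p: "p \<in> topspace (topo M)"
  obtain c d where cd: "c \<in> charts_at M p" "c \<in> atlas M" "d \<in> atlas N" "(t, snd c p) \<in> Om c d"
    using Om_chart_ex[OF p assms] .
  define V where "V = {x. (t, x) \<in> Om c d}"
  have "continuous_on V (\<lambda>x. q c d (t, x))"
    by (rule continuous_on_compose2[OF smooth_on_imp_continuous_on[OF q_smooth[OF cd(2,3)]]])
       (auto simp: V_def intro: continuous_intros)
  then have "continuous_on V (\<lambda>x. Q t (chart_inv c x))"
    by (rule continuous_on_eq) (use Q_eq_q[OF cd(2,3)] in \<open>auto simp: V_def\<close>)
  then show "\<exists>c\<in>charts_at M p. \<exists>V. open V \<and> snd c p \<in> V \<and> V \<subseteq> chart_image c \<and>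
      continuous_on V (\<lambda>x. Q t (chart_inv c x))"
    using cd slice_open[OF Om_open[OF cd(2,3)]] Om_D(2)[OF cd(2,3)]
    by (intro bexI[of _ c] exI[of _ V]) (auto simp: V_def)
qed

lemma q_time_derivative:
  assumes "c \<in> atlas M" "d \<in> atlas N" "(t, x) \<in> Om c d"
  shows "((\<lambda>t. Q t (chart_inv c x)) has_real_derivative frechet_derivative (q c d) (at (t, x)) (1, 0)) (at t)"
proof -
  let ?D = "frechet_derivative (q c d) (at (t, x))"
  have D: "(q c d has_derivative ?D) (at (t, x))"
    by (rule smooth_on_has_derivative[OF q_smooth[OF assms(1,2)] assms(3)])
  have A: "((\<lambda>s. q c d (s, x)) has_derivative (\<lambda>r. ?D (r, 0))) (at t)"
    by (rule has_derivative_compose[where f = "\<lambda>s. (s, x)" and g = "q c d", OF _ D])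
       (auto intro!: derivative_eq_intros)
  have B: "?D (r, 0) = ?D (1, 0) * r" for r
    using linear_cmul[OF has_derivative_linear[OF D], of r "(1, 0)"] by (simp add: mult.commute)
  have "((\<lambda>s. q c d (s, x)) has_real_derivative ?D (1, 0)) (at t)"
    unfolding has_field_derivative_def by (rule has_derivative_eq_rhs[OF A]) (rule ext, rule B)
  moreover have "open {s. (s, x) \<in> Om c d}"
    using open_vimage[OF Om_open[OF assms(1,2)], of "\<lambda>s. (s, x)"]
      continuous_on_Pair[OF continuous_on_id continuous_on_const, of UNIV x] by (simp add: vimage_def)
  ultimately show ?thesis
    by (rule has_field_derivative_transform_within_open) (use assms Q_eq_q in auto)
qed

text \<open>Taken pointwise on the manifold, so independence of charts is built in;
  \<open>dQ_eq\<close> evaluates it in any suitable pair of charts.\<close>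

definition dQ :: "real \<Rightarrow> 'a \<Rightarrow> real" where
  "dQ t p = deriv (\<lambda>t. Q t p) t"

lemma dQ_eq:
  "c \<in> atlas M \<Longrightarrow> d \<in> atlas N \<Longrightarrow> (t, x) \<in> Om c d \<Longrightarrow>
    dQ t (chart_inv c x) = frechet_derivative (q c d) (at (t, x)) (1, 0)"
  unfolding dQ_def by (rule DERIV_imp_deriv[OF q_time_derivative])

lemma dQ_continuous:
  assumes "\<bar>t\<bar> < \<epsilon>" shows "continuous_map (topo M) euclidean (dQ t)"
proof (rule M.continuous_map_charts)
  fix p assume p: "p \<in> topspace (topo M)"
  obtain c d where cd: "c \<in> charts_at M p" "c \<in> atlas M" "d \<in> atlas N" "(t, snd c p) \<in> Om c d"
    using Om_chart_ex[OF p assms] .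
  define V where "V = {x. (t, x) \<in> Om c d}"
  have "continuous_on V (\<lambda>x. frechet_derivative (q c d) (at (t, x)) (1, 0))"
    by (rule continuous_on_compose2[OF smooth_on_imp_continuous_on[OF
            smooth_on_frechet_derivative[OF q_smooth[OF cd(2,3)]]], where f = "\<lambda>x. (t, x)"])
       (auto simp: V_def intro: continuous_intros)
  then have "continuous_on V (\<lambda>x. dQ t (chart_inv c x))"
    by (rule continuous_on_eq) (use dQ_eq[OF cd(2,3)] in \<open>auto simp: V_def\<close>)
  then show "\<exists>c\<in>charts_at M p. \<exists>V. open V \<and> snd c p \<in> V \<and> V \<subseteq> chart_image c \<and>
      continuous_on V (\<lambda>x. dQ t (chart_inv c x))"
    using cd slice_open[OF Om_open[OF cd(2,3)]] Om_D(2)[OF cd(2,3)]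
    by (intro bexI[of _ c] exI[of _ V]) (auto simp: V_def)
qed

lemma Q_has_derivative:
  assumes "p \<in> topspace (topo M)" "\<bar>t\<bar> < \<epsilon>"
  shows "((\<lambda>t. Q t p) has_real_derivative dQ t p) (at t)"
proof -
  obtain c d where cd: "c \<in> charts_at M p" "c \<in> atlas M" "d \<in> atlas N" "(t, snd c p) \<in> Om c d"
    using Om_chart_ex[OF assms] .
  have "chart_inv c (snd c p) = p" by (rule M.chart_inv_left[OF cd(2) M.charts_atD(2)[OF cd(1)]])
  then show ?thesis using q_time_derivative[OF cd(2-4)] dQ_eq[OF cd(2-4)] by simp
qed

text \<open>In charts the time derivative is continuous in time and space jointly, hence bounded on
  a product neighbourhood of each point at time 0. Compactness reduces to finitely many
  neighbourhoods and so to a common time bound.\<close>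

lemma dQ_bounded:
  "\<exists>\<delta>>0. \<exists>C. \<forall>t p. \<bar>t\<bar> < \<delta> \<longrightarrow> p \<in> topspace (topo M) \<longrightarrow> \<bar>dQ t p\<bar> \<le> C"
proof -
  define good where "good U \<longleftrightarrow> openin (topo M) U \<and>
    (\<exists>\<delta>>0. \<exists>C. \<forall>t p. \<bar>t\<bar> < \<delta> \<longrightarrow> p \<in> U \<longrightarrow> \<bar>dQ t p\<bar> \<le> C)" for U
  have "\<exists>U. good U \<and> p \<in> U" if p: "p \<in> topspace (topo M)" for p
  proof -
    have "\<bar>0\<bar> < \<epsilon>" using eps by simp
    then obtain c d where cd: "c \<in> charts_at M p" "c \<in> atlas M" "d \<in> atlas N" "(0, snd c p) \<in> Om c d"
      by (rule Om_chart_ex[OF p])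
    let ?D = "\<lambda>z. frechet_derivative (q c d) (at z) (1, 0)"
    define B where "B = \<bar>?D (0, snd c p)\<bar> + 1"
    have cn: "continuous_on (Om c d) (\<lambda>z. \<bar>?D z\<bar>)"
      by (intro continuous_on_rabs smooth_on_imp_continuous_on smooth_on_frechet_derivative q_smooth cd)
    have "open ((\<lambda>z. \<bar>?D z\<bar>) -` {..<B} \<inter> Om c d)"
      by (rule continuous_on_open_vimage[OF Om_open[OF cd(2,3)], THEN iffD1, OF cn, rule_format]) simp
    moreover have "(0, snd c p) \<in> (\<lambda>z. \<bar>?D z\<bar>) -` {..<B} \<inter> Om c d" using cd(4) by (simp add: B_def)
    ultimately obtain A V where AV: "open A" "open V" "(0, snd c p) \<in> A \<times> V"
      "A \<times> V \<subseteq> (\<lambda>z. \<bar>?D z\<bar>) -` {..<B} \<inter> Om c d"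
      by (rule open_prod_elim)
    obtain \<delta> where \<delta>: "\<delta> > 0" "ball 0 \<delta> \<subseteq> A" using AV(1,3) open_contains_ball by blast
    have sub: "V \<subseteq> chart_image c" using AV(3,4) Om_D(2)[OF cd(2,3)] by blast
    have "\<bar>dQ t r\<bar> \<le> B" if "\<bar>t\<bar> < \<delta>" "r \<in> chart_inv c ` V" for t r
    proof -
      obtain x where x: "x \<in> V" "r = chart_inv c x" using \<open>r \<in> chart_inv c ` V\<close> by auto
      have "t \<in> A" using \<delta> that by (auto simp: dist_real_def)
      then have "(t, x) \<in> Om c d" "\<bar>?D (t, x)\<bar> < B" using AV(4) x(1) by auto
      then show ?thesis using dQ_eq[OF cd(2,3)] x by auto
    qed
    then have "good (chart_inv c ` V)"
      unfolding good_def using \<delta>(1) M.openin_chart_inv_image[OF cd(2) AV(2) sub]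
      by (intro conjI, simp, intro exI[where x = \<delta>], intro conjI exI[where x = B]) auto
    moreover have "p \<in> chart_inv c ` V"
      using AV(3) M.chart_inv_left[OF cd(2) M.charts_atD(2)[OF cd(1)]]
      by (intro image_eqI[of _ _ "snd c p"]) auto
    ultimately show ?thesis by blast
  qed
  then have "topspace (topo M) \<subseteq> \<Union> {U. good U}" by auto
  moreover have "\<And>U. U \<in> {U. good U} \<Longrightarrow> openin (topo M) U" by (simp add: good_def)
  ultimately obtain \<F> where F: "finite \<F>" "\<F> \<subseteq> {U. good U}" "topspace (topo M) \<subseteq> \<Union> \<F>"
    using compact[unfolded compact_space_alt, rule_format, of "{U. good U}"] by blast
  have "\<exists>\<delta>>0. \<exists>C. \<forall>t p. \<bar>t\<bar> < \<delta> \<longrightarrow> p \<in> \<Union> \<F> \<longrightarrow> \<bar>dQ t p\<bar> \<le> C"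
    using F(1,2)
  proof (induction \<F> rule: finite_induct)
    case empty
    then show ?case by (auto intro: exI[of _ 1])
  next
    case (insert U \<F>)
    have "\<F> \<subseteq> {U. good U}" using insert.prems by simp
    from insert.IH[OF this] obtain \<delta>1 C1
      where 1: "\<delta>1 > 0" "\<forall>t p. \<bar>t\<bar> < \<delta>1 \<longrightarrow> p \<in> \<Union> \<F> \<longrightarrow> \<bar>dQ t p\<bar> \<le> C1"
      by (elim exE conjE) (rule that)
    have "good U" using insert by simp
    then obtain \<delta>2 C2 where 2: "\<delta>2 > 0" "\<forall>t p. \<bar>t\<bar> < \<delta>2 \<longrightarrow> p \<in> U \<longrightarrow> \<bar>dQ t p\<bar> \<le> C2"
      unfolding good_def by (elim exE conjE) (rule that)
    have "\<bar>dQ t p\<bar> \<le> max C1 C2" if "\<bar>t\<bar> < min \<delta>1 \<delta>2" "p \<in> \<Union> (insert U \<F>)" for t p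
      using 1(2)[rule_format, of t p] 2(2)[rule_format, of t p] that by (cases "p \<in> U") auto
    then show ?case using 1(1) 2(1) by (intro exI[where x = "min \<delta>1 \<delta>2"], intro conjI exI[where x = "max C1 C2"]) auto
  qed
  then obtain \<delta> C where "\<delta> > 0" "\<forall>t p. \<bar>t\<bar> < \<delta> \<longrightarrow> p \<in> \<Union> \<F> \<longrightarrow> \<bar>dQ t p\<bar> \<le> C"
    by (elim exE conjE) (rule that)
  then have "\<forall>t p. \<bar>t\<bar> < \<delta> \<longrightarrow> p \<in> topspace (topo M) \<longrightarrow> \<bar>dQ t p\<bar> \<le> C"
    using subsetD[OF F(3)] by simp
  then show ?thesis using \<open>\<delta> > 0\<close> by (intro exI[where x = \<delta>], intro conjI exI[where x = C])
qed

text \<open>The bound from \<open>dQ_bounded\<close> is a constant, and a constant may dominate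
  because the measure is finite.\<close>

lemma energy_has_derivative:
  "((\<lambda>t. alpha_energy \<alpha> M g N h (F t)) has_real_derivative (\<integral>p. dQ 0 p \<partial>M.\<mu>)) (at 0)"
proof -
  interpret mu: finite_measure "M.\<mu>" by (rule M.finite_measure_mu[OF compact])
  obtain \<delta> C where \<delta>: "\<delta> > 0" "\<And>t p. \<bar>t\<bar> < \<delta> \<Longrightarrow> p \<in> topspace (topo M) \<Longrightarrow> \<bar>dQ t p\<bar> \<le> C"
    using dQ_bounded by blast
  have int: "integrable M.\<mu> (Q t)" if t: "\<bar>t\<bar> < \<epsilon>" for t
  proof -
    obtain B where "\<forall>p\<in>topspace (topo M). \<bar>Q t p\<bar> \<le> B"
      using M.continuous_map_bounded[OF compact Q_continuous[OF t]] by blast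
    moreover have "Q t \<in> borel_measurable M.\<mu>"
      by (rule M.measurable_mu[OF compact M.continuous_map_borel_M[OF Q_continuous[OF t]]])
    ultimately show ?thesis
      by (intro mu.integrable_const_bound[where B = B]) (auto simp: M.space_mu[OF compact])
  qed
  have "((\<lambda>t. \<integral>p. Q t p \<partial>M.\<mu>) has_real_derivative (\<integral>p. dQ 0 p \<partial>M.\<mu>)) (at 0)"
    by (rule has_derivative_integral_at_0[where \<delta> = "min \<delta> \<epsilon>" and w = "\<lambda>_. C"])
       (use \<delta> eps int Q_has_derivative in \<open>auto simp: M.space_mu[OF compact]\<close>)
  then show ?thesis unfolding alpha_energy_def Q_def .
qed

lemma energy_critical_iff:
  "((\<lambda>t. alpha_energy \<alpha> M g N h (F t)) has_real_derivative 0) (at 0) \<longleftrightarrow> (\<integral>p. dQ 0 p \<partial>M.\<mu>) = 0"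
  using energy_has_derivative DERIV_unique by metis

end

section \<open>The first variation formula\<close>

text \<open>\<open>W\<close> and the complement of the closed ball are open and cover the space, and
  the extension is smooth on each.\<close>

lemma smooth_on_zero_extension:
  fixes u :: "'a::euclidean_space \<Rightarrow> 'b::euclidean_space"
  assumes "open W" "cball a r \<subseteq> W" "smooth_on W u" "\<And>x. x \<in> W \<Longrightarrow> x \<notin> cball a r \<Longrightarrow> u x = 0"
  shows "smooth_on UNIV (\<lambda>x. if x \<in> W then u x else 0)"
proof (rule smooth_on_locally)
  fix x :: 'a
  show "\<exists>U. open U \<and> x \<in> U \<and> smooth_on U (\<lambda>x. if x \<in> W then u x else 0)"
  proof (cases "x \<in> W")
    case True
    have "smooth_on W (\<lambda>x. if x \<in> W then u x else 0)"
      using smooth_on_cong[OF assms(1), of "\<lambda>x. if x \<in> W then u x else 0" u] assms(3) by simp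
    then show ?thesis using True assms(1) by blast
  next
    case False
    have op: "open (- cball a r)" by auto
    have "smooth_on (- cball a r) (\<lambda>x. if x \<in> W then u x else 0)"
      using smooth_on_cong[OF op, of "\<lambda>x. if x \<in> W then u x else 0" "\<lambda>x. 0"]
        smooth_on_const[OF op, of 0] assms(4) by simp
    moreover have "x \<in> - cball a r" using False assms(2) by auto
    ultimately show ?thesis using op by blast
  qed
qed

context riem_pair begin

text \<open>Coordinate expressions of a map \<open>f\<close> in charts \<open>c\<close>, \<open>d\<close>: the domain, the energy density
  \<open>|df|\<^sup>2\<close>, and half the weight \<open>2\<alpha>(1 + |df|\<^sup>2)\<^bsup>\<alpha>-1\<^esup>\<close> of \<open>\<tau>\<^sub>\<alpha>\<close>. With indices lowered and multiplied by
  the volume density, \<open>\<tau>\<^sub>\<alpha>\<close> becomes \<open>EL\<close>, the divergence of \<open>momentum\<close> minus a term of order zero.\<close>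

definition Wd :: "('a \<Rightarrow> 'b) \<Rightarrow> ('a, 'm) chart \<Rightarrow> ('b, 'n) chart \<Rightarrow> (real^'m) set" where
  "Wd f c d = {x \<in> chart_image c. f (chart_inv c x) \<in> fst d}"

definition e0 :: "('a \<Rightarrow> 'b) \<Rightarrow> ('a, 'm) chart \<Rightarrow> ('b, 'n) chart \<Rightarrow> real^'m \<Rightarrow> real" where
  "e0 f c d x = edens (metric_matrix M g c x) (metric_matrix N h d (local_rep c d f x))
     (\<lambda>k. pd k (local_rep c d f) x)"

definition P0 :: "real \<Rightarrow> ('a \<Rightarrow> 'b) \<Rightarrow> ('a, 'm) chart \<Rightarrow> ('b, 'n) chart \<Rightarrow> real^'m \<Rightarrow> real" where
  "P0 \<alpha> f c d x = \<alpha> * (1 + e0 f c d x) powr (\<alpha> - 1)"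

definition momentum :: "real \<Rightarrow> ('a \<Rightarrow> 'b) \<Rightarrow> ('a, 'm) chart \<Rightarrow> ('b, 'n) chart \<Rightarrow> 'n \<Rightarrow> 'm \<Rightarrow> real^'m \<Rightarrow> real" where
  "momentum \<alpha> f c d a k x =
    (\<Sum>l\<in>UNIV. (2 * P0 \<alpha> f c d x * M.vol c x * matrix_inv (metric_matrix M g c x) $ k $ l) *
      (\<Sum>b\<in>UNIV. metric_matrix N h d (local_rep c d f x) $ a $ b * pd l (local_rep c d f) x $ b))"

definition EL :: "real \<Rightarrow> ('a \<Rightarrow> 'b) \<Rightarrow> ('a, 'm) chart \<Rightarrow> ('b, 'n) chart \<Rightarrow> 'n \<Rightarrow> real^'m \<Rightarrow> real" where
  "EL \<alpha> f c d a x = (\<Sum>k\<in>UNIV. pd k (momentum \<alpha> f c d a k) x)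
    - P0 \<alpha> f c d x * M.vol c x * (\<Sum>k\<in>UNIV. \<Sum>l\<in>UNIV. matrix_inv (metric_matrix M g c x) $ k $ l *
      (\<Sum>b\<in>UNIV. \<Sum>b'\<in>UNIV. pd a (metric_matrix N h d) (local_rep c d f x) $ b $ b' *
        pd k (local_rep c d f) x $ b * pd l (local_rep c d f) x $ b'))"

context
  fixes f :: "'a \<Rightarrow> 'b" and c :: "('a, 'm) chart" and d :: "('b, 'n) chart"
  assumes f: "smooth_map M N f" and c: "c \<in> atlas M" and d: "d \<in> atlas N"
begin

lemma f_continuous: "continuous_map (topo M) (topo N) f"
  using f by (simp add: smooth_map_def)

lemma Wd_eq: "Wd f c d = snd c ` {p \<in> fst c. f p \<in> fst d}"
proof (intro equalityI subsetI)
  fix x assume "x \<in> Wd f c d"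
  then show "x \<in> snd c ` {p \<in> fst c. f p \<in> fst d}"
    using M.chart_inv_in[of x c] M.chart_inv_right[of x c]
    by (intro image_eqI[of _ _ "chart_inv c x"]) (auto simp: Wd_def)
next
  fix x assume "x \<in> snd c ` {p \<in> fst c. f p \<in> fst d}"
  then show "x \<in> Wd f c d"
    using M.chart_inv_left[OF c] M.chart_image_in[of _ c] by (auto simp: Wd_def)
qed

lemma Wd_open: "open (Wd f c d)"
proof -
  have "openin (topo M) {p \<in> topspace (topo M). f p \<in> fst d}"
    by (rule openin_continuous_map_preimage[OF f_continuous N.chart_open[OF d]])
  from M.open_chart_image[OF c this]
  have "open (snd c ` (fst c \<inter> {p \<in> topspace (topo M). f p \<in> fst d}))" .
  moreover have "fst c \<inter> {p \<in> topspace (topo M). f p \<in> fst d} = {p \<in> fst c. f p \<in> fst d}"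
    using c by (auto simp: M.topspace_eq)
  ultimately show ?thesis by (simp add: Wd_eq)
qed

lemma Wd_sub: "Wd f c d \<subseteq> chart_image c" by (auto simp: Wd_def)

lemma rep_smooth: "smooth_on (Wd f c d) (local_rep c d f)"
  using f c d unfolding Wd_eq by (simp add: smooth_map_def)

lemma rep_image: "local_rep c d f ` Wd f c d \<subseteq> chart_image d"
  by (auto simp: Wd_def local_rep_def chart_image_def)

lemma G_smooth: "smooth_on (Wd f c d) (metric_matrix M g c)"
  by (rule smooth_on_subset[OF M.metric_matrix_smooth[OF c] Wd_sub])

lemma G_det: "x \<in> Wd f c d \<Longrightarrow> det (metric_matrix M g c x) \<noteq> 0"
  using M.metric_det_pos[OF c, of x] Wd_sub by auto

lemma H_smooth: "smooth_on (Wd f c d) (\<lambda>x. metric_matrix N h d (local_rep c d f x))"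
  by (rule smooth_on_compose[OF Wd_open N.chart_image_open[OF d] N.metric_matrix_smooth[OF d] rep_smooth rep_image])

lemma dH_smooth: "smooth_on (Wd f c d) (\<lambda>x. pd a (metric_matrix N h d) (local_rep c d f x))"
  by (rule smooth_on_compose[OF Wd_open N.chart_image_open[OF d]
        smooth_on_pd[OF N.metric_matrix_smooth[OF d]] rep_smooth rep_image])

lemma e0_smooth: "smooth_on (Wd f c d) (e0 f c d)"
  unfolding e0_def[abs_def]
  by (intro smooth_intros Wd_open G_smooth H_smooth rep_smooth G_det)

lemma e0_eq:
  assumes "x \<in> Wd f c d"
  shows "e0 f c d x = (hs_norm M g N h f (chart_inv c x))\<^sup>2"
proof -
  have x: "x \<in> chart_image c" "f (chart_inv c x) \<in> fst d" using assms by (auto simp: Wd_def)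
  have cd: "c \<in> charts_at M (chart_inv c x)" "d \<in> charts_at N (f (chart_inv c x))"
    using c d x M.chart_inv_in[OF x(1)] by (auto simp: charts_at_def)
  have "local_rep c d f differentiable (at (snd c (chart_inv c x)))"
    using smooth_on_imp_differentiable[OF rep_smooth assms] M.chart_inv_right[OF x(1)] by simp
  from hs_norm_coords[OF f_continuous cd this] show ?thesis
    unfolding M.chart_inv_right[OF x(1)] e0_def by (simp add: local_rep_def)
qed

lemma e0_nonneg: "x \<in> Wd f c d \<Longrightarrow> e0 f c d x \<ge> 0"
  by (simp add: e0_eq)

lemma P0_smooth: "smooth_on (Wd f c d) (P0 \<alpha> f c d)"
  unfolding P0_def[abs_def]
  by (intro smooth_intros Wd_open e0_smooth) (use e0_nonneg in force)

lemma momentum_smooth: "smooth_on (Wd f c d) (momentum \<alpha> f c d a k)"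
  unfolding momentum_def[abs_def]
  by (intro smooth_intros Wd_open P0_smooth H_smooth G_smooth G_det rep_smooth
      smooth_on_subset[OF M.vol_smooth[OF c] Wd_sub])

lemma EL_smooth: "smooth_on (Wd f c d) (EL \<alpha> f c d a)"
  unfolding EL_def[abs_def]
  by (intro smooth_intros Wd_open P0_smooth H_smooth G_smooth G_det rep_smooth momentum_smooth dH_smooth
      smooth_on_subset[OF M.vol_smooth[OF c] Wd_sub])

end

end

section \<open>The time derivative of the energy density at time 0\<close>

context energy_variation begin

text \<open>The components of the variation field along the initial map.\<close>

definition Vf :: "('a, 'm) chart \<Rightarrow> ('b, 'n) chart \<Rightarrow> real^'m \<Rightarrow> real^'n" where
  "Vf c d x = frechet_derivative (Phi c d) (at (0, x)) (1, 0)"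

context
  fixes c :: "('a, 'm) chart" and d :: "('b, 'n) chart"
  assumes f: "smooth_map M N f" and c: "c \<in> atlas M" and d: "d \<in> atlas N"
begin

lemma F_0_chart: "x \<in> chart_image c \<Longrightarrow> F 0 (chart_inv c x) = f (chart_inv c x)"
  by (rule F_0) (use openin_subset[OF M.chart_open[OF c]] M.chart_inv_in[of x c] in blast)

lemma Wd_Om: "x \<in> Wd f c d \<Longrightarrow> (0, x) \<in> Om c d"
  using eps by (auto simp: Wd_def Om_def F_0_chart)

lemma Phi_0: "x \<in> Wd f c d \<Longrightarrow> Phi c d (0, x) = local_rep c d f x"
  by (simp add: Phi_def local_rep_def Wd_def F_0_chart)

lemma pd_rep: 
  assumes "x \<in> Wd f c d"
  shows "pd k (local_rep c d f) x = frechet_derivative (Phi c d) (at (0, x)) (0, axis k 1)"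
proof -
  have "pd k (local_rep c d f) x = pd k (local_rep c d (F 0)) x"
    by (rule pd_cong_open[OF Wd_open[OF f c d] assms]) (use Phi_0 in \<open>simp add: Phi_def\<close>)
  also have "\<dots> = frechet_derivative (Phi c d) (at (0, x)) (0, axis k 1)"
    by (rule pd_eqI[OF Phi_slice[OF c d Wd_Om[OF assms]]])
  finally show ?thesis .
qed

lemma dens_0: "x \<in> Wd f c d \<Longrightarrow> dens c d (0, x) = e0 f c d x"
  by (simp add: dens_def e0_def Phi_0 pd_rep)

lemma Vf_smooth: "smooth_on (Wd f c d) (Vf c d)"
  unfolding Vf_def[abs_def]
  by (rule smooth_on_compose[where f = "\<lambda>x. (0, x)", OF Wd_open[OF f c d] Om_open[OF c d]
        smooth_on_frechet_derivative[OF Phi_smooth[OF c d]]])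
     (auto intro: Wd_Om intro!: smooth_intros Wd_open[OF f c d])

lemma Phi_time_derivative:
  assumes "z \<in> Om c d" "smooth_on (Om c d) K"
  shows "((\<lambda>t. K (t, snd z)) has_vector_derivative frechet_derivative K (at z) (1, 0)) (at (fst z))"
proof -
  have "((\<lambda>t. (t, snd z)) has_vector_derivative (1, 0)) (at (fst z))"
    unfolding has_vector_derivative_def by (auto intro!: derivative_eq_intros)
  from has_vector_derivative_chain[OF this, of K] smooth_on_has_derivative[OF assms(2,1)]
  show ?thesis by simp
qed

text \<open>Time and space derivatives of the variation commute, so the time derivative of the
  spatial differential is the spatial differential of the variation field.\<close>

lemma pd_Vf:
  assumes "x \<in> Wd f c d"
  shows "frechet_derivative (\<lambda>z. frechet_derivative (Phi c d) (at z) (0, axis k 1)) (at (0, x)) (1, 0)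
    = pd k (Vf c d) x"
proof -
  let ?K = "\<lambda>z. frechet_derivative (Phi c d) (at z) (1, 0)"
  have "((\<lambda>x. ?K (0, x)) has_derivative (\<lambda>v. frechet_derivative ?K (at (0, x)) (0, v))) (at x)"
    by (rule has_derivative_compose[where f = "\<lambda>y. (0, y)" and g = ?K,
          OF _ smooth_on_has_derivative[OF smooth_on_frechet_derivative[OF Phi_smooth[OF c d]] Wd_Om[OF assms]]])
       (auto intro!: derivative_eq_intros)
  then have "pd k (Vf c d) x = frechet_derivative ?K (at (0, x)) (0, axis k 1)"
    unfolding Vf_def[abs_def] by (rule pd_eqI)
  then show ?thesis
    using frechet_derivative_commute[OF Om_open[OF c d] Phi_smooth[OF c d] Wd_Om[OF assms]] by simp
qed

text \<open>The outer power contributes the factor \<open>P0\<close>; the bracket is the time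
  derivative of the energy density, evaluated with the metric on M held fixed.\<close>

lemma dQ_formula:
  assumes x: "x \<in> Wd f c d"
  shows "dQ 0 (chart_inv c x) = P0 \<alpha> f c d x *
    ((\<Sum>k\<in>UNIV. \<Sum>l\<in>UNIV. matrix_inv (metric_matrix M g c x) $ k $ l * (\<Sum>a\<in>UNIV. \<Sum>b\<in>UNIV.
       (\<Sum>j\<in>UNIV. Vf c d x $ j * pd j (metric_matrix N h d) (local_rep c d f x) $ a $ b) *
         pd k (local_rep c d f) x $ a * pd l (local_rep c d f) x $ b))
    + 2 * (\<Sum>k\<in>UNIV. \<Sum>l\<in>UNIV. matrix_inv (metric_matrix M g c x) $ k $ l * (\<Sum>a\<in>UNIV. \<Sum>b\<in>UNIV.
       metric_matrix N h d (local_rep c d f x) $ a $ b * pd k (Vf c d) x $ a * pd l (local_rep c d f) x $ b)))"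
    (is "_ = P0 \<alpha> f c d x * ?R")
proof -
  let ?G = "metric_matrix M g c x" and ?H = "metric_matrix N h d"
  let ?A = "\<lambda>k t. frechet_derivative (Phi c d) (at (t, x)) (0, axis k 1)"
  note Om = Wd_Om[OF x]
  have xi: "x \<in> chart_image c" using Wd_sub[OF f c d] x by blast
  have yi: "Phi c d (0, x) \<in> chart_image d" by (rule Om_D(7)[OF c d Om])
  have Gs: "spd ?G" by (rule M.metric_matrix_spd[OF c xi])
  have Hs: "spd (?H (Phi c d (0, x)))" by (rule N.metric_matrix_spd[OF d yi])
  have "((\<lambda>t. edens ?G (?H (Phi c d (t, x))) (\<lambda>k. ?A k t)) has_real_derivative
    (\<Sum>k\<in>UNIV. \<Sum>l\<in>UNIV. matrix_inv ?G $ k $ l * (\<Sum>a\<in>UNIV. \<Sum>b\<in>UNIV.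
       (\<Sum>j\<in>UNIV. Vf c d x $ j * pd j ?H (Phi c d (0, x)) $ a $ b) * ?A k 0 $ a * ?A l 0 $ b))
    + 2 * (\<Sum>k\<in>UNIV. \<Sum>l\<in>UNIV. matrix_inv ?G $ k $ l * (\<Sum>a\<in>UNIV. \<Sum>b\<in>UNIV.
       ?H (Phi c d (0, x)) $ a $ b * pd k (Vf c d) x $ a * ?A l 0 $ b))) (at 0)"
  proof (rule edens_has_real_derivative)
    show "((\<lambda>t. Phi c d (t, x)) has_vector_derivative Vf c d x) (at 0)"
      using Phi_time_derivative[OF Om Phi_smooth[OF c d]] by (simp add: Vf_def)
    show "?H differentiable (at (Phi c d (0, x)))"
      by (rule smooth_on_imp_differentiable[OF N.metric_matrix_smooth[OF d] yi])
    show "(?A k has_vector_derivative pd k (Vf c d) x) (at 0)" for k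
      using Phi_time_derivative[OF Om smooth_on_frechet_derivative[OF Phi_smooth[OF c d]], of "(0, axis k 1)"]
      by (simp add: pd_Vf[OF x])
    show "matrix_inv ?G $ k $ l = matrix_inv ?G $ l $ k" for k l
      by (rule matrix_inv_sym[OF G_det[OF f c d x]]) (use Gs in \<open>simp add: spd_def\<close>)
    show "?H (Phi c d (0, x)) $ a $ b = ?H (Phi c d (0, x)) $ b $ a" for a b
      using Hs by (simp add: spd_def)
  qed
  then have "((\<lambda>t. dens c d (t, x)) has_real_derivative ?R) (at 0)"
    by (simp add: dens_def Phi_0[OF x] pd_rep[OF x])
  moreover have "1 + dens c d (0, x) > 0" using dens_nonneg[OF c d Om] by simp
  ultimately have 1: "((\<lambda>t. q c d (t, x)) has_real_derivative P0 \<alpha> f c d x * ?R) (at 0)"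
    unfolding q_def
    by (auto intro!: derivative_eq_intros simp: P0_def dens_0[OF x])
  have "((\<lambda>t. q c d (t, x)) has_real_derivative frechet_derivative (q c d) (at (0, x)) (1, 0)) (at 0)"
    using Phi_time_derivative[OF Om q_smooth[OF c d]]
    by (simp only: has_real_derivative_iff_has_vector_derivative fst_conv snd_conv)
  from DERIV_unique[OF this 1] show ?thesis unfolding dQ_eq[OF c d Om] .
qed

text \<open>The pointwise form of integration by parts. \<open>momentum\<close> is the coefficient
  of the derivatives of the variation field in the first variation, so the product rule trades them
  for a divergence and leaves the field undifferentiated against \<open>EL\<close>.\<close>

lemma vol_dQ:
  assumes x: "x \<in> Wd f c d"
  shows "M.vol c x * dQ 0 (chart_inv c x) =
    (\<Sum>k\<in>UNIV. pd k (\<lambda>x. \<Sum>a\<in>UNIV. momentum \<alpha> f c d a k x * Vf c d x $ a) x)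
      - (\<Sum>a\<in>UNIV. Vf c d x $ a * EL \<alpha> f c d a x)"
proof -
  let ?gi = "\<lambda>k l. matrix_inv (metric_matrix M g c x) $ k $ l" and ?F = "local_rep c d f"
  let ?H = "metric_matrix N h d"
  let ?P = "P0 \<alpha> f c d x" and ?v = "M.vol c x" and ?V = "Vf c d x"
  note smd = smooth_on_imp_differentiable[OF _ x]
  have dm: "momentum \<alpha> f c d a k differentiable (at x)" for a k by (rule smd[OF momentum_smooth[OF f c d]])
  have dV: "Vf c d differentiable (at x)" by (rule smd[OF Vf_smooth])
  have dVa: "(\<lambda>x. Vf c d x $ a) differentiable (at x)" for a
    by (rule smd) (intro smooth_intros Wd_open[OF f c d] Vf_smooth)
  have "pd k (\<lambda>x. \<Sum>a\<in>UNIV. momentum \<alpha> f c d a k x * Vf c d x $ a) x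
      = (\<Sum>a\<in>UNIV. pd k (momentum \<alpha> f c d a k) x * ?V $ a + momentum \<alpha> f c d a k x * pd k (Vf c d) x $ a)" for k
    by (subst pd_sum) (simp_all add: pd_mult[OF dm dVa] pd_nth[OF dV] differentiable_mult dm dVa)
  then have 1: "(\<Sum>k\<in>UNIV. pd k (\<lambda>x. \<Sum>a\<in>UNIV. momentum \<alpha> f c d a k x * Vf c d x $ a) x)
      = (\<Sum>k\<in>UNIV. \<Sum>a\<in>UNIV. pd k (momentum \<alpha> f c d a k) x * ?V $ a)
      + (\<Sum>k\<in>UNIV. \<Sum>a\<in>UNIV. momentum \<alpha> f c d a k x * pd k (Vf c d) x $ a)"
    by (simp add: sum.distrib)
  define S where "S j = (\<Sum>k\<in>UNIV. \<Sum>l\<in>UNIV. ?gi k l * (\<Sum>a\<in>UNIV. \<Sum>b\<in>UNIV.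
      pd j ?H (?F x) $ a $ b * pd k ?F x $ a * pd l ?F x $ b))" for j
  have "(\<Sum>a\<in>UNIV. ?V $ a * EL \<alpha> f c d a x)
      = (\<Sum>a\<in>UNIV. \<Sum>k\<in>UNIV. pd k (momentum \<alpha> f c d a k) x * ?V $ a) - (\<Sum>a\<in>UNIV. ?P * ?v * (?V $ a * S a))"
    unfolding EL_def S_def[symmetric]
    by (simp add: right_diff_distrib sum_subtractf sum_distrib_left mult_ac)
  also have "(\<Sum>a\<in>UNIV. \<Sum>k\<in>UNIV. pd k (momentum \<alpha> f c d a k) x * ?V $ a)
      = (\<Sum>k\<in>UNIV. \<Sum>a\<in>UNIV. pd k (momentum \<alpha> f c d a k) x * ?V $ a)"
    by (rule sum.swap)
  finally have 2: "(\<Sum>a\<in>UNIV. ?V $ a * EL \<alpha> f c d a x)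
      = (\<Sum>k\<in>UNIV. \<Sum>a\<in>UNIV. pd k (momentum \<alpha> f c d a k) x * ?V $ a) - ?P * ?v * (\<Sum>a\<in>UNIV. ?V $ a * S a)"
    by (simp only: sum_distrib_left)
  have "(\<Sum>a\<in>UNIV. \<Sum>b\<in>UNIV. (\<Sum>j\<in>UNIV. ?V $ j * pd j ?H (?F x) $ a $ b) * pd k ?F x $ a * pd l ?F x $ b)
      = (\<Sum>j\<in>UNIV. ?V $ j * (\<Sum>a\<in>UNIV. \<Sum>b\<in>UNIV. pd j ?H (?F x) $ a $ b * pd k ?F x $ a * pd l ?F x $ b))" for k l
    unfolding sum_distrib_left sum_distrib_right by (subst sum_rotate3[symmetric]) (simp only: mult.assoc)
  then have "(\<Sum>k\<in>UNIV. \<Sum>l\<in>UNIV. ?gi k l * (\<Sum>a\<in>UNIV. \<Sum>b\<in>UNIV.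
       (\<Sum>j\<in>UNIV. ?V $ j * pd j ?H (?F x) $ a $ b) * pd k ?F x $ a * pd l ?F x $ b))
      = (\<Sum>k\<in>UNIV. \<Sum>l\<in>UNIV. \<Sum>j\<in>UNIV. ?V $ j * (?gi k l * (\<Sum>a\<in>UNIV. \<Sum>b\<in>UNIV. pd j ?H (?F x) $ a $ b * pd k ?F x $ a * pd l ?F x $ b)))"
    by (simp only: sum_distrib_left[of "?gi _ _"] mult.left_commute)
  also have "\<dots> = (\<Sum>j\<in>UNIV. ?V $ j * S j)"
    unfolding S_def sum_distrib_left[of "?V $ _"] by (rule sum_rotate3[symmetric])
  finally have 3: "(\<Sum>k\<in>UNIV. \<Sum>l\<in>UNIV. ?gi k l * (\<Sum>a\<in>UNIV. \<Sum>b\<in>UNIV.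
       (\<Sum>j\<in>UNIV. ?V $ j * pd j ?H (?F x) $ a $ b) * pd k ?F x $ a * pd l ?F x $ b)) = (\<Sum>j\<in>UNIV. ?V $ j * S j)" .
  have 4: "(\<Sum>k\<in>UNIV. \<Sum>a\<in>UNIV. momentum \<alpha> f c d a k x * pd k (Vf c d) x $ a)
      = 2 * ?P * ?v * (\<Sum>k\<in>UNIV. \<Sum>l\<in>UNIV. ?gi k l * (\<Sum>a\<in>UNIV. \<Sum>b\<in>UNIV.
          ?H (?F x) $ a $ b * pd k (Vf c d) x $ a * pd l ?F x $ b))"
  proof -
    have "(\<Sum>a\<in>UNIV. momentum \<alpha> f c d a k x * pd k (Vf c d) x $ a)
      = 2 * ?P * ?v * (\<Sum>l\<in>UNIV. ?gi k l * (\<Sum>a\<in>UNIV. \<Sum>b\<in>UNIV.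
          ?H (?F x) $ a $ b * pd k (Vf c d) x $ a * pd l ?F x $ b))" for k
      unfolding momentum_def sum_distrib_left sum_distrib_right
      by (subst sum.swap) (simp add: mult_ac)
    then show ?thesis by (simp only: sum_distrib_left[of "2 * ?P * ?v"])
  qed
  show ?thesis unfolding dQ_formula[OF x] 1 2 3 4 by (simp add: algebra_simps)
qed

end

end

text \<open>Compactness of the ball passes to its image, and compact sets are closed in a Hausdorff
  space. Being closed in all of M, not just in the chart domain, is what later allows gluing along
  its complement.\<close>

lemma (in smooth_mfd) closedin_chart_cball:
  assumes "c \<in> atlas M" "cball a r \<subseteq> chart_image c"
  shows "closedin (topo M) (chart_inv c ` cball a r)"
proof (rule compactin_imp_closedin[OF hausdorff])
  have "compactin (top_of_set (chart_image c)) (cball a r)"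
    using assms(2) by (simp add: compactin_subtopology)
  then show "compactin (topo M) (chart_inv c ` cball a r)"
    by (rule image_compactin) (rule chart_inv_continuous[OF assms(1)])
qed

lemma (in smooth_mfd) open_chart_complement:
  assumes "c \<in> atlas M" "closedin (topo M) K"
  shows "open {x \<in> chart_image c. chart_inv c x \<notin> K}"
proof -
  have "openin (topo M) (topspace (topo M) - K)" using assms(2) by (simp add: closedin_def)
  from open_chart_image[OF assms(1) this]
  have "open (snd c ` (fst c \<inter> (topspace (topo M) - K)))" .
  also have "snd c ` (fst c \<inter> (topspace (topo M) - K)) = {x \<in> chart_image c. chart_inv c x \<notin> K}"
  proof (intro equalityI subsetI)
    fix x assume "x \<in> snd c ` (fst c \<inter> (topspace (topo M) - K))"
    then show "x \<in> {x \<in> chart_image c. chart_inv c x \<notin> K}"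
      using chart_inv_left[OF assms(1)] chart_image_in[of _ c] by auto
  next
    fix x assume "x \<in> {x \<in> chart_image c. chart_inv c x \<notin> K}"
    moreover from this have "chart_inv c x \<in> topspace (topo M)"
      using openin_subset[OF chart_open[OF assms(1)]] chart_inv_in[of x c] by auto
    ultimately show "x \<in> snd c ` (fst c \<inter> (topspace (topo M) - K))"
      using chart_inv_in[of x c] chart_inv_right[of x c] by (intro image_eqI[of _ _ "chart_inv c x"]) auto
  qed
  finally show ?thesis .
qed

lemma (in smooth_mfd) chart_inv_notin:
  assumes "c \<in> atlas M" "B \<subseteq> chart_image c" "x \<in> chart_image c" "x \<notin> B"
  shows "chart_inv c x \<notin> chart_inv c ` B"
proof
  assume "chart_inv c x \<in> chart_inv c ` B"
  then obtain y where y: "y \<in> B" "chart_inv c x = chart_inv c y" by auto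
  then have "x = y" using chart_inv_right[of x c] chart_inv_right[of y c] assms by auto
  then show False using y assms by simp
qed

context riem_pair begin

lemma Wd_charts:
  assumes "p \<in> topspace (topo M)" "c \<in> charts_at M p" "d \<in> charts_at N (f p)"
  shows "snd c p \<in> Wd f c d"
  using assms M.chart_inv_left[of c p] M.chart_image_in[of p c] by (auto simp: Wd_def charts_at_def)

lemma Wd_charts_ex:
  assumes "continuous_map (topo M) (topo N) f" "p \<in> topspace (topo M)"
  shows "\<exists>c d. c \<in> charts_at M p \<and> d \<in> charts_at N (f p)"
  using M.charts_at_ex[OF assms(2)] N.charts_at_ex[of "f p"]
    continuous_map_image_subset_topspace[OF assms(1)] assms(2) by blast

end

section \<open>First variation for variations supported in a coordinate ball\<close>

context energy_variation begin

context
  fixes c :: "('a, 'm) chart" and d :: "('b, 'n) chart" and a :: "real^'m" and r :: real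
  assumes f: "smooth_map M N f" and c: "c \<in> atlas M" and d: "d \<in> atlas N"
    and cb: "cball a r \<subseteq> Wd f c d"
    and supp: "\<And>t p. \<bar>t\<bar> < \<epsilon> \<Longrightarrow> p \<in> topspace (topo M) \<Longrightarrow> p \<notin> chart_inv c ` cball a r \<Longrightarrow> F t p = f p"
begin

lemma Vf_zero:
  assumes c': "c' \<in> atlas M" "d' \<in> atlas N" and x: "x \<in> Wd f c' d'" "chart_inv c' x \<notin> chart_inv c ` cball a r"
  shows "Vf c' d' x = 0"
proof -
  have xi: "x \<in> chart_image c'" using x by (auto simp: Wd_def)
  have p: "chart_inv c' x \<in> topspace (topo M)"
    using openin_subset[OF M.chart_open[OF c'(1)]] M.chart_inv_in[OF xi] by auto
  have "((\<lambda>t. Phi c' d' (t, x)) has_vector_derivative Vf c' d' x) (at 0)"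
    using Phi_time_derivative[OF f c' Wd_Om[OF f c' x(1)] Phi_smooth[OF c']] by (simp add: Vf_def)
  moreover have "((\<lambda>t. Phi c' d' (t, x)) has_vector_derivative 0) (at 0)"
  proof (rule has_vector_derivative_transform_within_open[of "\<lambda>t. snd d' (f (chart_inv c' x))" 0 0 "{-\<epsilon><..<\<epsilon>}"])
    fix t assume "t \<in> {-\<epsilon><..<\<epsilon>}"
    then have "\<bar>t\<bar> < \<epsilon>" by auto
    from supp[OF this p x(2)] show "snd d' (f (chart_inv c' x)) = Phi c' d' (t, x)"
      by (simp add: Phi_def local_rep_def)
  qed (use eps in auto)
  ultimately show ?thesis by (rule vector_derivative_unique_at)
qed

text \<open>The energy density sees spatial derivatives of the variation field, so vanishing at the
  point alone would not suffice; the complement of the support is open, and the field vanishes on a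
  neighbourhood.\<close>

lemma dQ_zero:
  assumes p: "p \<in> topspace (topo M)" "p \<notin> chart_inv c ` cball a r"
  shows "dQ 0 p = 0"
proof -
  let ?K = "chart_inv c ` cball a r"
  obtain c' d' where cd: "c' \<in> charts_at M p" "d' \<in> charts_at N (f p)"
    using Wd_charts_ex[OF f_continuous[OF f c d] p(1)] by blast
  note at = M.charts_atD(1)[OF cd(1)] N.charts_atD(1)[OF cd(2)]
  have x: "snd c' p \<in> Wd f c' d'" by (rule Wd_charts[where f = f, OF p(1) cd])
  have inv: "chart_inv c' (snd c' p) = p" by (rule M.chart_inv_left[OF M.charts_atD[OF cd(1)]])
  have K: "closedin (topo M) ?K"
    by (rule M.closedin_chart_cball[OF c]) (use cb Wd_sub[OF f c d] in blast)
  define U where "U = Wd f c' d' \<inter> {x \<in> chart_image c'. chart_inv c' x \<notin> ?K}"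
  have U: "open U" unfolding U_def by (intro open_Int Wd_open[OF f at] M.open_chart_complement at K)
  have xU: "snd c' p \<in> U" using x p(2) inv Wd_sub[OF f at] by (auto simp: U_def)
  have V0: "Vf c' d' y = 0" if "y \<in> U" for y using Vf_zero[OF at] that by (auto simp: U_def)
  have "pd k (Vf c' d') (snd c' p) = pd k (\<lambda>_. 0) (snd c' p)" for k
    by (rule pd_cong_open[OF U xU V0])
  then have "pd k (Vf c' d') (snd c' p) = 0" for k by (simp add: pd_const)
  then show ?thesis using dQ_formula[OF f at x] V0[OF xU] unfolding inv by simp
qed

lemma first_variation_local:
  "(\<integral>p. dQ 0 p \<partial>M.\<mu>) =
    - (\<integral>x. (if x \<in> Wd f c d then \<Sum>b\<in>UNIV. Vf c d x $ b * EL \<alpha> f c d b x else 0) \<partial>lborel)"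
proof -
  let ?W = "Wd f c d" and ?K = "chart_inv c ` cball a r"
  have sub: "cball a r \<subseteq> chart_image c" using cb Wd_sub[OF f c d] by blast
  have V0: "Vf c d x = 0" if "x \<in> ?W" "x \<notin> cball a r" for x
    using Vf_zero[OF c d that(1)] M.chart_inv_notin[OF c sub _ that(2)] Wd_sub[OF f c d] that(1) by blast
  note Wo = Wd_open[OF f c d]
  \<comment> \<open>The coordinate expressions exist on \<open>Wd\<close> only. Extended by zero
    they become smooth with compact support on the whole space, as the integration by parts
    requires.\<close>
  define X where "X k x = (if x \<in> ?W then \<Sum>b\<in>UNIV. momentum \<alpha> f c d b k x * Vf c d x $ b else 0)" for k x
  define Y where "Y x = (if x \<in> ?W then \<Sum>b\<in>UNIV. Vf c d x $ b * EL \<alpha> f c d b x else 0)" for x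
  have Xs: "smooth_on UNIV (X k)" for k unfolding X_def[abs_def]
    by (rule smooth_on_zero_extension[OF Wo cb])
       (auto intro!: smooth_intros Wo momentum_smooth[OF f c d] Vf_smooth[OF f c d] simp: V0)
  have Ys: "smooth_on UNIV Y" unfolding Y_def[abs_def]
    by (rule smooth_on_zero_extension[OF Wo cb])
       (auto intro!: smooth_intros Wo EL_smooth[OF f c d] Vf_smooth[OF f c d] simp: V0)
  have X0: "X k x = 0" if "x \<notin> cball a r" for k x using V0[OF _ that] by (simp add: X_def)
  have Y0: "Y x = 0" if "x \<notin> cball a r" for x using V0[OF _ that] by (simp add: Y_def)
  have pX0: "pd k (X k) x = 0" if "x \<notin> cball a r" for k x
  proof -
    have "pd k (X k) x = pd k (\<lambda>_. 0) x"
      by (rule pd_cong_open[of "- cball a r"]) (use that X0 in auto)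
    then show ?thesis by (simp add: pd_const)
  qed
  have eq: "M.vol c x * dQ 0 (chart_inv c x) = (\<Sum>k\<in>UNIV. pd k (X k) x) - Y x" for x
  proof (cases "x \<in> ?W")
    case True
    have "pd k (X k) x = pd k (\<lambda>x. \<Sum>b\<in>UNIV. momentum \<alpha> f c d b k x * Vf c d x $ b) x" for k
      by (rule pd_cong_open[OF Wo True]) (simp add: X_def)
    then show ?thesis using vol_dQ[OF f c d True] True by (simp add: Y_def)
  next
    case False
    then have nc: "x \<notin> cball a r" using cb by blast
    \<comment> \<open>Outside the chart image \<open>chart_inv\<close> is arbitrary and the equation
      rests on \<open>vol\<close> being 0; inside the image but off the ball it rests on
      \<open>dQ_zero\<close>.\<close>
    have "M.vol c x * dQ 0 (chart_inv c x) = 0"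
    proof (cases "x \<in> chart_image c")
      case True
      have "chart_inv c x \<in> topspace (topo M)"
        using openin_subset[OF M.chart_open[OF c]] M.chart_inv_in[OF True] by auto
      then show ?thesis using dQ_zero[OF _ M.chart_inv_notin[OF c sub True nc]] by simp
    qed (simp add: M.vol_def)
    then show ?thesis using pX0[OF nc] Y0[OF nc] by simp
  qed
  have iX: "integrable lborel (pd k (X k))" for k
    by (rule integrable_compact_support[OF _ pX0]) (rule smooth_on_imp_continuous_on[OF smooth_on_pd[OF Xs]])
  have zX: "(\<integral>x. pd k (X k) x \<partial>lborel) = 0" for k
    by (rule integral_pd_eq_0[OF smooth_on_imp_differentiable[OF Xs]
          smooth_on_imp_continuous_on[OF smooth_on_pd[OF Xs]] X0]) simp
  have iY: "integrable lborel Y"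
    by (rule integrable_compact_support[OF _ Y0]) (rule smooth_on_imp_continuous_on[OF Ys])
  have "(\<integral>p. dQ 0 p \<partial>M.\<mu>) = (\<integral>x. M.vol c x * dQ 0 (chart_inv c x) \<partial>lborel)"
  proof (rule M.integral_mu_chart[OF compact c])
    show "dQ 0 \<in> borel_measurable M.borel_M"
      by (rule M.continuous_map_borel_M[OF dQ_continuous]) (use eps in simp)
    fix p assume "p \<in> topspace (topo M)" "p \<notin> fst c"
    then show "dQ 0 p = 0" using sub M.chart_inv_in[of _ c] by (intro dQ_zero) auto
  qed
  also have "\<dots> = (\<integral>x. (\<Sum>k\<in>UNIV. pd k (X k) x) - Y x \<partial>lborel)" by (simp only: eq)
  also have "\<dots> = (\<Sum>k\<in>UNIV. \<integral>x. pd k (X k) x \<partial>lborel) - (\<integral>x. Y x \<partial>lborel)"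
    using iX iY by (simp add: Bochner_Integration.integral_diff Bochner_Integration.integral_sum)
  finally show ?thesis by (simp add: zX Y_def)
qed

end

end

section \<open>The Euler--Lagrange expression and the conformal tension field\<close>

lemma det_scaleR_matrix:
  fixes A :: "real^'n^'n"
  shows "det (r *\<^sub>R A) = r ^ CARD('n) * det A"
  by (simp add: det_def prod.distrib sum_distrib_left mult_ac)

context riem_pair begin

definition conf :: "real \<Rightarrow> ('a \<Rightarrow> 'b) \<Rightarrow> 'a \<Rightarrow> real" where
  "conf \<alpha> f p = (2 * \<alpha>) powr (2 / (real CARD('m) - 2)) *
     (1 + (hs_norm M g N h f p)\<^sup>2) powr ((2 * \<alpha> - 2) / (real CARD('m) - 2))"

abbreviation conf_metric :: "real \<Rightarrow> ('a \<Rightarrow> 'b) \<Rightarrow> ('a, 'm) metric" where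
  "conf_metric \<alpha> f \<equiv> \<lambda>p u v. conf \<alpha> f p * g p u v"

lemma conf_metric_matrix:
  "metric_matrix M (conf_metric \<alpha> f) c x = conf \<alpha> f (chart_inv c x) *\<^sub>R metric_matrix M g c x"
  by (simp add: metric_matrix_def Let_def vec_eq_iff)

context
  fixes \<alpha> :: real and f :: "'a \<Rightarrow> 'b" and c :: "('a, 'm) chart" and d :: "('b, 'n) chart"
  assumes \<alpha>: "\<alpha> > 1" and dim: "CARD('m) > 2"
    and f: "smooth_map M N f" and c: "c \<in> atlas M" and d: "d \<in> atlas N"
begin

lemma conf_pos: "conf \<alpha> f p > 0"
proof -
  have "1 + (hs_norm M g N h f p)\<^sup>2 > 0" by (simp add: add_pos_nonneg)
  then show ?thesis using \<alpha> by (simp add: conf_def)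
qed

text \<open>The conformal factor is chosen such that its power \<open>(m - 2) / 2\<close>, which is how
  \<open>\<surd>g g\<^sup>k\<^sup>l\<close> scales, is the weight \<open>2\<alpha>(1 + |df|\<^sup>2)\<^bsup>\<alpha>-1\<^esup>\<close>.\<close>

lemma sqrt_det_conf:
  assumes x: "x \<in> Wd f c d"
  shows "sqrt (det (metric_matrix M (conf_metric \<alpha> f) c x)) * matrix_inv (metric_matrix M (conf_metric \<alpha> f) c x) $ k $ l
    = 2 * P0 \<alpha> f c d x * M.vol c x * matrix_inv (metric_matrix M g c x) $ k $ l"
proof -
  let ?m = "real CARD('m)" and ?p = "chart_inv c x" and ?G = "metric_matrix M g c x"
  define A where "A = 2 * P0 \<alpha> f c d x"
  define C where "C = conf \<alpha> f ?p"
  have e: "1 + e0 f c d x > 0" using e0_nonneg[OF f c d x] by simp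
  have A: "A = (2 * \<alpha>) * (1 + e0 f c d x) powr (\<alpha> - 1)" by (simp add: A_def P0_def)
  have A0: "A > 0" unfolding A using \<alpha> e by simp
  have m2: "?m - 2 > 0" using dim by simp
  have C: "C = A powr (2 / (?m - 2))"
    unfolding A C_def conf_def e0_eq[OF f c d x, symmetric] using \<alpha> e
    by (simp add: powr_mult powr_powr algebra_simps)
  have C0: "C > 0" unfolding C using A0 by simp
  have xi: "x \<in> chart_image c" using x by (auto simp: Wd_def)
  have dG: "det ?G > 0" by (rule M.metric_det_pos[OF c xi])
  have "sqrt (C ^ CARD('m)) / C = C powr (?m / 2) / C powr 1"
    using C0 by (simp add: powr_half_sqrt[symmetric] powr_realpow[symmetric] powr_powr)
  also have "\<dots> = C powr (?m / 2 - 1)" by (rule powr_diff[symmetric])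
  also have "?m / 2 - 1 = (?m - 2) / 2" by (simp add: field_simps)
  \<comment> \<open>The exponent 2 / (m - 2) of the conformal factor is undone exactly here, which
    requires m - 2 to be nonzero.\<close>
  also have "C powr ((?m - 2) / 2) = A"
  proof -
    have "2 / (?m - 2) * ((?m - 2) / 2) = 1" using m2 by simp
    then show ?thesis unfolding C powr_powr using A0 by (simp only: powr_one)
  qed
  finally have CA: "sqrt (C ^ CARD('m)) / C = A" .
  have "sqrt (det (C *\<^sub>R ?G)) * matrix_inv (C *\<^sub>R ?G) $ k $ l
      = (sqrt (C ^ CARD('m)) / C) * sqrt (det ?G) * matrix_inv ?G $ k $ l"
    using C0 dG by (simp add: det_scaleR_matrix real_sqrt_mult matrix_inv_scaleR)
  then show ?thesis unfolding conf_metric_matrix C_def[symmetric] CA using xi by (simp add: A_def M.vol_def)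
qed

lemma EL_eq_tension:
  assumes x: "x \<in> Wd f c d"
  shows "EL \<alpha> f c d a x = sqrt (det (metric_matrix M (conf_metric \<alpha> f) c x)) *
    (\<Sum>b\<in>UNIV. metric_matrix N h d (local_rep c d f x) $ a $ b * tension_field M (conf_metric \<alpha> f) N h c d f x $ b)"
proof -
  let ?W = "Wd f c d" and ?B = "metric_matrix M (conf_metric \<alpha> f) c" and ?H = "metric_matrix N h d"
  let ?F = "local_rep c d f"
  note Wo = Wd_open[OF f c d]
  \<comment> \<open>\<open>conf\<close> is a function on the manifold; rewriting the norm as
    \<open>e0\<close> exposes a coordinate expression known to be smooth.\<close>
  have B_eq: "?B y = ((2 * \<alpha>) powr (2 / (real CARD('m) - 2)) *
     (1 + e0 f c d y) powr ((2 * \<alpha> - 2) / (real CARD('m) - 2))) *\<^sub>R metric_matrix M g c y" if "y \<in> ?W" for y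
    by (simp only: conf_metric_matrix) (simp only: conf_def e0_eq[OF f c d that])
  have e: "1 + e0 f c d y > 0" if "y \<in> ?W" for y using e0_nonneg[OF f c d that] by simp
  have Bs: "smooth_on ?W ?B"
    by (subst smooth_on_cong[OF Wo B_eq], assumption)
       (intro smooth_intros Wo e0_smooth[OF f c d] G_smooth[OF f c d] e)
  have Bspd: "spd (?B y)" if "y \<in> ?W" for y
    unfolding conf_metric_matrix using that Wd_sub[OF f c d]
    by (intro spd_scaleR conf_pos M.metric_matrix_spd[OF c]) auto
  have Fx: "?F x \<in> chart_image d" using rep_image[OF f c d] x by blast
  have "(\<Sum>k\<in>UNIV. pd k (\<lambda>y. \<Sum>l\<in>UNIV. (sqrt (det (?B y)) * matrix_inv (?B y) $ k $ l) *
        (\<Sum>b\<in>UNIV. ?H (?F y) $ a $ b * pd l ?F y $ b)) x)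
      - sqrt (det (?B x)) / 2 * (\<Sum>k\<in>UNIV. \<Sum>l\<in>UNIV. matrix_inv (?B x) $ k $ l *
        (\<Sum>b\<in>UNIV. \<Sum>b'\<in>UNIV. pd a ?H (?F x) $ b $ b' * pd k ?F x $ b * pd l ?F x $ b'))
    = sqrt (det (?B x)) * (\<Sum>b\<in>UNIV. ?H (?F x) $ a $ b * tens ?B ?H ?F x $ b)"
    by (rule tension_divergence[OF Wo x N.chart_image_open[OF d] Fx Bs Bspd
          N.metric_matrix_smooth[OF d] N.metric_matrix_spd[OF d] rep_smooth[OF f c d]])
  moreover have "pd k (\<lambda>y. \<Sum>l\<in>UNIV. (sqrt (det (?B y)) * matrix_inv (?B y) $ k $ l) *
        (\<Sum>b\<in>UNIV. ?H (?F y) $ a $ b * pd l ?F y $ b)) x = pd k (momentum \<alpha> f c d a k) x" for k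
    by (rule pd_cong_open[OF Wo x]) (simp only: momentum_def sqrt_det_conf)
  \<comment> \<open>\<open>P0\<close> is half of the weight, which matches the factor 1/2 in the
    zero-order term of the unweighted expression for the new metric.\<close>
  moreover have "sqrt (det (?B x)) / 2 * (\<Sum>k\<in>UNIV. \<Sum>l\<in>UNIV. matrix_inv (?B x) $ k $ l * Z k l)
      = P0 \<alpha> f c d x * M.vol c x * (\<Sum>k\<in>UNIV. \<Sum>l\<in>UNIV. matrix_inv (metric_matrix M g c x) $ k $ l * Z k l)"
    for Z :: "'m \<Rightarrow> 'm \<Rightarrow> real"
  proof -
    have "sqrt (det (?B x)) / 2 * (matrix_inv (?B x) $ k $ l * Z k l)
        = P0 \<alpha> f c d x * M.vol c x * (matrix_inv (metric_matrix M g c x) $ k $ l * Z k l)" for k l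
    proof -
      have "sqrt (det (?B x)) / 2 * (matrix_inv (?B x) $ k $ l * Z k l)
          = (sqrt (det (?B x)) * matrix_inv (?B x) $ k $ l) * Z k l / 2" by simp
      then show ?thesis unfolding sqrt_det_conf[OF x] by simp
    qed
    then show ?thesis by (simp only: sum_distrib_left)
  qed
  ultimately show ?thesis unfolding EL_def tension_field_eq_tens by simp
qed

text \<open>\<open>EL\<close> is the tension field with its index lowered by a positive definite
  matrix and multiplied by a positive density, an injective operation.\<close>

lemma EL_zero_iff:
  assumes x: "x \<in> Wd f c d"
  shows "(\<forall>a. EL \<alpha> f c d a x = 0) \<longleftrightarrow> tension_field M (conf_metric \<alpha> f) N h c d f x = 0"
proof
  let ?T = "tension_field M (conf_metric \<alpha> f) N h c d f x" and ?H = "metric_matrix N h d (local_rep c d f x)"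
  assume 0: "\<forall>a. EL \<alpha> f c d a x = 0"
  have "spd (metric_matrix M (conf_metric \<alpha> f) c x)"
    unfolding conf_metric_matrix using x Wd_sub[OF f c d]
    by (intro spd_scaleR conf_pos M.metric_matrix_spd[OF c]) auto
  then have "sqrt (det (metric_matrix M (conf_metric \<alpha> f) c x)) \<noteq> 0" using spd_det_pos by fastforce
  then have "(\<Sum>b\<in>UNIV. ?H $ a $ b * ?T $ b) = 0" for a using 0 EL_eq_tension[OF x, of a] by simp
  then have HT: "?H *v ?T = 0" by (simp add: matrix_vector_mult_def vec_eq_iff)
  have H: "spd ?H" by (rule N.metric_matrix_spd[OF d]) (use rep_image[OF f c d] x in blast)
  show "?T = 0"
  proof (rule ccontr)
    assume "?T \<noteq> 0"
    then have "?T \<bullet> (?H *v ?T) > 0" using H unfolding spd_def by simp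
    then show False unfolding HT by simp
  qed
qed (simp add: EL_eq_tension[OF x])

end

lemma harmonic_iff_EL:
  assumes "\<alpha> > 1" "CARD('m) > 2" "smooth_map M N f"
  shows "harmonic M (conf_metric \<alpha> f) N h f \<longleftrightarrow>
    (\<forall>c\<in>atlas M. \<forall>d\<in>atlas N. \<forall>x\<in>Wd f c d. \<forall>a. EL \<alpha> f c d a x = 0)"
proof
  assume H: "harmonic M (conf_metric \<alpha> f) N h f"
  show "\<forall>c\<in>atlas M. \<forall>d\<in>atlas N. \<forall>x\<in>Wd f c d. \<forall>a. EL \<alpha> f c d a x = 0"
  proof (intro ballI)
    fix c d x assume cd: "c \<in> atlas M" "d \<in> atlas N" and x: "x \<in> Wd f c d"
    have xi: "x \<in> chart_image c" "f (chart_inv c x) \<in> fst d" using x by (auto simp: Wd_def)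
    have "chart_inv c x \<in> topspace (topo M)"
      using openin_subset[OF M.chart_open[OF cd(1)]] M.chart_inv_in[OF xi(1)] by auto
    moreover have "c \<in> charts_at M (chart_inv c x)" "d \<in> charts_at N (f (chart_inv c x))"
      using cd xi M.chart_inv_in[OF xi(1)] by (auto simp: charts_at_def)
    ultimately have "tension_field M (conf_metric \<alpha> f) N h c d f (snd c (chart_inv c x)) = 0"
      using H unfolding harmonic_def by blast
    then show "\<forall>a. EL \<alpha> f c d a x = 0"
      unfolding EL_zero_iff[OF assms cd x] M.chart_inv_right[OF xi(1)] .
  qed
next
  assume E: "\<forall>c\<in>atlas M. \<forall>d\<in>atlas N. \<forall>x\<in>Wd f c d. \<forall>a. EL \<alpha> f c d a x = 0"
  show "harmonic M (conf_metric \<alpha> f) N h f"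
    unfolding harmonic_def
  proof (intro ballI)
    fix p c d assume p: "p \<in> topspace (topo M)" and c: "c \<in> charts_at M p" and d: "d \<in> charts_at N (f p)"
    show "tension_field M (conf_metric \<alpha> f) N h c d f (snd c p) = 0"
      unfolding EL_zero_iff[OF assms M.charts_atD(1)[OF c] N.charts_atD(1)[OF d] Wd_charts[where f = f, OF p c d], symmetric]
      using E Wd_charts[where f = f, OF p c d] M.charts_atD(1)[OF c] N.charts_atD(1)[OF d] by blast
  qed
qed

end

section \<open>Partitions of unity\<close>

context smooth_mfd begin

definition smooth_fun :: "('a \<Rightarrow> real) \<Rightarrow> bool" where
  "smooth_fun \<rho> \<longleftrightarrow> (\<forall>c\<in>atlas M. smooth_on (chart_image c) (\<lambda>x. \<rho> (chart_inv c x)))"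

lemma smooth_fun_continuous: "smooth_fun \<rho> \<Longrightarrow> continuous_map (topo M) euclidean \<rho>"
proof (rule continuous_map_charts)
  fix p assume \<rho>: "smooth_fun \<rho>" and "p \<in> topspace (topo M)"
  then obtain c where c: "c \<in> charts_at M p" using charts_at_ex by blast
  have ca: "c \<in> atlas M" "p \<in> fst c" using charts_atD[OF c] by auto
  have "continuous_on (chart_image c) (\<lambda>x. \<rho> (chart_inv c x))"
    using \<rho> ca(1) smooth_on_imp_continuous_on by (auto simp: smooth_fun_def)
  then show "\<exists>c\<in>charts_at M p. \<exists>V. open V \<and> snd c p \<in> V \<and> V \<subseteq> chart_image c \<and>
      continuous_on V (\<lambda>x. \<rho> (chart_inv c x))"
    using c chart_image_open[OF ca(1)] chart_image_in[OF ca(2)]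
    by (intro bexI[of _ c] exI[of _ "chart_image c"]) auto
qed

definition chart_bump :: "('a, 'm) chart \<Rightarrow> real^'m \<Rightarrow> real \<Rightarrow> 'a \<Rightarrow> real" where
  "chart_bump c a r p = (if p \<in> fst c then ball_bump a r (snd c p) else 0)"

lemma chart_bump_nonneg: "chart_bump c a r p \<ge> 0"
  by (simp add: chart_bump_def ball_bump_nonneg)

lemma chart_inv_in_topspace: "c \<in> atlas M \<Longrightarrow> x \<in> chart_image c \<Longrightarrow> chart_inv c x \<in> topspace (topo M)"
  using openin_subset[OF chart_open[of c]] chart_inv_in[of x c] by auto

context
  fixes c :: "('a, 'm) chart" and a :: "real^'m" and r :: real
  assumes c: "c \<in> atlas M" and sub: "cball a r \<subseteq> chart_image c" and r: "r > 0"
begin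

lemma chart_bump_zero:
  assumes "p \<notin> chart_inv c ` cball a r" shows "chart_bump c a r p = 0"
proof (cases "p \<in> fst c")
  case True
  have "snd c p \<notin> ball a r"
  proof
    assume "snd c p \<in> ball a r"
    then have "p \<in> chart_inv c ` cball a r"
      using chart_inv_left[OF c True] by (intro image_eqI[of _ _ "snd c p"]) auto
    then show False using assms by contradiction
  qed
  then show ?thesis by (simp add: chart_bump_def ball_bump_eq_0[OF r])
qed (simp add: chart_bump_def)

lemma chart_bump_pos: 
  assumes "p \<in> chart_inv c ` ball a r" shows "chart_bump c a r p > 0"
proof -
  obtain x where x: "x \<in> ball a r" "p = chart_inv c x" using assms by auto
  have xi: "x \<in> chart_image c" using x sub ball_subset_cball by blast
  show ?thesis unfolding chart_bump_def x(2) chart_inv_right[OF xi]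
    using chart_inv_in[OF xi] ball_bump_pos_iff[OF r, of a x] x(1) by simp
qed

lemma chart_bump_smooth: "smooth_fun (chart_bump c a r)"
  unfolding smooth_fun_def
proof (intro ballI smooth_on_locally)
  fix c' x assume c': "c' \<in> atlas M" and x: "x \<in> chart_image c'"
  show "\<exists>U. open U \<and> x \<in> U \<and> smooth_on U (\<lambda>x. chart_bump c a r (chart_inv c' x))"
  proof (cases "chart_inv c' x \<in> fst c")
    case True
    let ?U = "snd c' ` (fst c' \<inter> fst c)"
    have U: "open ?U" by (rule open_overlap[OF c' c])
    have xU: "x \<in> ?U" using overlap_image[OF c'] x True by blast
    have "smooth_on ?U (\<lambda>x. ball_bump a r (snd c (chart_inv c' x)))"
      by (rule smooth_on_compose[OF U _ smooth_on_ball_bump smooth_transition[OF c' c, simplified]]) auto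
    moreover have "chart_bump c a r (chart_inv c' y) = ball_bump a r (snd c (chart_inv c' y))" if "y \<in> ?U" for y
      using that by (simp add: chart_bump_def overlap_image[OF c'])
    ultimately have "smooth_on ?U (\<lambda>x. chart_bump c a r (chart_inv c' x))"
      using smooth_on_cong[OF U, of "\<lambda>x. chart_bump c a r (chart_inv c' x)"] by simp
    then show ?thesis using U xU by blast
  next
    \<comment> \<open>Points outside the domain of \<open>c\<close> may be limits of points inside
      it. The image of the closed ball is closed in M, so its complement is a neighbourhood on which
      the bump is zero.\<close>
    case False
    let ?K = "chart_inv c ` cball a r" and ?U = "{x \<in> chart_image c'. chart_inv c' x \<notin> chart_inv c ` cball a r}"
    have U: "open ?U" by (rule open_chart_complement[OF c' closedin_chart_cball[OF c sub]])
    have "?K \<subseteq> fst c" using sub chart_inv_in[of _ c] by auto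
    then have xU: "x \<in> ?U" using False x by auto
    have "smooth_on ?U (\<lambda>x. chart_bump c a r (chart_inv c' x))"
      using smooth_on_cong[OF U, of "\<lambda>x. chart_bump c a r (chart_inv c' x)" "\<lambda>_. 0"] smooth_on_const[OF U, of 0]
        chart_bump_zero by simp
    then show ?thesis using U xU by blast
  qed
qed

end

end

text \<open>The first variation of the energy density as a linear function of the variation field \<open>v\<close>
  and of its derivatives \<open>dv\<close>.\<close>

definition variation_form :: "real^'m^'m \<Rightarrow> real^'n^'n \<Rightarrow> ('n \<Rightarrow> real^'n^'n) \<Rightarrow> ('m \<Rightarrow> real^'n) \<Rightarrow>
    real^'n \<Rightarrow> ('m \<Rightarrow> real^'n) \<Rightarrow> real" where
  "variation_form G H dH A v dv =
    (\<Sum>k\<in>UNIV. \<Sum>l\<in>UNIV. matrix_inv G $ k $ l * (\<Sum>a\<in>UNIV. \<Sum>b\<in>UNIV.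
       (\<Sum>j\<in>UNIV. v $ j * dH j $ a $ b) * A k $ a * A l $ b))
    + 2 * (\<Sum>k\<in>UNIV. \<Sum>l\<in>UNIV. matrix_inv G $ k $ l * (\<Sum>a\<in>UNIV. \<Sum>b\<in>UNIV.
       H $ a $ b * dv k $ a * A l $ b))"

lemma variation_form_add:
  "variation_form G H dH A (v + w) (\<lambda>k. dv k + dw k) = variation_form G H dH A v dv + variation_form G H dH A w dw"
  unfolding variation_form_def vector_add_component
  by (simp only: distrib_left distrib_right sum.distrib)

lemma variation_form_sum:
  "finite J \<Longrightarrow> variation_form G H dH A (\<Sum>i\<in>J. v i) (\<lambda>k. \<Sum>i\<in>J. dv i k) = (\<Sum>i\<in>J. variation_form G H dH A (v i) (dv i))"
proof (induction J rule: finite_induct)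
  case empty
  then show ?case by (simp add: variation_form_def)
next
  case (insert i J)
  then show ?case using variation_form_add[of G H dH A "v i" "\<Sum>i\<in>J. v i" "dv i" "\<lambda>k. \<Sum>i\<in>J. dv i k"] by simp
qed

section \<open>Localization by rescaling time\<close>

context energy_variation begin

lemma dQ_variation_form:
  assumes "smooth_map M N f" "c \<in> atlas M" "d \<in> atlas N" "x \<in> Wd f c d"
  shows "dQ 0 (chart_inv c x) = P0 \<alpha> f c d x * variation_form (metric_matrix M g c x)
    (metric_matrix N h d (local_rep c d f x)) (\<lambda>j. pd j (metric_matrix N h d) (local_rep c d f x))
    (\<lambda>k. pd k (local_rep c d f) x) (Vf c d x) (\<lambda>k. pd k (Vf c d) x)"
  unfolding variation_form_def by (rule dQ_formula[OF assms])

lemma dQ_integrable: "integrable M.\<mu> (dQ 0)"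
proof -
  interpret mu: finite_measure "M.\<mu>" by (rule M.finite_measure_mu[OF compact])
  have c: "continuous_map (topo M) euclidean (dQ 0)" by (rule dQ_continuous) (use eps in simp)
  obtain B where "\<forall>p\<in>topspace (topo M). \<bar>dQ 0 p\<bar> \<le> B"
    using M.continuous_map_bounded[OF compact c] by blast
  moreover have "dQ 0 \<in> borel_measurable M.\<mu>"
    by (rule M.measurable_mu[OF compact M.continuous_map_borel_M[OF c]])
  ultimately show ?thesis
    by (intro mu.integrable_const_bound[where B = B]) (auto simp: M.space_mu[OF compact])
qed

text \<open>Slowing down time by a function \<open>\<rho>\<close> on \<open>M\<close> multiplies the variation field by \<open>\<rho>\<close>. This localizes a
  variation without having to establish chart independence of any term of the first variation.\<close>

context
  fixes \<rho> :: "'a \<Rightarrow> real"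
  assumes \<rho>: "M.smooth_fun \<rho>" and \<rho>01: "\<And>p. p \<in> topspace (topo M) \<Longrightarrow> 0 \<le> \<rho> p \<and> \<rho> p \<le> 1"
begin

text \<open>Values of \<rho> in the unit interval only shorten times, so the rescaled variation
  lives on the same interval.\<close>

lemma rescaled_time: 
  assumes "t \<in> {-\<epsilon><..<\<epsilon>}" "p \<in> topspace (topo M)" shows "t * \<rho> p \<in> {-\<epsilon><..<\<epsilon>}"
proof -
  have "\<bar>t * \<rho> p\<bar> \<le> \<bar>t\<bar> * 1" unfolding abs_mult using \<rho>01[OF assms(2)] by (intro mult_left_mono) auto
  then show ?thesis using assms(1) by auto
qed

lemma rescaled_variation: "energy_variation M g N h f \<epsilon> (\<lambda>t p. F (t * \<rho> p) p)"
proof (unfold_locales)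
  show "smooth_variation M N f \<epsilon> (\<lambda>t p. F (t * \<rho> p) p)"
    unfolding smooth_variation_def
  proof (intro conjI ballI)
    let ?X = "prod_topology (top_of_set {-\<epsilon><..<\<epsilon>}) (topo M)"
    have 1: "continuous_map ?X euclideanreal fst"
      using continuous_map_fst[of "top_of_set {-\<epsilon><..<\<epsilon>}" "topo M"] by (simp add: continuous_map_in_subtopology)
    have 2: "continuous_map ?X euclideanreal (\<lambda>z. \<rho> (snd z))"
      using continuous_map_compose[OF continuous_map_snd M.smooth_fun_continuous[OF \<rho>]] by (simp add: o_def)
    have "continuous_map ?X euclideanreal (\<lambda>z. fst z * \<rho> (snd z))"
      by (rule continuous_map_real_mult[OF 1 2])
    then have "continuous_map ?X (top_of_set {-\<epsilon><..<\<epsilon>}) (\<lambda>z. fst z * \<rho> (snd z))"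
      using rescaled_time by (auto simp: continuous_map_in_subtopology)
    then have "continuous_map ?X ?X (\<lambda>z. (fst z * \<rho> (snd z), snd z))"
      by (intro continuous_map_pairedI continuous_map_snd)
    from continuous_map_compose[OF this F_continuous_product]
    show "continuous_map ?X (topo N) (\<lambda>(t, p). F (t * \<rho> p) p)" by (simp add: o_def case_prod_unfold)
  next
    fix c d assume c: "c \<in> atlas M" and d: "d \<in> atlas N"
    let ?I = "{-\<epsilon><..<\<epsilon>} \<times> chart_image c"
    let ?\<psi> = "\<lambda>z. (fst z * \<rho> (chart_inv c (snd z)), snd z)"
    let ?D = "{(t, x). t \<in> {-\<epsilon><..<\<epsilon>} \<and> x \<in> chart_image c \<and> F (t * \<rho> (chart_inv c x)) (chart_inv c x) \<in> fst d}"
    have I: "open ?I" using M.chart_image_open[OF c] by (intro open_Times) auto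
    have "smooth_on ?I (\<lambda>z. \<rho> (chart_inv c (snd z)))"
      by (rule smooth_on_compose[where f = snd and g = "\<lambda>x. \<rho> (chart_inv c x)",
            OF I M.chart_image_open[OF c]])
         (use \<rho> c in \<open>auto simp: M.smooth_fun_def intro!: smooth_on_bounded_linear bounded_linear_snd I\<close>)
    then have \<psi>: "smooth_on ?I ?\<psi>"
      by (intro smooth_intros I smooth_on_bounded_linear[OF bounded_linear_fst] smooth_on_bounded_linear[OF bounded_linear_snd])
    have D: "?D = ?\<psi> -` Om c d \<inter> ?I"
      using rescaled_time[OF _ M.chart_inv_in_topspace[OF c]] by (auto simp: Om_def)
    have Do: "open ?D" unfolding D
      by (rule continuous_on_open_vimage[OF I, THEN iffD1, OF smooth_on_imp_continuous_on[OF \<psi>], rule_format])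
         (rule Om_open[OF c d])
    have "?D \<subseteq> ?I" "?\<psi> ` ?D \<subseteq> Om c d" unfolding D by auto
    then have "smooth_on ?D (\<lambda>z. Phi c d (?\<psi> z))"
      by (intro smooth_on_compose[OF Do Om_open[OF c d] Phi_smooth[OF c d] smooth_on_subset[OF \<psi>]])
    then show "smooth_on ?D (\<lambda>(t, x). local_rep c d (\<lambda>p. F (t * \<rho> p) p) x)"
      by (simp add: Phi_def local_rep_def case_prod_unfold)
  next
    fix p assume "p \<in> topspace (topo M)"
    then show "F (0 * \<rho> p) p = f p" by (simp add: F_0)
  qed
qed (use compact eps in auto)

lemma rescaled_Vf:
  assumes f: "smooth_map M N f" and c: "c \<in> atlas M" and d: "d \<in> atlas N" and x: "x \<in> Wd f c d"
  shows "energy_variation.Vf (\<lambda>t p. F (t * \<rho> p) p) c d x = \<rho> (chart_inv c x) *\<^sub>R Vf c d x"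
proof -
  interpret R: energy_variation M g N h \<alpha> f \<epsilon> "\<lambda>t p. F (t * \<rho> p) p" by (rule rescaled_variation)
  have 1: "((\<lambda>t. R.Phi c d (t, x)) has_vector_derivative R.Vf c d x) (at 0)"
    using R.Phi_time_derivative[OF f c d R.Wd_Om[OF f c d x] R.Phi_smooth[OF c d]] by (simp add: R.Vf_def)
  let ?s = "\<rho> (chart_inv c x)"
  have "((\<lambda>t. Phi c d (t, x)) has_vector_derivative Vf c d x) (at 0)"
    using Phi_time_derivative[OF f c d Wd_Om[OF f c d x] Phi_smooth[OF c d]] by (simp add: Vf_def)
  then have "((\<lambda>t. Phi c d (t, x)) has_vector_derivative Vf c d x) (at (0 * ?s))" by simp
  moreover have "((\<lambda>t. t * ?s) has_vector_derivative ?s) (at 0)"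
    by (auto intro!: derivative_eq_intros simp: has_real_derivative_iff_has_vector_derivative[symmetric])
  ultimately have "(((\<lambda>t. Phi c d (t, x)) \<circ> (\<lambda>t. t * ?s)) has_vector_derivative ?s *\<^sub>R Vf c d x) (at 0)"
    using vector_diff_chain_at[of "\<lambda>t. t * ?s" ?s 0 "\<lambda>t. Phi c d (t, x)" "Vf c d x"] by blast
  moreover have "(\<lambda>t. Phi c d (t, x)) \<circ> (\<lambda>t. t * ?s) = (\<lambda>t. R.Phi c d (t, x))"
    by (auto simp: Phi_def R.Phi_def local_rep_def)
  ultimately have "((\<lambda>t. R.Phi c d (t, x)) has_vector_derivative ?s *\<^sub>R Vf c d x) (at 0)" by simp
  with 1 show ?thesis by (rule vector_derivative_unique_at)
qed

end

text \<open>Each function of the partition of unity gives a rescaled variation supported in one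
  coordinate ball, where the local formula yields 0. Since \<open>dQ\<close> is linear in the
  variation field and its derivatives, these contributions add up to the original one.\<close>

lemma integral_dQ_zero:
  assumes f: "smooth_map M N f"
    and EL: "\<And>c d x a. c \<in> atlas M \<Longrightarrow> d \<in> atlas N \<Longrightarrow> x \<in> Wd f c d \<Longrightarrow> EL \<alpha> f c d a x = 0"
  shows "(\<integral>p. dQ 0 p \<partial>M.\<mu>) = 0"
proof -
  \<comment> \<open>A closed coordinate ball inside \<open>Wd\<close> ensures that one pair of
    charts serves a whole piece. The open balls form the cover while the closed ones contain the
    supports.\<close>
  define good where "good = {(c, d, a, r). c \<in> atlas M \<and> d \<in> atlas N \<and> r > 0 \<and> cball a r \<subseteq> Wd f c d}"
  define U where "U = (\<lambda>(c :: ('a, 'm) chart, d :: ('b, 'n) chart, a, r). chart_inv c ` ball a r :: 'a set)"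
  define \<beta> where "\<beta> = (\<lambda>(c :: ('a, 'm) chart, d :: ('b, 'n) chart, a, r). M.chart_bump c a r)"
  define K where "K = (\<lambda>(c :: ('a, 'm) chart, d :: ('b, 'n) chart, a, r). chart_inv c ` cball a r :: 'a set)"
  have goodD: "openin (topo M) (U i)" "M.smooth_fun (\<beta> i)" "\<And>p. \<beta> i p \<ge> 0" "\<And>p. p \<in> U i \<Longrightarrow> \<beta> i p > 0"
    "\<And>p. p \<notin> K i \<Longrightarrow> \<beta> i p = 0" if good: "i \<in> good" for i
  proof -
    obtain c d a r where i: "i = (c, d, a, r)" by (cases i) auto
    have g: "c \<in> atlas M" "d \<in> atlas N" "r > 0" "cball a r \<subseteq> Wd f c d" using good by (auto simp: i good_def)
    have sub: "cball a r \<subseteq> chart_image c" using g(4) Wd_sub[OF f g(1,2)] by blast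
    have sub': "ball a r \<subseteq> chart_image c" using sub ball_subset_cball by blast
    show "openin (topo M) (U i)" unfolding U_def i split by (rule M.openin_chart_inv_image[OF g(1) _ sub']) simp
    show "M.smooth_fun (\<beta> i)" unfolding \<beta>_def i split by (rule M.chart_bump_smooth[OF g(1) sub g(3)])
    show "\<beta> i p \<ge> 0" for p unfolding \<beta>_def i split by (rule M.chart_bump_nonneg)
    show "\<beta> i p > 0" if "p \<in> U i" for p
      using that unfolding \<beta>_def U_def i split by (rule M.chart_bump_pos[OF g(1) sub g(3)])
    show "\<beta> i p = 0" if "p \<notin> K i" for p
      using that unfolding \<beta>_def K_def i split by (rule M.chart_bump_zero[OF g(1) sub g(3)])
  qed
  have "\<exists>i\<in>good. p \<in> U i" if p: "p \<in> topspace (topo M)" for p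
  proof -
    obtain c0 d0 where "c0 \<in> atlas M" "d0 \<in> atlas N" and cd: "c0 \<in> charts_at M p" "d0 \<in> charts_at N (f p)"
    proof -
      have "continuous_map (topo M) (topo N) f" using f by (simp add: smooth_map_def)
      from Wd_charts_ex[OF this p] show ?thesis using that M.charts_atD(1) N.charts_atD(1) by blast
    qed
    have x: "snd c0 p \<in> Wd f c0 d0" by (rule Wd_charts[where f = f, OF p cd])
    obtain r where r: "r > 0" "cball (snd c0 p) r \<subseteq> Wd f c0 d0"
      using Wd_open[OF f \<open>c0 \<in> atlas M\<close> \<open>d0 \<in> atlas N\<close>] x open_contains_cball by blast
    have "p \<in> chart_inv c0 ` ball (snd c0 p) r"
      using M.chart_inv_left[OF M.charts_atD[OF cd(1)]] r(1) by (intro image_eqI[of _ _ "snd c0 p"]) auto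
    then show ?thesis using r \<open>c0 \<in> atlas M\<close> \<open>d0 \<in> atlas N\<close>
      by (intro bexI[of _ "(c0, d0, snd c0 p, r)"]) (auto simp: U_def good_def)
  qed
  then have "topspace (topo M) \<subseteq> \<Union> (U ` good)" by auto
  then have "\<exists>\<F>. finite \<F> \<and> \<F> \<subseteq> U ` good \<and> topspace (topo M) \<subseteq> \<Union> \<F>"
    using compact[unfolded compact_space_alt, rule_format, of "U ` good"] goodD(1) by auto
  then obtain J where J: "J \<subseteq> good" "finite J" "topspace (topo M) \<subseteq> \<Union> (U ` J)"
    by (metis finite_subset_image)
  \<comment> \<open>The bumps are divided by their sum, which is positive because every point lies
    in one of the finitely many open balls.\<close>
  define B where "B p = (\<Sum>i\<in>J. \<beta> i p)" for p
  define \<rho> where "\<rho> i p = \<beta> i p / B p" for i p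
  have B_pos: "B p > 0" if p: "p \<in> topspace (topo M)" for p
  proof -
    obtain i where i: "i \<in> J" "p \<in> U i" using J(3) p by blast
    have "\<beta> i p > 0" using goodD(4)[of i p] i J(1) by blast
    then show ?thesis unfolding B_def
      by (rule sum_pos2[OF J(2) i(1)]) (rule goodD(3), use J(1) in blast)
  qed
  have \<rho>_smooth: "M.smooth_fun (\<rho> i)" if i: "i \<in> J" for i
    unfolding M.smooth_fun_def
  proof
    fix c assume c: "c \<in> atlas M"
    have "smooth_on (chart_image c) (\<lambda>x. \<beta> j (chart_inv c x))" if "j \<in> J" for j
      using goodD(2)[of j] that J(1) c by (auto simp: M.smooth_fun_def)
    moreover have "B (chart_inv c x) \<noteq> 0" if "x \<in> chart_image c" for x
      using B_pos[OF M.chart_inv_in_topspace[OF c that]] by simp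
    ultimately show "smooth_on (chart_image c) (\<lambda>x. \<rho> i (chart_inv c x))"
      unfolding \<rho>_def B_def using i by (intro smooth_intros M.chart_image_open c) auto
  qed
  have \<rho>_sum: "(\<Sum>i\<in>J. \<rho> i p) = 1" if "p \<in> topspace (topo M)" for p
    using B_pos[OF that] by (simp add: \<rho>_def sum_divide_distrib[symmetric] B_def[symmetric])
  have \<rho>01: "0 \<le> \<rho> i p \<and> \<rho> i p \<le> 1" if "i \<in> J" "p \<in> topspace (topo M)" for i p
  proof -
    have "\<rho> j p \<ge> 0" if "j \<in> J" for j
      using goodD(3)[of j p] J(1) that B_pos[OF \<open>p \<in> topspace (topo M)\<close>] by (auto simp: \<rho>_def)
    then show ?thesis using \<rho>_sum[OF that(2)] member_le_sum[of i J "\<lambda>i. \<rho> i p"] that J(2) by auto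
  qed
  define Fr where "Fr i = (\<lambda>t p. F (t * \<rho> i p) p)" for i
  have ev: "energy_variation M g N h f \<epsilon> (Fr i)" if "i \<in> J" for i
    unfolding Fr_def by (rule rescaled_variation[OF \<rho>_smooth[OF that] \<rho>01[OF that]])
  let ?dQ = "\<lambda>i. energy_variation.dQ M g N h \<alpha> (Fr i)"
  have zero: "(\<integral>p. ?dQ i 0 p \<partial>M.\<mu>) = 0" if i: "i \<in> J" for i
  proof -
    interpret R: energy_variation M g N h \<alpha> f \<epsilon> "Fr i" by (rule ev[OF i])
    obtain c d a r where ieq: "i = (c, d, a, r)" by (cases i) auto
    have g: "c \<in> atlas M" "d \<in> atlas N" "r > 0" "cball a r \<subseteq> Wd f c d"
      using i J(1) by (auto simp: ieq good_def)
    have supp: "Fr i t p = f p" if "p \<in> topspace (topo M)" "p \<notin> chart_inv c ` cball a r" for t p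
    proof -
      have "\<beta> i p = 0" using goodD(5)[of i p] i J(1) that(2) by (auto simp: K_def ieq)
      then show ?thesis by (simp add: Fr_def \<rho>_def F_0[OF that(1)])
    qed
    have "(\<integral>p. R.dQ 0 p \<partial>M.\<mu>)
      = - (\<integral>x. (if x \<in> Wd f c d then \<Sum>b\<in>UNIV. R.Vf c d x $ b * EL \<alpha> f c d b x else 0) \<partial>lborel)"
      by (rule R.first_variation_local[OF f g(1,2,4)]) (rule supp)
    also have "(\<lambda>x. if x \<in> Wd f c d then \<Sum>b\<in>UNIV. R.Vf c d x $ b * EL \<alpha> f c d b x else 0) = (\<lambda>x. 0)"
      by (rule ext) (simp add: EL[OF g(1,2)])
    finally show ?thesis by simp
  qed
  have sum: "dQ 0 p = (\<Sum>i\<in>J. ?dQ i 0 p)" if p: "p \<in> topspace (topo M)" for p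
  proof -
    have fc: "continuous_map (topo M) (topo N) f" using f by (simp add: smooth_map_def)
    obtain c d where cd: "c \<in> charts_at M p" "d \<in> charts_at N (f p)"
      using Wd_charts_ex[OF fc p] by blast
    note at = M.charts_atD(1)[OF cd(1)] N.charts_atD(1)[OF cd(2)]
    define x where "x = snd c p"
    have x: "x \<in> Wd f c d" unfolding x_def by (rule Wd_charts[where f = f, OF p cd])
    have inv: "chart_inv c x = p" unfolding x_def by (rule M.chart_inv_left[OF M.charts_atD[OF cd(1)]])
    let ?V = "\<lambda>i. energy_variation.Vf (Fr i) c d"
    let ?L = "variation_form (metric_matrix M g c x)
      (metric_matrix N h d (local_rep c d f x)) (\<lambda>j. pd j (metric_matrix N h d) (local_rep c d f x))
      (\<lambda>k. pd k (local_rep c d f) x)"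
    have V: "?V i y = \<rho> i (chart_inv c y) *\<^sub>R Vf c d y" if "i \<in> J" "y \<in> Wd f c d" for i y
      unfolding Fr_def by (rule rescaled_Vf[OF \<rho>_smooth[OF that(1)] \<rho>01[OF that(1)] f at that(2)])
    \<comment> \<open>Proved on all of \<open>Wd\<close>, so that it can be differentiated: the
      derivatives of the functions \<rho> cancel in the sum.\<close>
    have Vsum: "(\<Sum>i\<in>J. ?V i y) = Vf c d y" if "y \<in> Wd f c d" for y
    proof -
      have "(\<Sum>i\<in>J. ?V i y) = (\<Sum>i\<in>J. \<rho> i (chart_inv c y)) *\<^sub>R Vf c d y"
        using V that by (simp add: scaleR_sum_left)
      then show ?thesis
        using \<rho>_sum[OF M.chart_inv_in_topspace[OF at(1)]] Wd_sub[OF f at] that by auto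
    qed
    have dV: "?V i differentiable (at x)" if "i \<in> J" for i
      using energy_variation.Vf_smooth[OF ev[OF that] f at] smooth_on_imp_differentiable x by blast
    have pdV: "(\<Sum>i\<in>J. pd k (?V i) x) = pd k (Vf c d) x" for k
    proof -
      have "pd k (\<lambda>y. \<Sum>i\<in>J. ?V i y) x = (\<Sum>i\<in>J. pd k (?V i) x)"
        by (rule pd_sum) (rule dV)
      moreover have "pd k (\<lambda>y. \<Sum>i\<in>J. ?V i y) x = pd k (Vf c d) x"
        by (rule pd_cong_open[OF Wd_open[OF f at] x Vsum])
      ultimately show ?thesis by simp
    qed
    have "(\<Sum>i\<in>J. ?dQ i 0 p) = (\<Sum>i\<in>J. P0 \<alpha> f c d x * ?L (?V i x) (\<lambda>k. pd k (?V i) x))"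
    proof (rule sum.cong[OF refl])
      fix i assume "i \<in> J"
      from energy_variation.dQ_variation_form[OF ev[OF this] f at x, of \<alpha>]
      show "?dQ i 0 p = P0 \<alpha> f c d x * ?L (?V i x) (\<lambda>k. pd k (?V i) x)" unfolding inv .
    qed
    also have "\<dots> = P0 \<alpha> f c d x * ?L (\<Sum>i\<in>J. ?V i x) (\<lambda>k. \<Sum>i\<in>J. pd k (?V i) x)"
      by (simp only: variation_form_sum[OF J(2)] sum_distrib_left)
    also have "\<dots> = dQ 0 p"
      unfolding Vsum[OF x] pdV using dQ_variation_form[OF f at x] unfolding inv by simp
    finally show ?thesis by simp
  qed
  have "(\<integral>p. dQ 0 p \<partial>M.\<mu>) = (\<integral>p. (\<Sum>i\<in>J. ?dQ i 0 p) \<partial>M.\<mu>)"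
    by (rule Bochner_Integration.integral_cong) (simp_all add: sum M.space_mu[OF compact])
  also have "\<dots> = (\<Sum>i\<in>J. \<integral>p. ?dQ i 0 p \<partial>M.\<mu>)"
    by (rule Bochner_Integration.integral_sum) (rule energy_variation.dQ_integrable[OF ev])
  also have "\<dots> = 0" by (simp add: zero)
  finally show ?thesis .
qed

end

section \<open>Variations supported in a chart\<close>

context riem_pair begin

text \<open>Continuity into N can be tested in coordinates once a neighbourhood is known to map into
  a single chart domain; there the chart is injective, so membership in an open set can be recovered
  from coordinates.\<close>

lemma continuous_map_product_charts:
  fixes I :: "real set" and F :: "real \<Rightarrow> 'a \<Rightarrow> 'b"
  assumes "\<And>t p. t \<in> I \<Longrightarrow> p \<in> topspace (topo M) \<Longrightarrow> \<exists>c\<in>charts_at M p. \<exists>d\<in>atlas N. \<exists>S. open S \<and>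
    (t, snd c p) \<in> S \<and> S \<subseteq> I \<times> chart_image c \<and> (\<forall>z\<in>S. F (fst z) (chart_inv c (snd z)) \<in> fst d) \<and>
    continuous_on S (\<lambda>z. local_rep c d (F (fst z)) (snd z))"
  shows "continuous_map (prod_topology (top_of_set I) (topo M)) (topo N) (\<lambda>(t, p). F t p)"
  unfolding continuous_map_def
proof (intro conjI allI impI)
  show "(\<lambda>(t, p). F t p) \<in> topspace (prod_topology (top_of_set I) (topo M)) \<rightarrow> topspace (topo N)"
  proof
    fix z assume "z \<in> topspace (prod_topology (top_of_set I) (topo M))"
    then obtain t p where z: "z = (t, p)" "t \<in> I" "p \<in> topspace (topo M)" by auto
    obtain c d S where "c \<in> charts_at M p" "d \<in> atlas N" "(t, snd c p) \<in> S"
      "\<forall>z\<in>S. F (fst z) (chart_inv c (snd z)) \<in> fst d" using assms[OF z(2,3)] by blast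
    then have "F t p \<in> fst d" "d \<in> atlas N" using M.chart_inv_left[of c p] by (auto simp: charts_at_def)
    then show "(case z of (t, p) \<Rightarrow> F t p) \<in> topspace (topo N)"
      using openin_subset[OF N.chart_open[of d]] z by auto
  qed
  fix U assume U: "openin (topo N) U"
  let ?P = "{z \<in> topspace (prod_topology (top_of_set I) (topo M)). (case z of (t, p) \<Rightarrow> F t p) \<in> U}"
  show "openin (prod_topology (top_of_set I) (topo M)) ?P"
  proof (subst openin_subopen, intro ballI)
    fix z assume "z \<in> ?P"
    then obtain t p where z: "z = (t, p)" "t \<in> I" "p \<in> topspace (topo M)" "F t p \<in> U" by auto
    obtain c d S where c: "c \<in> charts_at M p" and d: "d \<in> atlas N"
      and S: "open S" "(t, snd c p) \<in> S" "S \<subseteq> I \<times> chart_image c"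
      "\<forall>z\<in>S. F (fst z) (chart_inv c (snd z)) \<in> fst d"
      "continuous_on S (\<lambda>z. local_rep c d (F (fst z)) (snd z))" using assms[OF z(2,3)] by blast
    have ca: "c \<in> atlas M" "p \<in> fst c" using M.charts_atD[OF c] by auto
    have inv: "chart_inv c (snd c p) = p" by (rule M.chart_inv_left[OF ca])
    define S' where "S' = (\<lambda>z. local_rep c d (F (fst z)) (snd z)) -` (snd d ` (fst d \<inter> U)) \<inter> S"
    have "open S'" unfolding S'_def
      by (rule continuous_on_open_vimage[OF S(1), THEN iffD1, OF S(5), rule_format])
         (rule N.open_chart_image[OF d U])
    moreover have "F t p \<in> fst d" using S(2,4) inv by force
    then have "(t, snd c p) \<in> S'" using S(2) z(4) inv by (auto simp: S'_def local_rep_def)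
    ultimately obtain A B where AB: "open A" "open B" "(t, snd c p) \<in> A \<times> B" "A \<times> B \<subseteq> S'"
      by (rule open_prod_elim)
    have Bi: "B \<subseteq> chart_image c" and Ai: "A \<subseteq> I" using AB(3,4) S(3) by (auto simp: S'_def)
    have "openin (topo M) (chart_inv c ` B)" by (rule M.openin_chart_inv_image[OF ca(1) AB(2) Bi])
    moreover have "openin (top_of_set I) A" using AB(1) Ai by (simp add: open_subset)
    ultimately have "openin (prod_topology (top_of_set I) (topo M)) (A \<times> chart_inv c ` B)"
      by (simp add: openin_prod_Times_iff)
    moreover have "z \<in> A \<times> chart_inv c ` B"
      using AB(3) inv z(1) by (auto intro!: image_eqI[of _ _ "snd c p"])
    moreover have "A \<times> chart_inv c ` B \<subseteq> ?P"
    proof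
      fix y assume "y \<in> A \<times> chart_inv c ` B"
      then obtain s x where y: "y = (s, chart_inv c x)" "s \<in> A" "x \<in> B" by auto
      then have "(s, x) \<in> S'" using AB(4) by auto
      then have "snd d (F s (chart_inv c x)) \<in> snd d ` (fst d \<inter> U)" "F s (chart_inv c x) \<in> fst d"
        using S(4) by (auto simp: S'_def local_rep_def)
      then have "F s (chart_inv c x) \<in> U" using N.chart_inj[OF d] by (auto dest: inj_onD)
      then show "y \<in> ?P"
        using y Ai M.chart_inv_in_topspace[OF ca(1)] Bi by auto
    qed
    ultimately show "\<exists>T. openin (prod_topology (top_of_set I) (topo M)) T \<and> z \<in> T \<and> T \<subseteq> ?P" by blast
  qed
qed

text \<open>Moves the image of the map along straight lines of the chart \<open>d\<close>, which
  replace geodesics, and leaves the map unchanged off the coordinate ball.\<close>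

definition bump_variation ::
    "('a \<Rightarrow> 'b) \<Rightarrow> ('a, 'm) chart \<Rightarrow> ('b, 'n) chart \<Rightarrow> real^'m \<Rightarrow> real \<Rightarrow> real^'n \<Rightarrow> real \<Rightarrow> 'a \<Rightarrow> 'b" where
  "bump_variation f c d a r w t p = (if p \<in> fst c \<and> snd c p \<in> Wd f c d
     then chart_inv d (local_rep c d f (snd c p) + (t * ball_bump a r (snd c p)) *\<^sub>R w) else f p)"

context
  fixes f :: "'a \<Rightarrow> 'b" and c :: "('a, 'm) chart" and d :: "('b, 'n) chart"
    and a :: "real^'m" and r :: real and w :: "real^'n" and \<epsilon> :: real
  assumes f: "smooth_map M N f" and c: "c \<in> atlas M" and d: "d \<in> atlas N"
    and cb: "cball a r \<subseteq> Wd f c d" and r: "r > 0" and eps: "\<epsilon> > 0"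
    and inside: "\<And>x t. x \<in> cball a r \<Longrightarrow> \<bar>t\<bar> < \<epsilon> \<Longrightarrow> local_rep c d f x + (t * ball_bump a r x) *\<^sub>R w \<in> chart_image d"
begin

abbreviation (input) "Fb \<equiv> bump_variation f c d a r w"
abbreviation (input) "curve \<equiv> \<lambda>t x. local_rep c d f x + (t * ball_bump a r x) *\<^sub>R w"

lemma curve_in: "x \<in> Wd f c d \<Longrightarrow> \<bar>t\<bar> < \<epsilon> \<Longrightarrow> curve t x \<in> chart_image d"
  using inside[of x t] rep_image[OF f c d] ball_bump_eq_0[OF r, of x a] by (cases "x \<in> cball a r") auto

lemma Fb_chart: "x \<in> Wd f c d \<Longrightarrow> Fb t (chart_inv c x) = chart_inv d (curve t x)"
  using M.chart_inv_in[of x c] M.chart_inv_right[of x c] by (auto simp: bump_variation_def Wd_def)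

lemma Fb_outside:
  assumes "p \<in> topspace (topo M)" "t = 0 \<or> p \<notin> chart_inv c ` cball a r" shows "Fb t p = f p"
proof (cases "p \<in> fst c \<and> snd c p \<in> Wd f c d")
  case True
  have inv: "chart_inv c (snd c p) = p" using M.chart_inv_left[OF c] True by blast
  have t0: "t * ball_bump a r (snd c p) = 0"
  proof (cases "t = 0")
    case False
    then have "snd c p \<notin> cball a r" using assms(2) inv by (metis image_eqI)
    then show ?thesis using ball_bump_eq_0[OF r] ball_subset_cball by (metis mult_zero_right subsetD)
  qed simp
  have "Fb t p = chart_inv d (local_rep c d f (snd c p))"
    by (simp only: bump_variation_def if_P[OF True] t0 scaleR_zero_left add_0_right)
  also have "\<dots> = f p"
    using N.chart_inv_left[OF d, of "f p"] True inv by (simp add: local_rep_def Wd_def)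
  finally show ?thesis .
next
  case False
  then show ?thesis unfolding bump_variation_def by (rule if_not_P)
qed

lemma curve_smooth: 
  assumes "open S" "smooth_on S \<tau>" "smooth_on S \<theta>" "\<theta> ` S \<subseteq> Wd f c d"
  shows "smooth_on S (\<lambda>z. curve (\<tau> z) (\<theta> z))"
  by (intro smooth_intros assms smooth_on_compose[OF assms(1) Wd_open[OF f c d] rep_smooth[OF f c d] assms(3,4)]
      smooth_on_compose[OF assms(1) _ smooth_on_ball_bump assms(3)]) auto

lemma outside_open:
  assumes "c' \<in> atlas M" "d' \<in> atlas N"
  shows "open (Wd f c' d' \<inter> {x \<in> chart_image c'. chart_inv c' x \<notin> chart_inv c ` cball a r})"
proof -
  have "cball a r \<subseteq> chart_image c" using cb Wd_sub[OF f c d] by blast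
  then show ?thesis
    by (intro open_Int Wd_open[OF f assms] M.open_chart_complement[OF assms(1)] M.closedin_chart_cball[OF c])
qed

text \<open>At points of the supporting ball the coordinate formula holds on a neighbourhood. At all
  other points the closedness of the ball provides a neighbourhood on which the variation is
  constant in time.\<close>

lemma bump_variation_continuous:
  "continuous_map (prod_topology (top_of_set {-\<epsilon><..<\<epsilon>}) (topo M)) (topo N) (\<lambda>(t, p). Fb t p)"
proof (rule continuous_map_product_charts)
  fix t :: real and p assume t: "t \<in> {-\<epsilon><..<\<epsilon>}" and p: "p \<in> topspace (topo M)"
  let ?K = "chart_inv c ` cball a r" and ?I = "{-\<epsilon><..<\<epsilon>}"
  let ?goal = "\<lambda>c' d' S. c' \<in> charts_at M p \<and> d' \<in> atlas N \<and> open S \<and>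
    (t, snd c' p) \<in> S \<and> S \<subseteq> ?I \<times> chart_image c' \<and> (\<forall>z\<in>S. Fb (fst z) (chart_inv c' (snd z)) \<in> fst d') \<and>
    continuous_on S (\<lambda>z. local_rep c' d' (Fb (fst z)) (snd z))"
  have "\<exists>c' d' S. ?goal c' d' S"
  proof (cases "p \<in> ?K")
    case True
    then obtain x where x: "x \<in> cball a r" "p = chart_inv c x" by auto
    have xW: "x \<in> Wd f c d" using x cb by blast
    have xi: "x \<in> chart_image c" using xW Wd_sub[OF f c d] by blast
    let ?S = "?I \<times> Wd f c d"
    have S: "open ?S" by (intro open_Times Wd_open[OF f c d]) auto
    have cp: "c \<in> charts_at M p" "snd c p = x"
      using c x(2) M.chart_inv_in[OF xi] M.chart_inv_right[OF xi] by (auto simp: charts_at_def)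
    have ci: "curve (fst z) (snd z) \<in> chart_image d" if "z \<in> ?S" for z
      using that by (intro curve_in) auto
    have "smooth_on ?S (\<lambda>z. curve (fst z) (snd z))"
      by (rule curve_smooth[OF S smooth_on_bounded_linear[OF bounded_linear_fst S]
            smooth_on_bounded_linear[OF bounded_linear_snd S]]) auto
    then have "continuous_on ?S (\<lambda>z. curve (fst z) (snd z))" by (rule smooth_on_imp_continuous_on)
    moreover have "curve (fst z) (snd z) = local_rep c d (Fb (fst z)) (snd z)" if "z \<in> ?S" for z
    proof -
      have "local_rep c d (Fb (fst z)) (snd z) = snd d (chart_inv d (curve (fst z) (snd z)))"
        using that Fb_chart by (auto simp: local_rep_def)
      then show ?thesis using N.chart_inv_right[OF ci[OF that]] by simp
    qed
    ultimately have "continuous_on ?S (\<lambda>z. local_rep c d (Fb (fst z)) (snd z))"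
      by (rule continuous_on_eq)
    moreover have "Fb (fst z) (chart_inv c (snd z)) \<in> fst d" if "z \<in> ?S" for z
      using that Fb_chart N.chart_inv_in[OF ci[OF that]] by auto
    ultimately have "?goal c d ?S" using cp d S t xW Wd_sub[OF f c d] by auto
    then show ?thesis by blast
  next
    case False
    obtain c' d' where cd: "c' \<in> charts_at M p" "d' \<in> charts_at N (f p)"
      using Wd_charts_ex[OF f_continuous[OF f c d] p] by blast
    note at = M.charts_atD(1)[OF cd(1)] N.charts_atD(1)[OF cd(2)]
    let ?V = "Wd f c' d' \<inter> {x \<in> chart_image c'. chart_inv c' x \<notin> ?K}"
    let ?S = "?I \<times> ?V"
    have S: "open ?S" by (intro open_Times outside_open[OF at]) auto
    have x: "snd c' p \<in> ?V"
      using Wd_charts[where f = f, OF p cd] False M.chart_inv_left[OF M.charts_atD[OF cd(1)]] Wd_sub[OF f at] by auto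
    have Feq: "Fb (fst z) (chart_inv c' (snd z)) = f (chart_inv c' (snd z))" if "z \<in> ?S" for z
      using that M.chart_inv_in_topspace[OF at(1)] by (intro Fb_outside) auto
    have "continuous_on ?S (\<lambda>z. local_rep c' d' f (snd z))"
      by (rule continuous_on_compose2[OF smooth_on_imp_continuous_on[OF rep_smooth[OF f at]]])
         (auto intro: continuous_on_snd continuous_on_id)
    then have "continuous_on ?S (\<lambda>z. local_rep c' d' (Fb (fst z)) (snd z))"
      by (rule continuous_on_eq) (simp only: local_rep_def Feq)
    moreover have "Fb (fst z) (chart_inv c' (snd z)) \<in> fst d'" if "z \<in> ?S" for z
      unfolding Feq[OF that] using that by (auto simp: Wd_def)
    ultimately have "?goal c' d' ?S" using cd at S t x by auto
    then show ?thesis by blast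
  qed
  then show "\<exists>c'\<in>charts_at M p. \<exists>d'\<in>atlas N. \<exists>S. open S \<and>
    (t, snd c' p) \<in> S \<and> S \<subseteq> ?I \<times> chart_image c' \<and> (\<forall>z\<in>S. Fb (fst z) (chart_inv c' (snd z)) \<in> fst d') \<and>
    continuous_on S (\<lambda>z. local_rep c' d' (Fb (fst z)) (snd z))"
    by blast
qed

text \<open>Smoothness is demanded for all pairs of charts, so near the support the coordinate curve
  is composed with transition maps on both sides; elsewhere the variation equals the smooth map
  itself.\<close>

lemma bump_variation_smooth:
  assumes at: "c' \<in> atlas M" "d' \<in> atlas N"
  shows "smooth_on {(t, x). t \<in> {-\<epsilon><..<\<epsilon>} \<and> x \<in> chart_image c' \<and> Fb t (chart_inv c' x) \<in> fst d'}
    (\<lambda>(t, x). local_rep c' d' (Fb t) x)"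
proof (rule smooth_on_locally)
  fix z assume z: "z \<in> {(t, x). t \<in> {-\<epsilon><..<\<epsilon>} \<and> x \<in> chart_image c' \<and> Fb t (chart_inv c' x) \<in> fst d'}"
  let ?K = "chart_inv c ` cball a r" and ?I = "{-\<epsilon><..<\<epsilon>}"
  obtain t x where zt: "z = (t, x)" "t \<in> ?I" "x \<in> chart_image c'" "Fb t (chart_inv c' x) \<in> fst d'" using z by auto
  have p: "chart_inv c' x \<in> topspace (topo M)" by (rule M.chart_inv_in_topspace[OF at(1) zt(3)])
  show "\<exists>U. open U \<and> z \<in> U \<and> smooth_on U (\<lambda>(t, x). local_rep c' d' (Fb t) x)"
  proof (cases "chart_inv c' x \<in> ?K")
    case False
    let ?V = "Wd f c' d' \<inter> {x \<in> chart_image c'. chart_inv c' x \<notin> ?K}"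
    let ?S = "?I \<times> ?V"
    have S: "open ?S" by (intro open_Times outside_open[OF at]) auto
    have "f (chart_inv c' x) \<in> fst d'" using Fb_outside[OF p, of t] False zt(4) by simp
    then have zS: "z \<in> ?S" using zt False by (auto simp: Wd_def)
    have "smooth_on ?S (\<lambda>z. local_rep c' d' f (snd z))"
      by (rule smooth_on_compose[OF S Wd_open[OF f at] rep_smooth[OF f at]
            smooth_on_bounded_linear[OF bounded_linear_snd S]]) auto
    moreover have "(case z of (t, x) \<Rightarrow> local_rep c' d' (Fb t) x) = local_rep c' d' f (snd z)" if "z \<in> ?S" for z
      using that M.chart_inv_in_topspace[OF at(1)] Fb_outside by (auto simp: local_rep_def)
    ultimately have "smooth_on ?S (\<lambda>(t, x). local_rep c' d' (Fb t) x)"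
      using smooth_on_cong[OF S, of "\<lambda>(t, x). local_rep c' d' (Fb t) x"] by simp
    then show ?thesis using S zS by blast
  next
    case True
    let ?\<theta> = "\<lambda>x. snd c (chart_inv c' x)"
    let ?O = "snd c' ` (fst c' \<inter> fst c)"
    have O: "open ?O" by (rule M.open_overlap[OF at(1) c])
    have \<theta>: "smooth_on ?O ?\<theta>" using M.smooth_transition[OF at(1) c] by simp
    let ?O1 = "?\<theta> -` Wd f c d \<inter> ?O"
    have O1: "open ?O1"
      by (rule continuous_on_open_vimage[OF O, THEN iffD1, OF smooth_on_imp_continuous_on[OF \<theta>], rule_format])
         (rule Wd_open[OF f c d])
    let ?S1 = "?I \<times> ?O1"
    have S1: "open ?S1" using O1 by (intro open_Times) auto
    let ?\<kappa> = "\<lambda>z. curve (fst z) (?\<theta> (snd z))"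
    have \<theta>1: "smooth_on ?S1 (\<lambda>z. ?\<theta> (snd z))"
      by (rule smooth_on_compose[where f = snd and g = ?\<theta>, OF S1 O \<theta>
            smooth_on_bounded_linear[OF bounded_linear_snd S1]]) auto
    have \<kappa>: "smooth_on ?S1 ?\<kappa>"
      by (rule curve_smooth[OF S1 smooth_on_bounded_linear[OF bounded_linear_fst S1] \<theta>1]) auto
    let ?Z = "snd d ` (fst d \<inter> fst d')"
    have Z: "open ?Z" by (rule N.open_overlap[OF d at(2)])
    \<comment> \<open>Only those times and points are kept at which the moved value lies in both
      target charts; the transition map is defined on that set.\<close>
    let ?S = "?\<kappa> -` ?Z \<inter> ?S1"
    have S: "open ?S"
      by (rule continuous_on_open_vimage[OF S1, THEN iffD1, OF smooth_on_imp_continuous_on[OF \<kappa>], rule_format])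
         (rule Z)
    have "?\<kappa> ` ?S \<subseteq> ?Z" by auto
    then have "smooth_on ?S (\<lambda>z. snd d' (chart_inv d (?\<kappa> z)))"
      by (rule smooth_on_compose[where g = "\<lambda>y. snd d' (chart_inv d y)", OF S Z
            N.smooth_transition[OF d at(2), simplified] smooth_on_subset[OF \<kappa> Int_lower2]])
    moreover have F_eq: "Fb s (chart_inv c' y) = chart_inv d (curve s (?\<theta> y))" if "y \<in> ?O1" for s y
    proof -
      have "chart_inv c' y \<in> fst c" using that M.overlap_image[OF at(1)] by blast
      then have "chart_inv c (?\<theta> y) = chart_inv c' y" by (rule M.chart_inv_left[OF c])
      then show ?thesis using Fb_chart[of "?\<theta> y" s] that by simp
    qed
    have "(case z of (t, x) \<Rightarrow> local_rep c' d' (Fb t) x) = snd d' (chart_inv d (?\<kappa> z))" if "z \<in> ?S" for z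
      using that F_eq by (auto simp: local_rep_def)
    ultimately have "smooth_on ?S (\<lambda>(t, x). local_rep c' d' (Fb t) x)"
      using smooth_on_cong[OF S, of "\<lambda>(t, x). local_rep c' d' (Fb t) x"] by simp
    moreover have "z \<in> ?S"
    proof -
      obtain y where y: "y \<in> cball a r" "chart_inv c' x = chart_inv c y" using True by auto
      have yW: "y \<in> Wd f c d" using y cb by blast
      have yi: "y \<in> chart_image c" using yW Wd_sub[OF f c d] by blast
      have \<theta>x: "?\<theta> x = y" unfolding y(2) by (rule M.chart_inv_right[OF yi])
      have "chart_inv c' x \<in> fst c" using y(2) M.chart_inv_in[OF yi] by simp
      with zt(3) have xO: "x \<in> ?O" by (intro M.overlap_image[OF at(1), THEN iffD2] conjI)
      have xO1: "x \<in> ?O1" using xO \<theta>x yW by simp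
      have ci: "curve t y \<in> chart_image d" using zt(2) by (intro curve_in yW) auto
      have "chart_inv d (curve t y) \<in> fst d'" using zt(4) F_eq[OF xO1, of t] \<theta>x by simp
      then have "curve t y \<in> ?Z" using N.overlap_image[OF d] ci by blast
      then show ?thesis using zt(1,2) xO1 \<theta>x by simp
    qed
    ultimately show ?thesis using S by blast
  qed
qed

lemma bump_smooth_variation: "smooth_variation M N f \<epsilon> Fb"
  unfolding smooth_variation_def
  using bump_variation_continuous bump_variation_smooth Fb_outside[of _ 0] by blast

end

text \<open>A function of constant sign with zero integral vanishes almost everywhere, but a ball of
  positive radius is not negligible. The factor \<sigma> lets one argument cover both signs.\<close>

lemma integral_bump_EL_nonzero:
  fixes u :: "real^'m \<Rightarrow> real"
  assumes "integrable lborel u" "r > 0" "\<And>x. \<sigma> * u x \<ge> 0" "\<And>x. x \<in> ball a r \<Longrightarrow> \<sigma> * u x > 0"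
  shows "(\<integral>x. u x \<partial>lborel) \<noteq> 0"
proof
  assume "(\<integral>x. u x \<partial>lborel) = 0"
  then have "(\<integral>x. \<sigma> * u x \<partial>lborel) = 0" by simp
  then have "AE x in lborel. \<sigma> * u x = 0"
    using integral_nonneg_eq_0_iff_AE[of lborel "\<lambda>x. \<sigma> * u x"] assms(1,3) by simp
  then obtain Z where Z: "Z \<in> null_sets lborel" "{x \<in> space lborel. \<not> \<sigma> * u x = 0} \<subseteq> Z"
    by (auto simp: eventually_ae_filter)
  then have "ball a r \<subseteq> Z" using assms(4) by force
  moreover have "negligible Z" using Z(1) by (simp add: negligible_iff_null_sets null_sets_completionI)
  ultimately have "negligible (ball a r)" using negligible_subset by blast
  then show False using open_not_negligible[of "ball a r"] assms(2) by simp
qed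

lemma exp_bump_le_1: "exp_bump s \<le> 1"
  by (simp add: exp_bump_def)

lemma non_critical_variation:
  assumes compact: "compact_space (topo M)" and f: "smooth_map M N f" and c: "c \<in> atlas M" and d: "d \<in> atlas N"
    and x0: "x0 \<in> Wd f c d" and EL: "EL \<alpha> f c d b x0 \<noteq> 0"
  shows "\<exists>\<epsilon>>0. \<exists>F. smooth_variation M N f \<epsilon> F \<and>
    \<not> ((\<lambda>t. alpha_energy \<alpha> M g N h (F t)) has_real_derivative 0) (at 0)"
proof -
  \<comment> \<open>The value at \<open>x0\<close> serves as the sign: its product with the
    continuous function \<open>EL\<close> is positive near \<open>x0\<close>. The direction
    \<open>axis b 1\<close> singles out the component that does not vanish.\<close>
  let ?\<sigma> = "EL \<alpha> f c d b x0" and ?w = "axis b 1 :: real^'n"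
  let ?W0 = "(\<lambda>x. ?\<sigma> * EL \<alpha> f c d b x) -` {0<..} \<inter> Wd f c d"
  have "continuous_on (Wd f c d) (\<lambda>x. ?\<sigma> * EL \<alpha> f c d b x)"
    by (intro continuous_on_mult_left smooth_on_imp_continuous_on EL_smooth[OF f c d])
  then have "open ?W0"
    by (rule continuous_on_open_vimage[OF Wd_open[OF f c d], THEN iffD1, rule_format]) simp
  moreover have "x0 \<in> ?W0" using x0 EL by (auto simp: zero_less_mult_iff)
  ultimately obtain r where r: "r > 0" "cball x0 r \<subseteq> ?W0" using open_contains_cball by blast
  have cb: "cball x0 r \<subseteq> Wd f c d" using r(2) by blast
  have "compact (local_rep c d f ` cball x0 r)"
    by (intro compact_continuous_image continuous_on_subset[OF smooth_on_imp_continuous_on[OF rep_smooth[OF f c d]] cb]) auto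
  moreover have "local_rep c d f ` cball x0 r \<subseteq> chart_image d" using rep_image[OF f c d] cb by blast
  \<comment> \<open>The compact image of the ball has a uniform margin inside the chart image. The
    bump is at most 1 and the direction has norm 1, so times below this margin keep the moved points
    in the chart.\<close>
  ultimately obtain \<epsilon> where \<epsilon>: "\<epsilon> > 0" "(\<Union>y\<in>local_rep c d f ` cball x0 r. ball y \<epsilon>) \<subseteq> chart_image d"
    using compact_subset_open_imp_ball_epsilon_subset[OF _ N.chart_image_open[OF d]] by metis
  have inside: "local_rep c d f x + (t * ball_bump x0 r x) *\<^sub>R ?w \<in> chart_image d"
    if "x \<in> cball x0 r" "\<bar>t\<bar> < \<epsilon>" for x t
  proof -
    have "\<bar>t * ball_bump x0 r x\<bar> \<le> \<bar>t\<bar> * 1"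
      unfolding abs_mult using ball_bump_nonneg[of x0 r x] exp_bump_le_1
      by (intro mult_left_mono) (auto simp: ball_bump_def)
    then have "norm ((t * ball_bump x0 r x) *\<^sub>R ?w) < \<epsilon>" using that(2) by (simp add: norm_axis_1)
    then have "local_rep c d f x + (t * ball_bump x0 r x) *\<^sub>R ?w \<in> ball (local_rep c d f x) \<epsilon>"
      by (simp add: dist_norm)
    then show ?thesis using \<epsilon>(2) that(1) by blast
  qed
  let ?F = "bump_variation f c d x0 r ?w"
  note ctx = f c d cb r(1) \<epsilon>(1) inside
  have var: "smooth_variation M N f \<epsilon> ?F" by (rule bump_smooth_variation[OF ctx])
  interpret V: energy_variation M g N h \<alpha> f \<epsilon> ?F
    by unfold_locales (use compact \<epsilon> var in auto)
  have Vf: "V.Vf c d x = ball_bump x0 r x *\<^sub>R ?w" if x: "x \<in> Wd f c d" for x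
  proof -
    have "((\<lambda>t. V.Phi c d (t, x)) has_vector_derivative V.Vf c d x) (at 0)"
      using V.Phi_time_derivative[OF f c d V.Wd_Om[OF f c d x] V.Phi_smooth[OF c d]] by (simp add: V.Vf_def)
    moreover have "((\<lambda>t. V.Phi c d (t, x)) has_vector_derivative ball_bump x0 r x *\<^sub>R ?w) (at 0)"
    proof (rule has_vector_derivative_transform_within_open[where S = "{-\<epsilon><..<\<epsilon>}"])
      show "((\<lambda>t. local_rep c d f x + (t * ball_bump x0 r x) *\<^sub>R ?w) has_vector_derivative ball_bump x0 r x *\<^sub>R ?w) (at 0)"
        unfolding has_vector_derivative_def by (auto intro!: derivative_eq_intros)
      fix t assume "t \<in> {-\<epsilon><..<\<epsilon>}"
      then have t: "\<bar>t\<bar> < \<epsilon>" by auto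
      show "local_rep c d f x + (t * ball_bump x0 r x) *\<^sub>R ?w = V.Phi c d (t, x)"
        using Fb_chart[OF ctx x, of t] N.chart_inv_right[OF curve_in[OF ctx x t]]
        by (simp add: V.Phi_def local_rep_def)
    qed (use \<epsilon> in auto)
    ultimately show ?thesis by (rule vector_derivative_unique_at)
  qed
  define u where "u x = (if x \<in> Wd f c d then \<Sum>j\<in>UNIV. V.Vf c d x $ j * EL \<alpha> f c d j x else 0)" for x
  have u_eq: "u x = (if x \<in> Wd f c d then ball_bump x0 r x * EL \<alpha> f c d b x else 0)" for x
  proof -
    have "(\<Sum>j\<in>UNIV. V.Vf c d x $ j * EL \<alpha> f c d j x) = ball_bump x0 r x * EL \<alpha> f c d b x" if "x \<in> Wd f c d"
    proof -
      have "(\<Sum>j\<in>UNIV. V.Vf c d x $ j * EL \<alpha> f c d j x)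
          = (\<Sum>j\<in>UNIV. if j = b then ball_bump x0 r x * EL \<alpha> f c d j x else 0)"
        unfolding Vf[OF that] by (rule sum.cong) (auto simp: axis_def)
      then show ?thesis by simp
    qed
    then show ?thesis by (simp add: u_def)
  qed
  have b0: "ball_bump x0 r x = 0" if "x \<notin> cball x0 r" for x
    by (rule ball_bump_eq_0[OF r(1)]) (use that in auto)
  have "smooth_on UNIV (\<lambda>x. if x \<in> Wd f c d then ball_bump x0 r x * EL \<alpha> f c d b x else 0)"
    by (rule smooth_on_zero_extension[OF Wd_open[OF f c d] cb])
       (auto intro!: smooth_intros Wd_open[OF f c d] EL_smooth[OF f c d] smooth_on_subset[OF smooth_on_ball_bump] simp: b0)
  then have "smooth_on UNIV u" by (simp add: u_eq[abs_def])
  then have iu: "integrable lborel u"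
    by (intro integrable_compact_support[where a = x0 and r = r] smooth_on_imp_continuous_on) (auto simp: u_eq b0)
  have pos: "?\<sigma> * u x > 0" if "x \<in> ball x0 r" for x
  proof -
    have "x \<in> cball x0 r" using that by auto
    then have "x \<in> ?W0" by (rule subsetD[OF r(2)])
    then have "?\<sigma> * EL \<alpha> f c d b x > 0" "x \<in> Wd f c d" by auto
    have "ball_bump x0 r x > 0" using that ball_bump_pos_iff[OF r(1)] by blast
    then have "ball_bump x0 r x * (?\<sigma> * EL \<alpha> f c d b x) > 0"
      using \<open>?\<sigma> * EL \<alpha> f c d b x > 0\<close> by (rule mult_pos_pos)
    then show ?thesis using \<open>x \<in> Wd f c d\<close> by (simp add: u_eq mult.left_commute)
  qed
  have zero: "?\<sigma> * u x = 0" if "x \<notin> ball x0 r" for x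
    using ball_bump_eq_0[OF r(1) that] by (simp add: u_eq)
  \<comment> \<open>Positive on the open ball and zero elsewhere, so the whole integrand has one
    sign.\<close>
  have "?\<sigma> * u x \<ge> 0" for x
    using less_imp_le[OF pos[of x]] zero[of x] by (cases "x \<in> ball x0 r") linarith+
  then have "(\<integral>x. u x \<partial>lborel) \<noteq> 0" using integral_bump_EL_nonzero[OF iu r(1) _ pos] by blast
  moreover have "(\<integral>p. V.dQ 0 p \<partial>M.\<mu>) = - (\<integral>x. u x \<partial>lborel)"
    unfolding u_def by (rule V.first_variation_local[OF f c d cb]) (rule Fb_outside[OF ctx], auto)
  ultimately have "(\<integral>p. V.dQ 0 p \<partial>M.\<mu>) \<noteq> 0" by simp
  then show ?thesis using V.energy_critical_iff \<epsilon>(1) var by blast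
qed

end

theorem proposition3:
  fixes \<alpha> :: real
    and M :: "('a, 'm::finite) manifold" and g :: "('a, 'm) metric"
    and N :: "('b, 'n::finite) manifold" and h :: "('b, 'n) metric"
    and \<psi> :: "'a \<Rightarrow> 'b"
  assumes "\<alpha> > 1"
    and "riemannian_manifold M g" and "compact_space (topo M)" and "CARD('m) > 2"
    and "riemannian_manifold N h"
    and "smooth_map M N \<psi>" and "nondegenerate M N \<psi>"
  shows "alpha_harmonic \<alpha> M g N h \<psi> \<longleftrightarrow>
    harmonic M
      (\<lambda>p u v. ((2 * \<alpha>) powr (2 / (real CARD('m) - 2)) *
         (1 + (hs_norm M g N h \<psi> p)\<^sup>2) powr ((2 * \<alpha> - 2) / (real CARD('m) - 2))) * g p u v)
      N h \<psi>"
proof -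
  interpret riem_pair M g N h
    using assms(2,5) by unfold_locales
  have conf: "(\<lambda>p u v. ((2 * \<alpha>) powr (2 / (real CARD('m) - 2)) *
         (1 + (hs_norm M g N h \<psi> p)\<^sup>2) powr ((2 * \<alpha> - 2) / (real CARD('m) - 2))) * g p u v) = conf_metric \<alpha> \<psi>"
    by (simp add: conf_def)
  show ?thesis
    unfolding conf harmonic_iff_EL[OF assms(1,4,6)]
  proof
    assume crit: "alpha_harmonic \<alpha> M g N h \<psi>"
    show "\<forall>c\<in>atlas M. \<forall>d\<in>atlas N. \<forall>x\<in>Wd \<psi> c d. \<forall>a. EL \<alpha> \<psi> c d a x = 0"
    \<comment> \<open>By contraposition: a single component of \<open>EL\<close> that is nonzero at
      a single point already produces a variation contradicting criticality.\<close>
    proof (intro ballI allI, rule ccontr)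
      fix c d x a assume "c \<in> atlas M" "d \<in> atlas N" "x \<in> Wd \<psi> c d" "EL \<alpha> \<psi> c d a x \<noteq> 0"
      from non_critical_variation[OF assms(3,6) this] show False
        using crit unfolding alpha_harmonic_def by blast
    qed
  next
    assume EL: "\<forall>c\<in>atlas M. \<forall>d\<in>atlas N. \<forall>x\<in>Wd \<psi> c d. \<forall>a. EL \<alpha> \<psi> c d a x = 0"
    show "alpha_harmonic \<alpha> M g N h \<psi>"
      unfolding alpha_harmonic_def
    proof (intro allI impI)
      fix \<epsilon> :: real and F assume \<epsilon>: "\<epsilon> > 0" "smooth_variation M N \<psi> \<epsilon> F"
      interpret energy_variation M g N h \<alpha> \<psi> \<epsilon> F
        using \<epsilon> assms(3) by unfold_locales
      show "((\<lambda>t. alpha_energy \<alpha> M g N h (F t)) has_real_derivative 0) (at 0)"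
        unfolding energy_critical_iff by (rule integral_dQ_zero[OF assms(6)]) (use EL in blast)
    qed
  qed
qed

end
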